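(* Let $N$ be a positive integer, $p\in[2,+\infty)$, $f\in L^p(\mathbb{R}^N)$ and $\lambda<0$. Then the problem $$(\Delta^2-\lambda)u=f,\qquad u\in W^{2,p}(\mathbb{R}^N),$$ possesses a unique solution.
   Context: All functions are real-valued. The equation is understood in the weak (distributional) sense: $\int_{\mathbb{R}^N}\Delta u\,\Delta z\,dx=\int_{\mathbb{R}^N}(\lambda u+f)z\,dx$ for all $z\in C_0^\infty(\mathbb{R}^N)$. *)

theory Defs
  imports "HOL-Analysis.Analysis"
begin

text \<open>
  Functions on $R^N$ have type \<open>real ^ 'n \<Rightarrow> real\<close> with \<open>N = CARD('n)\<close>.  Elements of
  $L^p$ and $W^{k,p}$ are represented by functions, not by classes modulo almost everywhere
  equality.
\<close>

definition partial_derivative :: "'n::finite \<Rightarrow> (real ^ 'n \<Rightarrow> real) \<Rightarrow> real ^ 'n \<Rightarrow> real" where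
  "partial_derivative i \<phi> x = frechet_derivative \<phi> (at x) (axis i 1)"

text \<open>
  A derivative of order \<open>k\<close> is indexed by a list of \<open>k\<close> coordinate directions instead of a
  multi-index of length \<open>k\<close>.  On smooth functions the order of the list is irrelevant, so both
  index the same family of derivatives.
\<close>

primrec iter_partial :: "'n::finite list \<Rightarrow> (real ^ 'n \<Rightarrow> real) \<Rightarrow> real ^ 'n \<Rightarrow> real" where
  "iter_partial [] \<phi> = \<phi>"
| "iter_partial (i # is) \<phi> = partial_derivative i (iter_partial is \<phi>)"

text \<open>
  Differentiability of every iterated partial derivative entails their continuity; hence
  \<open>smooth\<close> is $C^\infty(R^N)$.
\<close>

definition smooth :: "(real ^ 'n::finite \<Rightarrow> real) \<Rightarrow> bool" where
  "smooth \<phi> \<longleftrightarrow> (\<forall>is. iter_partial is \<phi> differentiable_on UNIV)"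

definition test_functions :: "(real ^ 'n::finite \<Rightarrow> real) set" where
  "test_functions = {\<phi>. smooth \<phi> \<and> compact (closure {x. \<phi> x \<noteq> 0})}"

definition laplacian :: "(real ^ 'n::finite \<Rightarrow> real) \<Rightarrow> real ^ 'n \<Rightarrow> real" where
  "laplacian \<phi> x = (\<Sum>i\<in>UNIV. iter_partial [i, i] \<phi> x)"

definition Lp_space :: "real \<Rightarrow> (real ^ 'n::finite \<Rightarrow> real) set" where
  "Lp_space p = {u \<in> borel_measurable lebesgue. integrable lebesgue (\<lambda>x. \<bar>u x\<bar> powr p)}"

definition locally_integrable :: "(real ^ 'n::finite \<Rightarrow> real) \<Rightarrow> bool" where
  "locally_integrable u \<longleftrightarrow> (\<forall>K. compact K \<longrightarrow> u absolutely_integrable_on K)"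

definition has_weak_derivative ::
  "(real ^ 'n::finite \<Rightarrow> real) \<Rightarrow> 'n list \<Rightarrow> (real ^ 'n \<Rightarrow> real) \<Rightarrow> bool" where
  "has_weak_derivative u is g \<longleftrightarrow>
     locally_integrable u \<and> locally_integrable g \<and>
     (\<forall>\<phi>\<in>test_functions.
        (LINT x|lebesgue. u x * iter_partial is \<phi> x) =
        (-1) ^ length is * (LINT x|lebesgue. g x * \<phi> x))"

definition sobolev_space :: "nat \<Rightarrow> real \<Rightarrow> (real ^ 'n::finite \<Rightarrow> real) set" where
  "sobolev_space k p =
     {u \<in> Lp_space p. \<forall>is. length is \<le> k \<longrightarrow> (\<exists>g\<in>Lp_space p. has_weak_derivative u is g)}"

text \<open>
  Weak derivatives are unique only up to null sets, so \<open>weak_derivative\<close> selects a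
  representative; it is meaningful only if a weak derivative exists.
\<close>

definition weak_derivative ::
  "'n::finite list \<Rightarrow> (real ^ 'n \<Rightarrow> real) \<Rightarrow> real ^ 'n \<Rightarrow> real" where
  "weak_derivative is u = (SOME g. has_weak_derivative u is g)"

definition weak_laplacian :: "(real ^ 'n::finite \<Rightarrow> real) \<Rightarrow> real ^ 'n \<Rightarrow> real" where
  "weak_laplacian u x = (\<Sum>i\<in>UNIV. weak_derivative [i, i] u x)"

text \<open>The weak form of $(\Delta^2 - \mu) u = f$, for \<open>u\<close> with weak second derivatives.\<close>

definition weakly_solves ::
  "real \<Rightarrow> (real ^ 'n::finite \<Rightarrow> real) \<Rightarrow> (real ^ 'n \<Rightarrow> real) \<Rightarrow> bool" where
  "weakly_solves \<mu> f u \<longleftrightarrow>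
     (\<forall>z\<in>test_functions.
        (LINT x|lebesgue. weak_laplacian u x * laplacian z x) =
        (LINT x|lebesgue. (\<mu> * u x + f x) * z x))"

end

theory Submission
  imports Defs "HOL-Probability.Sinc_Integral"
begin

text \<open>
  Write \<open>\<mu> = - s\<^sup>2\<close> with \<open>s > 0\<close>. The operator
  \<open>\<Delta>\<^sup>2 + s\<^sup>2\<close> has a fundamental solution \<open>G\<close> which is
  integrable together with its derivatives of order at most two. Hence \<open>u = G * f\<close> lies in
  $W^{2,p}$ by Young's inequality. Uniqueness is dual: for a test function \<open>\<eta>\<close> the
  identity \<open>\<eta> = G * (\<Delta>\<^sup>2 \<eta> + s\<^sup>2 \<eta>)\<close> and Fubini's
  theorem express the integral of \<open>v \<eta>\<close> through \<open>f\<close>, for every solution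
  \<open>v\<close>; so two solutions have the same integral against each test function and agree almost
  everywhere.

  The fundamental solution is built from the heat kernel \<open>h\<^sub>t\<close>. Since
  \<open>1 / (a\<^sup>2 + s\<^sup>2)\<close> is the Laplace transform of
  \<open>sin (s t) / s\<close> at \<open>a\<close> and \<open>h\<^sub>t\<close> is the kernel of
  \<open>exp (- t a)\<close> for \<open>a = - \<Delta>\<close>, \<open>G\<close> should be the
  integral of \<open>(sin (s t) / s) h\<^sub>t\<close> over \<open>t > 0\<close>. This does not
  converge absolutely in $L^1$, because \<open>h\<^sub>t\<close> has integral one for all \<open>t\<close>.
  But the second time derivative of \<open>h\<^sub>t\<close> has $L^1$ norm of order
  \<open>1 / t\<^sup>2\<close>. One therefore writes
  \<open>sin (s t) / s = \<alpha> + \<beta>''\<close> where \<open>\<alpha>\<close> decays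
  exponentially and \<open>\<beta>\<close> is bounded, and moves the two time derivatives from
  \<open>\<beta>\<close> to the heat kernel: \<open>G\<close> is the integral of
  \<open>\<alpha> h\<^sub>t + \<beta> \<partial>\<^sub>t\<^sup>2 h\<^sub>t\<close>. Near
  \<open>t = 0\<close> two derivatives in space cost a factor \<open>1 / t\<close>, which is harmless as
  \<open>\<alpha>\<close> is of order \<open>t\<close> and \<open>\<beta>\<close> of order
  \<open>t\<^sup>3\<close>. That \<open>G\<close> is a fundamental solution is checked by pairing with a
  test function \<open>w\<close>. The averages \<open>V\<^sub>j\<close> of
  \<open>\<Delta>\<^sup>j w\<close> against \<open>h\<^sub>t\<close> satisfy
  \<open>V\<^sub>j' = V\<^sub>j\<^sub>+\<^sub>1\<close>, and with them the integrand in \<open>t\<close>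
  becomes an exact derivative; only the boundary value at \<open>t = 0\<close> survives, and it is
  \<open>w 0\<close> (\<open>weighted_heat_averages_integral\<close>,
  \<open>green_kernel_fundamental\<close>).

  After the substitution \<open>x = sqrt t *\<^sub>R y\<close>, the measure \<open>G dx\<close> is the
  image under \<open>(t, y) \<mapsto> sqrt t *\<^sub>R y\<close> of an integrable density in
  \<open>(t, y)\<close>, and this parabolic scaling turns \<open>h\<^sub>t\<close> into one fixed Gaussian.
  Convolution with such an image is treated for an arbitrary density and an arbitrary map in the locale
  \<open>transported_kernel\<close>, which provides the $L^p$ bound
  (\<open>transport_powr_integrable\<close>) and Fubini's theorem (\<open>transport_duality\<close>,
  \<open>kernel_pairing_swap\<close>).
\<close>

section \<open>Smooth functions and test functions\<close>

lemma iter_partial_append: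
  "iter_partial (is @ js) \<phi> = iter_partial is (iter_partial js \<phi>)"
  by (induct "is") auto

lemma smooth_iter_partial: "smooth \<phi> \<Longrightarrow> smooth (iter_partial is \<phi>)"
  unfolding smooth_def by (metis iter_partial_append)

lemma smooth_partial_derivative: "smooth \<phi> \<Longrightarrow> smooth (partial_derivative i \<phi>)"
  using smooth_iter_partial[of \<phi> "[i]"] by simp

lemma smooth_differentiable: "smooth \<phi> \<Longrightarrow> \<phi> differentiable (at x)"
  unfolding smooth_def by (metis iter_partial.simps(1) differentiable_on_def UNIV_I)

lemma smooth_continuous: "smooth \<phi> \<Longrightarrow> continuous_on UNIV \<phi>"
  by (simp add: smooth_differentiable differentiable_imp_continuous_on differentiable_on_def)

text \<open>
  All iterated partial derivatives of a member stay in the class, so it suffices to exhibit a class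
  of differentiable functions that is closed under partial derivatives.  The bump functions and the
  Gaussians below are handled in this way.
\<close>

lemma smooth_coinduct:
  assumes "\<phi> \<in> C" and "\<And>\<psi> x. \<psi> \<in> C \<Longrightarrow> \<psi> differentiable (at x)"
    and "\<And>\<psi> i. \<psi> \<in> C \<Longrightarrow> partial_derivative i \<psi> \<in> C"
  shows "smooth \<phi>"
proof -
  have "iter_partial is \<phi> \<in> C" for "is"
    by (induct "is") (auto simp: assms)
  then show ?thesis
    unfolding smooth_def differentiable_on_def using assms(2) by auto
qed

lemma partial_derivative_eqI:
  "(\<phi> has_derivative D) (at x) \<Longrightarrow> partial_derivative i \<phi> x = D (axis i 1)"
  unfolding partial_derivative_def using frechet_derivative_at by metis

lemma sum_axis_mult [simp]:
  fixes f :: "'n::finite \<Rightarrow> real"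
  shows "(\<Sum>j\<in>UNIV. axis i 1 $ j * f j) = f i"
proof -
  have "(\<Sum>j\<in>UNIV. axis i 1 $ j * f j) = (\<Sum>j\<in>UNIV. if j = i then f j else 0)"
    by (rule sum.cong) (auto simp: axis_def)
  then show ?thesis by simp
qed

lemma has_derivative_partial_derivatives:
  fixes \<phi> :: "real ^ 'n::finite \<Rightarrow> real"
  assumes "\<phi> differentiable (at x)"
  shows "(\<phi> has_derivative (\<lambda>h. \<Sum>i\<in>UNIV. h $ i * partial_derivative i \<phi> x)) (at x)"
proof -
  obtain D where D: "(\<phi> has_derivative D) (at x)"
    using assms differentiable_def by blast
  interpret linear D
    using D has_derivative_linear by blast
  have "D = (\<lambda>h. \<Sum>i\<in>UNIV. h $ i * partial_derivative i \<phi> x)"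
  proof
    fix h
    have "D h = D (\<Sum>i\<in>UNIV. h $ i *\<^sub>R axis i 1)"
      using basis_expansion[of h] by (simp add: scalar_mult_eq_scaleR)
    then show "D h = (\<Sum>i\<in>UNIV. h $ i * partial_derivative i \<phi> x)"
      by (simp add: sum scale partial_derivative_eqI[OF D])
  qed
  with D show ?thesis
    by simp
qed

lemma partial_derivative_affine:
  fixes \<phi> :: "real ^ 'n::finite \<Rightarrow> real"
  assumes "\<And>x. \<phi> differentiable (at x)"
  shows "partial_derivative i (\<lambda>x. \<phi> (a + c *\<^sub>R x)) = (\<lambda>x. c * partial_derivative i \<phi> (a + c *\<^sub>R x))"
proof
  fix x
  have 1: "((\<lambda>x. a + c *\<^sub>R x) has_derivative (\<lambda>h. c *\<^sub>R h)) (at x)"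
    by (auto intro!: derivative_eq_intros)
  show "partial_derivative i (\<lambda>x. \<phi> (a + c *\<^sub>R x)) x = c * partial_derivative i \<phi> (a + c *\<^sub>R x)"
    using partial_derivative_eqI[OF has_derivative_compose[OF 1
        has_derivative_partial_derivatives[OF assms]], of i]
    by (simp add: mult.assoc flip: sum_distrib_left)
qed

lemma iter_partial_affine:
  fixes \<phi> :: "real ^ 'n::finite \<Rightarrow> real"
  assumes "smooth \<phi>"
  shows "iter_partial is (\<lambda>x. \<phi> (a + c *\<^sub>R x)) = (\<lambda>x. c ^ length is * iter_partial is \<phi> (a + c *\<^sub>R x))"
proof (induct "is")
  case (Cons i "is")
  have d: "\<And>x. iter_partial is \<phi> differentiable (at x)"
    using assms smooth_iter_partial smooth_differentiable by blast
  then have d': "(\<lambda>x. iter_partial is \<phi> (a + c *\<^sub>R x)) differentiable (at x)" for x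
    by (rule differentiable_compose) (auto intro!: derivative_intros)
  have "partial_derivative i (\<lambda>x. c ^ length is * iter_partial is \<phi> (a + c *\<^sub>R x)) x
      = c ^ length is * partial_derivative i (\<lambda>x. iter_partial is \<phi> (a + c *\<^sub>R x)) x" for x
    using partial_derivative_eqI[OF has_derivative_mult_right[OF
        has_derivative_partial_derivatives[OF d'[of x]]], of i "c ^ length is"] by simp
  then show ?case
    by (simp add: Cons fun_eq_iff partial_derivative_affine[OF d])
qed simp

lemma smooth_affine:
  fixes \<phi> :: "real ^ 'n::finite \<Rightarrow> real"
  assumes "smooth \<phi>"
  shows "smooth (\<lambda>x. \<phi> (a + c *\<^sub>R x))"
proof -
  have "(\<lambda>x. iter_partial is \<phi> (a + c *\<^sub>R x)) differentiable (at x)" for "is" x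
    by (rule differentiable_compose[of "iter_partial is \<phi>"])
       (auto intro!: derivative_intros smooth_differentiable smooth_iter_partial assms)
  then show ?thesis
    unfolding smooth_def differentiable_on_def iter_partial_affine[OF assms]
    by simp
qed

lemma iter_partial_sum:
  fixes \<phi> :: "'i \<Rightarrow> real ^ 'n::finite \<Rightarrow> real"
  assumes "finite I" and "\<And>j. j \<in> I \<Longrightarrow> smooth (\<phi> j)"
  shows "iter_partial is (\<lambda>x. \<Sum>j\<in>I. \<phi> j x) = (\<lambda>x. \<Sum>j\<in>I. iter_partial is (\<phi> j) x)"
proof (induct "is")
  case (Cons i "is")
  have "((\<lambda>x. \<Sum>j\<in>I. iter_partial is (\<phi> j) x) has_derivative
      (\<lambda>h. \<Sum>j\<in>I. \<Sum>i\<in>UNIV. h $ i * partial_derivative i (iter_partial is (\<phi> j)) x)) (at x)" for x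
    by (intro has_derivative_sum has_derivative_partial_derivatives smooth_differentiable
        smooth_iter_partial assms)
  from partial_derivative_eqI[OF this] show ?case
    by (simp add: Cons fun_eq_iff)
qed simp

lemma smooth_sum:
  fixes \<phi> :: "'i \<Rightarrow> real ^ 'n::finite \<Rightarrow> real"
  assumes "finite I" and "\<And>j. j \<in> I \<Longrightarrow> smooth (\<phi> j)"
  shows "smooth (\<lambda>x. \<Sum>j\<in>I. \<phi> j x)"
proof -
  have "(\<lambda>x. \<Sum>j\<in>I. iter_partial is (\<phi> j) x) differentiable (at x)" for "is" x
    using assms by (intro differentiable_sum ballI smooth_differentiable smooth_iter_partial)
  then show ?thesis
    unfolding smooth_def differentiable_on_def by (simp add: iter_partial_sum[OF assms])
qed

lemma smooth_combination:
  fixes \<phi> \<psi> :: "real ^ 'n::finite \<Rightarrow> real"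
  assumes "smooth \<phi>" "smooth \<psi>"
  shows "smooth (\<lambda>x. \<phi> x + c * \<psi> x)"
proof (rule smooth_coinduct[of _ "{(\<lambda>x. \<phi> x + c * \<psi> x) |\<phi> \<psi>. smooth \<phi> \<and> smooth \<psi>}"])
  show "(\<lambda>x. \<phi> x + c * \<psi> x) \<in> {(\<lambda>x. \<phi> x + c * \<psi> x) |\<phi> \<psi>. smooth \<phi> \<and> smooth \<psi>}"
    using assms by blast
next
  fix h' assume "h' \<in> {(\<lambda>x :: real ^ 'n. \<phi> x + c * \<psi> x) |\<phi> \<psi>. smooth \<phi> \<and> smooth \<psi>}"
  then obtain \<phi> \<psi> where h': "h' = (\<lambda>x. \<phi> x + c * \<psi> x)" and s: "smooth \<phi>" "smooth \<psi>" by blast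
  have D: "(h' has_derivative (\<lambda>h. (\<Sum>i\<in>UNIV. h $ i * partial_derivative i \<phi> x)
      + c * (\<Sum>i\<in>UNIV. h $ i * partial_derivative i \<psi> x))) (at x)" for x
    unfolding h' by (intro has_derivative_add has_derivative_mult_right has_derivative_partial_derivatives
        smooth_differentiable s)
  show "h' differentiable (at x)" for x
    using D by (rule differentiableI)
  have "partial_derivative i h' = (\<lambda>x. partial_derivative i \<phi> x + c * partial_derivative i \<psi> x)" for i
    by (auto simp: partial_derivative_eqI[OF D])
  then show "partial_derivative i h' \<in> {(\<lambda>x. \<phi> x + c * \<psi> x) |\<phi> \<psi>. smooth \<phi> \<and> smooth \<psi>}" for i
    using s smooth_partial_derivative by blast
qed

lemma laplacian_alt: "laplacian \<phi> = (\<lambda>x. \<Sum>i\<in>UNIV. iter_partial [i, i] \<phi> x)"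
  unfolding laplacian_def by auto

lemma smooth_laplacian: "smooth \<phi> \<Longrightarrow> smooth (laplacian \<phi>)"
  unfolding laplacian_alt by (intro smooth_sum smooth_iter_partial) auto

lemma laplacian_affine:
  "smooth \<phi> \<Longrightarrow> laplacian (\<lambda>x. \<phi> (a + c *\<^sub>R x)) = (\<lambda>x. c\<^sup>2 * laplacian \<phi> (a + c *\<^sub>R x))"
  unfolding laplacian_alt
  by (subst iter_partial_affine) (auto simp: sum_distrib_left power2_eq_square)

lemma test_functions_iff:
  "\<phi> \<in> test_functions \<longleftrightarrow> smooth \<phi> \<and> bounded {x. \<phi> x \<noteq> 0}"
  unfolding test_functions_def by simp

lemma support_partial_derivative: "{x. partial_derivative i \<phi> x \<noteq> 0} \<subseteq> closure {x. \<phi> x \<noteq> 0}"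
proof
  fix x assume x: "x \<in> {x. partial_derivative i \<phi> x \<noteq> 0}"
  show "x \<in> closure {x. \<phi> x \<noteq> 0}"
  proof (rule ccontr)
    assume "x \<notin> closure {x. \<phi> x \<noteq> 0}"
    then have "x \<in> - closure {x. \<phi> x \<noteq> 0}" by simp
    then have "(\<phi> has_derivative (\<lambda>_. 0)) (at x)"
    proof (rule has_derivative_transform_within_open[rotated 2])
      show "((\<lambda>_. 0) has_derivative (\<lambda>_. 0)) (at x)" by (rule has_derivative_const)
      show "0 = \<phi> y" if "y \<in> - closure {x. \<phi> x \<noteq> 0}" for y
        using that closure_subset[of "{x. \<phi> x \<noteq> 0}"] by fastforce
    qed (simp add: open_Compl)
    from partial_derivative_eqI[OF this] x show False by simp
  qed
qed

lemma bounded_support_partial_derivative: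
  "bounded {x. \<phi> x \<noteq> 0} \<Longrightarrow> bounded {x. partial_derivative i \<phi> x \<noteq> 0}"
  by (rule bounded_subset[OF bounded_closure support_partial_derivative])

lemma test_partial_derivative:
  "\<phi> \<in> test_functions \<Longrightarrow> partial_derivative i \<phi> \<in> test_functions"
  by (simp add: test_functions_iff smooth_partial_derivative bounded_support_partial_derivative)

lemma test_iter_partial: "\<phi> \<in> test_functions \<Longrightarrow> iter_partial is \<phi> \<in> test_functions"
  by (induct "is") (auto intro: test_partial_derivative)

lemma test_laplacian: 
  assumes "\<phi> \<in> test_functions"
  shows "laplacian \<phi> \<in> test_functions"
proof -
  have "{x. laplacian \<phi> x \<noteq> 0} \<subseteq> (\<Union>i\<in>UNIV. {x. iter_partial [i, i] \<phi> x \<noteq> 0})"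
    unfolding laplacian_def by (auto dest: sum.not_neutral_contains_not_neutral)
  moreover have "bounded (\<Union>i\<in>UNIV. {x. iter_partial [i, i] \<phi> x \<noteq> 0})"
    using assms test_iter_partial[OF assms] by (intro bounded_UN) (auto simp only: test_functions_iff finite)
  ultimately show ?thesis
    using assms by (auto simp: test_functions_iff smooth_laplacian intro: bounded_subset)
qed

lemma test_combination:
  assumes "\<phi> \<in> test_functions" "\<psi> \<in> test_functions"
  shows "(\<lambda>x. \<phi> x + c * \<psi> x) \<in> test_functions"
proof -
  have "{x. \<phi> x + c * \<psi> x \<noteq> 0} \<subseteq> {x. \<phi> x \<noteq> 0} \<union> {x. \<psi> x \<noteq> 0}" by auto
  moreover have "bounded ({x. \<phi> x \<noteq> 0} \<union> {x. \<psi> x \<noteq> 0})"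
    using assms by (simp only: test_functions_iff bounded_Un simp_thms)
  ultimately have "bounded {x. \<phi> x + c * \<psi> x \<noteq> 0}"
    by (rule bounded_subset[rotated])
  then show ?thesis
    using assms by (simp only: test_functions_iff smooth_combination simp_thms)
qed

lemma test_affine:
  assumes "\<phi> \<in> test_functions" and "c \<noteq> 0"
  shows "(\<lambda>x. \<phi> (a + c *\<^sub>R x)) \<in> test_functions"
proof -
  have "{x. \<phi> (a + c *\<^sub>R x) \<noteq> 0} \<subseteq> (\<lambda>y. (1/c) *\<^sub>R (y - a)) ` {x. \<phi> x \<noteq> 0}"
    using assms(2) by (auto simp: image_iff intro!: exI[of _ "a + c *\<^sub>R _"])
  moreover have "bounded ((\<lambda>y. (1/c) *\<^sub>R (y - a)) ` {x. \<phi> x \<noteq> 0})"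
    using assms(1) bounded_scaling[OF bounded_translation_minus, of _ "1/c" a]
    by (simp add: test_functions_iff image_image)
  ultimately show ?thesis
    using assms(1) by (auto simp: test_functions_iff smooth_affine intro: bounded_subset)
qed

lemma test_translate: "\<phi> \<in> test_functions \<Longrightarrow> (\<lambda>x. \<phi> (a + x)) \<in> test_functions"
  using test_affine[of \<phi> 1 a] by simp

lemma bounded_range_compact_support:
  fixes \<phi> :: "'a::euclidean_space \<Rightarrow> real"
  assumes "continuous_on UNIV \<phi>" and "bounded {x. \<phi> x \<noteq> 0}"
  obtains B where "\<And>x. \<bar>\<phi> x\<bar> \<le> B"
proof -
  have "compact (\<phi> ` closure {x. \<phi> x \<noteq> 0})"
    using assms by (intro compact_continuous_image) (auto intro: continuous_on_subset)
  then have "bounded (\<phi> ` closure {x. \<phi> x \<noteq> 0})"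
    by (rule compact_imp_bounded)
  then obtain B where B: "\<And>y. y \<in> \<phi> ` closure {x. \<phi> x \<noteq> 0} \<Longrightarrow> \<bar>y\<bar> \<le> B"
    unfolding bounded_iff real_norm_def by blast
  have "\<bar>\<phi> x\<bar> \<le> max B 0" for x
    using B[of "\<phi> x"] closure_subset[of "{x. \<phi> x \<noteq> 0}"] by (cases "\<phi> x = 0") auto
  then show ?thesis
    by (rule that)
qed

lemma integrable_compact_support:
  fixes \<phi> :: "'a::euclidean_space \<Rightarrow> real"
  assumes "continuous_on UNIV \<phi>" and "bounded {x. \<phi> x \<noteq> 0}"
  shows "integrable lborel \<phi>"
proof -
  have "set_integrable lborel (closure {x. \<phi> x \<noteq> 0}) \<phi>"
    using assms unfolding set_integrable_def
    by (intro borel_integrable_compact) (auto intro: continuous_on_subset)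
  moreover have "(\<lambda>x. indicator (closure {x. \<phi> x \<noteq> 0}) x *\<^sub>R \<phi> x) = \<phi>"
    using closure_subset[of "{x. \<phi> x \<noteq> 0}"] by (auto simp: fun_eq_iff indicator_def)
  ultimately show ?thesis
    by (simp add: set_integrable_def)
qed

lemma test_bounded:
  assumes "\<phi> \<in> test_functions"
  obtains B where "B \<ge> 0" "\<And>x. \<bar>\<phi> x\<bar> \<le> B"
  using assms bounded_range_compact_support[of \<phi>] 
  by (metis abs_ge_zero order_trans smooth_continuous test_functions_iff)

lemma test_integrable: "\<phi> \<in> test_functions \<Longrightarrow> integrable lborel \<phi>"
  by (simp add: integrable_compact_support smooth_continuous test_functions_iff)

lemma smooth_borel [measurable_dest]: "smooth \<phi> \<Longrightarrow> \<phi> \<in> borel_measurable borel"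
  by (simp add: borel_measurable_continuous_onI smooth_continuous)

lemma test_smooth: "\<phi> \<in> test_functions \<Longrightarrow> smooth \<phi>"
  by (simp add: test_functions_iff)

lemma test_borel: "\<phi> \<in> test_functions \<Longrightarrow> \<phi> \<in> borel_measurable borel"
  by (simp add: test_smooth smooth_borel)

lemma integrable_continuous_mult_test:
  assumes "continuous_on UNIV k" and "\<phi> \<in> test_functions"
  shows "integrable lborel (\<lambda>x. k x * \<phi> x)"
proof (rule integrable_compact_support)
  show "continuous_on UNIV (\<lambda>x. k x * \<phi> x)"
    using assms smooth_continuous[OF test_smooth] by (intro continuous_on_mult)
  show "bounded {x. k x * \<phi> x \<noteq> 0}"
    using assms(2) by (auto simp: test_functions_iff intro: bounded_subset)
qed

lemma integrable_translate:
  fixes F :: "'a::euclidean_space \<Rightarrow> real"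
  assumes "F \<in> borel_measurable borel"
  shows "integrable lborel (\<lambda>x. F (a + x)) \<longleftrightarrow> integrable lborel F"
  using integrable_distr_eq[of "(+) a" lborel borel F] assms by (simp add: lborel_distr_plus)

lemma integral_translate:
  fixes F :: "'a::euclidean_space \<Rightarrow> real"
  assumes "F \<in> borel_measurable borel"
  shows "(\<integral>x. F (a + x) \<partial>lborel) = (\<integral>x. F x \<partial>lborel)"
  using integral_distr[of "(+) a" lborel borel F] assms by (simp add: lborel_distr_plus)

section \<open>Differentiation under the integral and integration by parts\<close>

text \<open>
  The mean value theorem bounds the difference quotients by the integrable majorant \<open>B\<close> of the
  derivative, so dominated convergence applies along each sequence that tends to \<open>t0\<close>.
\<close>

lemma has_real_derivative_integral:
  fixes f :: "real \<Rightarrow> 'b \<Rightarrow> real"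
  assumes "\<delta> > 0"
    and int: "\<And>t. \<bar>t - t0\<bar> < \<delta> \<Longrightarrow> integrable M (f t)"
    and deriv: "\<And>t y. \<bar>t - t0\<bar> < \<delta> \<Longrightarrow> y \<in> space M \<Longrightarrow> ((\<lambda>t. f t y) has_real_derivative f' t y) (at t)"
    and bound: "\<And>t y. \<bar>t - t0\<bar> < \<delta> \<Longrightarrow> y \<in> space M \<Longrightarrow> \<bar>f' t y\<bar> \<le> B y"
    and B: "integrable M B" and f': "f' t0 \<in> borel_measurable M"
  shows "((\<lambda>t. \<integral>y. f t y \<partial>M) has_real_derivative (\<integral>y. f' t0 y \<partial>M)) (at t0)"
  unfolding has_field_derivative_iff tendsto_at_iff_sequentially comp_def
proof (intro allI impI)
  fix X :: "nat \<Rightarrow> real"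
  assume X: "\<forall>i. X i \<in> UNIV - {t0}" "X \<longlonglongrightarrow> t0"
  then have ev: "\<forall>\<^sub>F n in sequentially. \<bar>X n - t0\<bar> < \<delta>"
    using \<open>\<delta> > 0\<close> by (auto simp: tendsto_iff dist_real_def)
  \<comment> \<open>The difference quotient is cut off for the finitely many \<open>n\<close> with \<open>X n\<close> far from \<open>t0\<close>, so that
    the bound by \<open>B\<close> holds for every \<open>n\<close>.\<close>
  define q where "q n y = (if \<bar>X n - t0\<bar> < \<delta> then (f (X n) y - f t0 y) / (X n - t0) else 0)" for n y
  have q_meas: "q n \<in> borel_measurable M" for n
    using int[of "X n"] int[of t0] \<open>\<delta> > 0\<close>
    by (cases "\<bar>X n - t0\<bar> < \<delta>") (auto simp: q_def[abs_def])
  have lim: "(\<lambda>n. q n y) \<longlonglongrightarrow> f' t0 y" if "y \<in> space M" for y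
  proof -
    have "((\<lambda>t. (f t y - f t0 y) / (t - t0)) \<longlongrightarrow> f' t0 y) (at t0)"
      using deriv[of t0 y] that \<open>\<delta> > 0\<close> by (simp add: has_field_derivative_iff)
    then have "(\<lambda>n. (f (X n) y - f t0 y) / (X n - t0)) \<longlonglongrightarrow> f' t0 y"
      using X by (auto simp: tendsto_at_iff_sequentially comp_def)
    then show ?thesis
      by (rule Lim_transform_eventually) (use ev in eventually_elim, simp add: q_def)
  qed
  have dom: "\<bar>q n y\<bar> \<le> B y" if "y \<in> space M" for n y
  proof (cases "\<bar>X n - t0\<bar> < \<delta>")
    case True
    have "norm (f (X n) y - f t0 y) \<le> B y * norm (X n - t0)"
    proof (rule field_differentiable_bound[where S="{t. \<bar>t - t0\<bar> < \<delta>}" and f'="\<lambda>t. f' t y"])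
      have "{t. \<bar>t - t0\<bar> < \<delta>} = ball t0 \<delta>" by (auto simp: dist_real_def)
      then show "convex {t. \<bar>t - t0\<bar> < \<delta>}" by simp
    qed (use that deriv bound True \<open>\<delta> > 0\<close> in \<open>auto intro: has_field_derivative_at_within\<close>)
    then show ?thesis
      using True X(1) by (simp add: q_def divide_le_eq abs_divide)
  next
    case False
    then show ?thesis
      using bound[of t0 y] that \<open>\<delta> > 0\<close> by (auto simp: q_def)
  qed
  have "(\<lambda>n. \<integral>y. q n y \<partial>M) \<longlonglongrightarrow> (\<integral>y. f' t0 y \<partial>M)"
    by (rule integral_dominated_convergence[where w=B]) (use f' q_meas B lim dom in auto)
  then show "(\<lambda>n. ((\<integral>y. f (X n) y \<partial>M) - (\<integral>y. f t0 y \<partial>M)) / (X n - t0)) \<longlonglongrightarrow> (\<integral>y. f' t0 y \<partial>M)"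
  proof (rule Lim_transform_eventually)
    show "\<forall>\<^sub>F n in sequentially. (\<integral>y. q n y \<partial>M)
        = ((\<integral>y. f (X n) y \<partial>M) - (\<integral>y. f t0 y \<partial>M)) / (X n - t0)"
      using ev
    proof eventually_elim
      case (elim n)
      then show ?case
        using int[of "X n"] int[of t0] \<open>\<delta> > 0\<close> by (simp add: q_def)
    qed
  qed
qed

text \<open>
  The integral of the translate of \<open>F\<close> by \<open>r\<close> along the \<open>i\<close>-th axis does not depend on \<open>r\<close>.
  Its derivative at \<open>r = 0\<close> is the integral of the partial derivative.
\<close>

lemma integral_partial_derivative_zero:
  fixes F :: "real ^ 'n::finite \<Rightarrow> real"
  assumes diff: "\<And>x. F differentiable (at x)"
    and cont: "continuous_on UNIV (partial_derivative i F)"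
    and supp: "bounded {x. F x \<noteq> 0}"
  shows "(\<integral>x. partial_derivative i F x \<partial>lborel) = 0"
proof -
  have F: "integrable lborel F"
    using diff supp by (intro integrable_compact_support)
      (auto intro!: differentiable_imp_continuous_on simp: differentiable_on_def)
  have suppD: "bounded {x. partial_derivative i F x \<noteq> 0}"
    using supp by (rule bounded_support_partial_derivative)
  obtain B where B: "\<And>x. \<bar>partial_derivative i F x\<bar> \<le> B"
    using bounded_range_compact_support[OF cont suppD] by blast
  obtain R where R: "\<And>x. partial_derivative i F x \<noteq> 0 \<Longrightarrow> norm x \<le> R"
    using suppD by (auto simp: bounded_iff)
  define e :: "real ^ 'n" where "e = axis i 1"
  have e: "norm e = 1" by (simp add: e_def)
  have "((\<lambda>r. \<integral>x. F (x + r *\<^sub>R e) \<partial>lborel) has_real_derivative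
      (\<integral>x. partial_derivative i F (x + 0 *\<^sub>R e) \<partial>lborel)) (at 0)"
  proof (rule has_real_derivative_integral[where \<delta>=1 and B="\<lambda>x. B * indicator (cball 0 (R + 1)) x"])
    show "integrable lborel (\<lambda>x. F (x + r *\<^sub>R e))" for r
      using F integrable_translate[of F "r *\<^sub>R e"] borel_measurable_integrable[OF F]
      by (simp add: add.commute)
    show "integrable lborel (\<lambda>x :: real ^ 'n. B * indicator (cball 0 (R + 1)) x)"
      using emeasure_bounded_finite[OF bounded_cball, of "0 :: real ^ 'n" "R + 1"]
      by (intro integrable_mult_right integrable_real_indicator) auto
    show "(\<lambda>x. partial_derivative i F (x + 0 *\<^sub>R e)) \<in> borel_measurable lborel"
      using cont by (simp add: borel_measurable_continuous_onI)
    fix r :: real and x :: "real ^ 'n"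
    have 1: "((\<lambda>r. x + r *\<^sub>R e) has_derivative (\<lambda>h. h *\<^sub>R e)) (at r)"
      by (auto intro!: derivative_eq_intros)
    show "((\<lambda>r. F (x + r *\<^sub>R e)) has_real_derivative partial_derivative i F (x + r *\<^sub>R e)) (at r)"
      using has_derivative_compose[OF 1 has_derivative_partial_derivatives[OF diff]]
      by (simp add: has_field_derivative_def e_def mult.assoc mult_commute_abs flip: sum_distrib_left)
    assume r: "\<bar>r - 0\<bar> < 1"
    show "\<bar>partial_derivative i F (x + r *\<^sub>R e)\<bar> \<le> B * indicator (cball 0 (R + 1)) x"
    proof (cases "partial_derivative i F (x + r *\<^sub>R e) = 0")
      case False
      have "norm x \<le> norm (x + r *\<^sub>R e) + norm (r *\<^sub>R e)"
        using norm_triangle_ineq4[of "x + r *\<^sub>R e" "r *\<^sub>R e"] by simp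
      then have "norm x \<le> R + 1"
        using R[OF False] r e by simp
      then show ?thesis using B by simp
    qed (use B[of 0] in auto)
  qed simp
  moreover have "(\<integral>x. F (x + r *\<^sub>R e) \<partial>lborel) = (\<integral>x. F x \<partial>lborel)" for r
    using integral_translate[of F "r *\<^sub>R e"] borel_measurable_integrable[OF F]
    by (simp add: add.commute)
  ultimately show ?thesis
    using DERIV_unique[OF _ DERIV_const] by simp
qed

lemma integration_by_parts:
  fixes k w :: "real ^ 'n::finite \<Rightarrow> real"
  assumes k: "smooth k" and w: "w \<in> test_functions"
  shows "(\<integral>x. k x * partial_derivative i w x \<partial>lborel) = - (\<integral>x. partial_derivative i k x * w x \<partial>lborel)"
proof -
  have sw: "smooth w" using w test_functions_iff by blast
  have D: "((\<lambda>x. k x * w x) has_derivative (\<lambda>h. k x * (\<Sum>i\<in>UNIV. h $ i * partial_derivative i w x)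
      + (\<Sum>i\<in>UNIV. h $ i * partial_derivative i k x) * w x)) (at x)" for x
    by (intro has_derivative_mult has_derivative_partial_derivatives smooth_differentiable k sw)
  then have pd: "partial_derivative i (\<lambda>x. k x * w x)
      = (\<lambda>x. k x * partial_derivative i w x + partial_derivative i k x * w x)"
    by (auto simp: partial_derivative_eqI[OF D] )
  have bw: "bounded {x. w x \<noteq> 0}" "bounded {x. partial_derivative i w x \<noteq> 0}"
    using w test_partial_derivative test_functions_iff by blast+
  have c: "continuous_on UNIV k" "continuous_on UNIV (partial_derivative i k)"
    "continuous_on UNIV w" "continuous_on UNIV (partial_derivative i w)"
    using k sw by (auto intro: smooth_continuous smooth_partial_derivative)
  have 1: "integrable lborel (\<lambda>x. k x * partial_derivative i w x)"
    by (rule integrable_compact_support) (auto intro!: continuous_intros c bounded_subset[OF bw(2)])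
  have 2: "integrable lborel (\<lambda>x. partial_derivative i k x * w x)"
    by (rule integrable_compact_support) (auto intro!: continuous_intros c bounded_subset[OF bw(1)])
  have "(\<integral>x. partial_derivative i (\<lambda>x. k x * w x) x \<partial>lborel) = 0"
  proof (rule integral_partial_derivative_zero)
    show "(\<lambda>x. k x * w x) differentiable (at x)" for x
      using D differentiable_def by blast
    show "continuous_on UNIV (partial_derivative i (\<lambda>x. k x * w x))"
      unfolding pd by (intro continuous_intros c)
  qed (auto intro: bounded_subset[OF bw(1)])
  then show ?thesis
    unfolding pd using 1 2 by simp
qed

text \<open>
  The outermost derivative is moved first, hence the reversal of the list.
\<close>

lemma iterated_integration_by_parts:
  fixes k w :: "real ^ 'n::finite \<Rightarrow> real"
  assumes "smooth k" and w: "w \<in> test_functions"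
  shows "(\<integral>x. k x * iter_partial is w x \<partial>lborel)
    = (-1) ^ length is * (\<integral>x. iter_partial (rev is) k x * w x \<partial>lborel)"
  using \<open>smooth k\<close>
proof (induct "is" arbitrary: k)
  case (Cons i "is")
  have "(\<integral>x. k x * iter_partial (i # is) w x \<partial>lborel)
      = - (\<integral>x. partial_derivative i k x * iter_partial is w x \<partial>lborel)"
    by (simp add: integration_by_parts Cons test_iter_partial w)
  then show ?case
    using Cons by (simp add: smooth_partial_derivative iter_partial_append)
qed simp

lemma laplacian_integration_by_parts:
  fixes k w :: "real ^ 'n::finite \<Rightarrow> real"
  assumes k: "smooth k" and w: "w \<in> test_functions"
  shows "(\<integral>x. laplacian k x * w x \<partial>lborel) = (\<integral>x. k x * laplacian w x \<partial>lborel)"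
proof -
  have 1: "integrable lborel (\<lambda>x. iter_partial is k x * w x)"
    and 2: "integrable lborel (\<lambda>x. k x * iter_partial is w x)" for "is"
    using k w by (auto intro!: integrable_continuous_mult_test smooth_continuous
        smooth_iter_partial test_iter_partial)
  have "(\<integral>x. k x * iter_partial [i, i] w x \<partial>lborel) = (\<integral>x. iter_partial [i, i] k x * w x \<partial>lborel)" for i
    using iterated_integration_by_parts[OF k w, of "[i, i]"] by simp
  then show ?thesis
    unfolding laplacian_def sum_distrib_left sum_distrib_right
    by (simp add: Bochner_Integration.integral_sum 1 2 del: iter_partial.simps)
qed

section \<open>The fundamental lemma of the calculus of variations\<close>

text \<open>
  The classical smooth function that vanishes to infinite order at the origin, together with its
  multiples by powers of \<open>1 / t\<close>: these are what differentiation produces.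
\<close>

definition flat_exp :: "nat \<Rightarrow> real \<Rightarrow> real" where
  "flat_exp n t = (if t > 0 then exp (- inverse t) * inverse t ^ n else 0)"

lemma flat_exp_nonneg: "0 \<le> flat_exp n t"
  by (simp add: flat_exp_def)

lemma power_le_fact_exp:
  fixes x :: real
  assumes "0 \<le> x"
  shows "x ^ n \<le> fact n * exp x"
proof -
  have "(\<Sum>k\<in>{n}. x ^ k / fact k) \<le> (\<Sum>k. x ^ k / fact k)"
    using assms summable_exp[of x]
    by (intro sum_le_suminf) (auto simp: divide_inverse mult.commute)
  then have "x ^ n / fact n \<le> exp x"
    by (simp add: exp_def divide_inverse mult.commute)
  then show ?thesis
    by (simp only: divide_le_eq fact_gt_zero if_True mult.commute)
qed

text \<open>
  A quadratic bound at the origin, which gives the derivative zero there.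
\<close>

lemma flat_exp_le: "flat_exp n t \<le> fact (n + 2) * t\<^sup>2"
proof (cases "t > 0")
  case True
  have "inverse t ^ (n + 2) \<le> fact (n + 2) * exp (inverse t)"
    using True by (intro power_le_fact_exp) simp
  then have "exp (- inverse t) * inverse t ^ (n + 2) * t\<^sup>2
      \<le> exp (- inverse t) * (fact (n + 2) * exp (inverse t)) * t\<^sup>2"
    by (intro mult_right_mono mult_left_mono) (simp_all del: fact_Suc)
  also have "\<dots> = (exp (- inverse t) * exp (inverse t)) * (fact (n + 2) * t\<^sup>2)"
    by (simp only: mult_ac)
  also have "\<dots> = fact (n + 2) * t\<^sup>2"
    by (simp only: exp_add[symmetric] add.left_inverse exp_zero mult_1)
  also have "exp (- inverse t) * inverse t ^ (n + 2) * t\<^sup>2 = flat_exp n t"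
    using True by (simp add: flat_exp_def power_add power2_eq_square mult.assoc[symmetric])
  finally show ?thesis .
qed (simp add: flat_exp_def)

lemma flat_exp_has_real_derivative:
  "(flat_exp n has_real_derivative flat_exp (n + 2) t - n * flat_exp (n + 1) t) (at t)"
proof -
  consider "t > 0" | "t < 0" | "t = 0" by linarith
  then show ?thesis
  proof cases
    case 1
    have "((\<lambda>t. exp (- inverse t) * inverse t ^ n) has_real_derivative
        flat_exp (n + 2) t - n * flat_exp (n + 1) t) (at t)"
    proof -
      have "(inverse has_real_derivative - (inverse t ^ 2)) (at t)"
        using 1 by (auto intro!: derivative_eq_intros simp: power2_eq_square)
      from DERIV_mult[OF DERIV_chain2[OF DERIV_exp DERIV_minus[OF this]] DERIV_power[OF this, of n]]
      show ?thesis
        using 1 by (cases n) (auto simp: flat_exp_def algebra_simps power2_eq_square)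
    qed
    then show ?thesis
      by (rule has_field_derivative_transform_within_open[where S="{0<..}"])
         (use 1 in \<open>auto simp: flat_exp_def\<close>)
  next
    case 2
    have "((\<lambda>t. 0) has_real_derivative flat_exp (n + 2) t - n * flat_exp (n + 1) t) (at t)"
      using 2 by (simp add: flat_exp_def)
    then show ?thesis
      by (rule has_field_derivative_transform_within_open[where S="{..<0}"])
         (use 2 in \<open>auto simp: flat_exp_def\<close>)
  next
    case 3
    have "((\<lambda>h. flat_exp n h / h) \<longlongrightarrow> 0) (at 0)"
    proof (rule Lim_null_comparison)
      have "norm (flat_exp n h / h) \<le> fact (n + 2) * \<bar>h\<bar>" if "h \<noteq> 0" for h
        using flat_exp_le[of n h] flat_exp_nonneg[of n h] that
        by (simp add: abs_divide divide_le_eq power2_eq_square mult.assoc)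
      then show "\<forall>\<^sub>F h in at 0. norm (flat_exp n h / h) \<le> fact (n + 2) * \<bar>h\<bar>"
        by (auto simp: eventually_at intro!: exI[of _ 1])
      show "((\<lambda>h::real. fact (n + 2) * \<bar>h\<bar>) \<longlongrightarrow> 0) (at 0)"
        by (auto intro!: tendsto_eq_intros)
    qed
    then show ?thesis
      using 3 by (simp add: has_field_derivative_iff flat_exp_def)
  qed
qed

text \<open>
  A class closed under partial derivatives that contains the bump functions of boxes.
\<close>

inductive_set flat_algebra :: "(real ^ 'n::finite \<Rightarrow> real) set" where
  const: "(\<lambda>x. c) \<in> flat_algebra"
| flat: "(\<lambda>x. flat_exp n (c * x $ i + d)) \<in> flat_algebra"
| add: "\<phi> \<in> flat_algebra \<Longrightarrow> \<psi> \<in> flat_algebra \<Longrightarrow> (\<lambda>x. \<phi> x + \<psi> x) \<in> flat_algebra"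
| mult: "\<phi> \<in> flat_algebra \<Longrightarrow> \<psi> \<in> flat_algebra \<Longrightarrow> (\<lambda>x. \<phi> x * \<psi> x) \<in> flat_algebra"

lemma flat_algebra_derivative:
  assumes "\<phi> \<in> flat_algebra"
  shows "(\<forall>x. \<phi> differentiable (at x)) \<and> partial_derivative i \<phi> \<in> flat_algebra"
  using assms
proof induct
  case (const c)
  have "partial_derivative i (\<lambda>x. c) = (\<lambda>x. 0)"
    by (rule ext, rule partial_derivative_eqI[THEN trans]) (rule has_derivative_const, simp)
  then show ?case by (auto intro: flat_algebra.const)
next
  case (flat n c j d)
  have D: "((\<lambda>x. flat_exp n (c * x $ j + d)) has_derivative
      (\<lambda>h. (c * h $ j) * (flat_exp (n + 2) (c * x $ j + d) - n * flat_exp (n + 1) (c * x $ j + d)))) (at x)" for x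
  proof -
    have "((\<lambda>x. c * x $ j + d) has_derivative (\<lambda>h. c * h $ j)) (at x)"
      by (auto intro!: derivative_eq_intros bounded_linear.has_derivative[OF bounded_linear_vec_nth])
    from has_derivative_compose[OF this flat_exp_has_real_derivative[unfolded has_field_derivative_def]]
    show ?thesis by (simp add: mult.commute)
  qed
  have "partial_derivative i (\<lambda>x. flat_exp n (c * x $ j + d)) = (\<lambda>x. (c * axis i 1 $ j) *
      (flat_exp (n + 2) (c * x $ j + d) + (- real n) * flat_exp (n + 1) (c * x $ j + d)))"
    by (auto simp: partial_derivative_eqI[OF D])
  moreover have "\<dots> \<in> flat_algebra"
    by (intro flat_algebra.intros)
  ultimately show ?case using differentiableI[OF D] by simp
next
  case (add \<phi> \<psi>)
  then have D: "((\<lambda>x. \<phi> x + \<psi> x) has_derivative (\<lambda>h. (\<Sum>i\<in>UNIV. h $ i * partial_derivative i \<phi> x)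
      + (\<Sum>i\<in>UNIV. h $ i * partial_derivative i \<psi> x))) (at x)" for x
    by (intro has_derivative_add has_derivative_partial_derivatives) auto
  have "partial_derivative i (\<lambda>x. \<phi> x + \<psi> x) = (\<lambda>x. partial_derivative i \<phi> x + partial_derivative i \<psi> x)"
    by (auto simp: partial_derivative_eqI[OF D])
  moreover have "\<dots> \<in> flat_algebra" using add by (intro flat_algebra.intros) auto
  ultimately show ?case using differentiableI[OF D] by simp
next
  case (mult \<phi> \<psi>)
  then have D: "((\<lambda>x. \<phi> x * \<psi> x) has_derivative (\<lambda>h. \<phi> x * (\<Sum>i\<in>UNIV. h $ i * partial_derivative i \<psi> x)
      + (\<Sum>i\<in>UNIV. h $ i * partial_derivative i \<phi> x) * \<psi> x)) (at x)" for x
    by (intro has_derivative_mult has_derivative_partial_derivatives) auto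
  have "partial_derivative i (\<lambda>x. \<phi> x * \<psi> x) = (\<lambda>x. \<phi> x * partial_derivative i \<psi> x + partial_derivative i \<phi> x * \<psi> x)"
    by (auto simp: partial_derivative_eqI[OF D])
  moreover have "\<dots> \<in> flat_algebra" using mult by (intro flat_algebra.intros) auto
  ultimately show ?case using differentiableI[OF D] by simp
qed

lemma flat_algebra_smooth: "\<phi> \<in> flat_algebra \<Longrightarrow> smooth \<phi>"
  by (rule smooth_coinduct[of _ flat_algebra]) (auto dest: flat_algebra_derivative)

lemma flat_algebra_prod:
  assumes "finite I" and "\<And>i. i \<in> I \<Longrightarrow> \<phi> i \<in> flat_algebra"
  shows "(\<lambda>x. \<Prod>i\<in>I. \<phi> i x) \<in> flat_algebra"
  using assms by (induct I rule: finite_induct) (auto intro: flat_algebra.intros)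

definition box_bump :: "nat \<Rightarrow> real ^ 'n::finite \<Rightarrow> real ^ 'n \<Rightarrow> real ^ 'n \<Rightarrow> real" where
  "box_bump n a b x = (\<Prod>i\<in>UNIV. flat_exp 0 (real n * (x $ i - a $ i)) * flat_exp 0 (real n * (b $ i - x $ i)))"

lemma box_bump_outside: 
  assumes "x \<notin> box a b" shows "box_bump n a b x = 0"
proof -
  obtain i where "\<not> (a $ i < x $ i \<and> x $ i < b $ i)"
    using assms by (auto simp: mem_box_cart)
  then have "flat_exp 0 (real n * (x $ i - a $ i)) * flat_exp 0 (real n * (b $ i - x $ i)) = 0"
    by (auto simp: flat_exp_def zero_less_mult_iff)
  then show ?thesis
    unfolding box_bump_def by (intro prod_zero) auto
qed

lemma box_bump_test: "box_bump n a b \<in> test_functions"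
proof -
  have "(\<lambda>x. flat_exp 0 (real n * (x $ i - a $ i)) * flat_exp 0 (real n * (b $ i - x $ i))) \<in> flat_algebra" for i
    using flat_algebra.mult[OF flat_algebra.flat[of 0 "real n" i "- real n * a $ i"]
        flat_algebra.flat[of 0 "- real n" i "real n * b $ i"]]
    by (simp add: algebra_simps)
  then have "box_bump n a b \<in> flat_algebra"
    unfolding box_bump_def[abs_def] by (intro flat_algebra_prod) auto
  moreover have "{x. box_bump n a b x \<noteq> 0} \<subseteq> box a b"
    using box_bump_outside by blast
  ultimately show ?thesis
    using bounded_subset[OF bounded_box] by (auto simp: test_functions_iff flat_algebra_smooth)
qed

lemma box_bump_bounds: "0 \<le> box_bump n a b x" "box_bump n a b x \<le> 1"
proof -
  have "flat_exp 0 t \<le> 1" for t by (simp add: flat_exp_def)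
  then show "0 \<le> box_bump n a b x" "box_bump n a b x \<le> 1"
    unfolding box_bump_def by (auto intro!: prod_nonneg prod_le_1 mult_le_one mult_nonneg_nonneg flat_exp_nonneg)
qed

text \<open>
  The argument of each factor tends to infinity inside the box, so the bump functions increase
  to the indicator of the box, which is how test functions reach boxes.
\<close>

lemma box_bump_tendsto: "(\<lambda>n. box_bump n a b x) \<longlonglongrightarrow> indicator (box a b) x"
proof (cases "x \<in> box a b")
  case True
  have *: "(\<lambda>n. flat_exp 0 (real n * c)) \<longlonglongrightarrow> 1" if "c > 0" for c
  proof (rule Lim_transform_eventually)
    have "(\<lambda>n. exp (- (inverse (real n) * inverse c))) \<longlonglongrightarrow> exp (- (0 * inverse c))"
      by (intro tendsto_intros lim_inverse_n)
    then show "(\<lambda>n. exp (- inverse (real n * c))) \<longlonglongrightarrow> 1"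
      by (simp add: mult.commute)
    show "\<forall>\<^sub>F n in sequentially. exp (- inverse (real n * c)) = flat_exp 0 (real n * c)"
      using eventually_gt_at_top[of 0] by eventually_elim (use that in \<open>simp add: flat_exp_def\<close>)
  qed
  have "(\<lambda>n. box_bump n a b x) \<longlonglongrightarrow> (\<Prod>i\<in>(UNIV::'a set). 1 * 1)"
    unfolding box_bump_def using True
    by (intro tendsto_prod tendsto_mult *) (auto simp: mem_box_cart)
  then show ?thesis using True by simp
qed (simp add: box_bump_outside)

text \<open>
  The positive and the negative part of \<open>d\<close> are densities of two measures that agree on open
  boxes.  Boxes form an intersection-stable generator of the Borel sets and exhaust the space by
  sets of finite measure, so the two measures, and then the two densities, coincide.
\<close>

lemma AE_zero_if_box_integrals_zero:
  fixes d :: "'a::euclidean_space \<Rightarrow> real"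
  assumes int: "\<And>a b. set_integrable lborel (box a b) d"
    and zero: "\<And>a b. (LINT x:box a b|lborel. d x) = 0"
    and [measurable]: "d \<in> borel_measurable borel"
  shows "AE x in lborel. d x = 0"
proof -
  let ?P = "density lborel (\<lambda>x. ennreal (d x))" and ?N = "density lborel (\<lambda>x. ennreal (- d x))"
  have fin: "(\<integral>\<^sup>+x. ennreal (d x) * indicator (box a b) x \<partial>lborel) < \<infinity>"
    and eq: "(\<integral>\<^sup>+x. ennreal (d x) * indicator (box a b) x \<partial>lborel)
      = (\<integral>\<^sup>+x. ennreal (- d x) * indicator (box a b) x \<partial>lborel)" for a b
  proof -
    have i: "integrable lborel (\<lambda>x. indicator (box a b) x * d x)"
      using int[of a b] by (simp add: set_integrable_def)
    have e: "ennreal (c * d x) * indicator (box a b) x = ennreal (c * (indicator (box a b) x * d x))" for x c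
      by (simp add: indicator_def)
    let ?A = "\<lambda>c. \<integral>\<^sup>+x. ennreal (c * d x) * indicator (box a b) x \<partial>lborel"
    have *: "?A 1 < \<infinity>" "?A (-1) < \<infinity>"
      using i unfolding e by (auto simp: real_integrable_def less_top[symmetric])
    have "enn2real (?A 1) = enn2real (?A (-1))"
      using zero[of a b] unfolding e set_lebesgue_integral_def
      by (simp add: real_lebesgue_integral_def[OF i])
    then have "ennreal (enn2real (?A 1)) = ennreal (enn2real (?A (-1)))"
      by (rule arg_cong)
    then have "?A 1 = ?A (-1)"
      using * by (simp only: ennreal_enn2real infinity_ennreal_def)
    then show "(\<integral>\<^sup>+x. ennreal (d x) * indicator (box a b) x \<partial>lborel) < \<infinity>"
      "(\<integral>\<^sup>+x. ennreal (d x) * indicator (box a b) x \<partial>lborel)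
      = (\<integral>\<^sup>+x. ennreal (- d x) * indicator (box a b) x \<partial>lborel)"
      using *(1) by simp_all
  qed
  have "?P = ?N"
  proof (rule measure_eqI_generator_eq[where \<Omega>=UNIV and E="range (\<lambda>(a, b). box a b)"
        and A="\<lambda>n. box (- real n *\<^sub>R One) (real n *\<^sub>R One)"])
    show "Int_stable (range (\<lambda>(a, b). box a b :: 'a set))"
      by (auto simp: Int_stable_def box_Int_box)
    show "sets ?P = sigma_sets UNIV (range (\<lambda>(a, b). box a b))"
      "sets ?N = sigma_sets UNIV (range (\<lambda>(a, b). box a b))"
      by (simp_all add: borel_eq_box)
    show "(\<Union>n. box (- real n *\<^sub>R One) (real n *\<^sub>R One)) = (UNIV :: 'a set)"
      using UN_box_eq_UNIV by simp
    show "emeasure ?P (box (- real n *\<^sub>R One) (real n *\<^sub>R One)) \<noteq> \<infinity>" for n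
      using fin by (simp add: emeasure_density less_top)
  qed (auto simp: emeasure_density eq)
  then have "AE x in lborel. ennreal (d x) = ennreal (- d x)"
    by (intro sigma_finite_measure.density_unique[OF sigma_finite_lborel]) auto
  then show ?thesis
    by eventually_elim (metis ennreal_eq_0_iff linorder_le_cases neg_le_0_iff_le order_antisym)
qed

lemma AE_zero_if_test_integrals_zero:
  fixes d :: "real ^ 'n::finite \<Rightarrow> real"
  assumes int: "\<And>a b. set_integrable lborel (box a b) d"
    and zero: "\<And>\<eta>. \<eta> \<in> test_functions \<Longrightarrow> (\<integral>x. d x * \<eta> x \<partial>lborel) = 0"
    and d[measurable]: "d \<in> borel_measurable borel"
  shows "AE x in lborel. d x = 0"
proof (rule AE_zero_if_box_integrals_zero[OF int _ d])
  fix a b :: "real ^ 'n"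
  have [measurable]: "box_bump n a b \<in> borel_measurable borel" for n
    by (intro test_borel box_bump_test)
  have "(\<lambda>n. \<integral>x. d x * box_bump n a b x \<partial>lborel) \<longlonglongrightarrow> (\<integral>x. d x * indicator (box a b) x \<partial>lborel)"
  proof (rule integral_dominated_convergence[where w="\<lambda>x. \<bar>indicator (box a b) x * d x\<bar>"])
    show "integrable lborel (\<lambda>x. \<bar>indicator (box a b) x * d x\<bar>)"
      using int[of a b] by (intro integrable_abs) (simp add: set_integrable_def)
    show "AE x in lborel. (\<lambda>n. d x * box_bump n a b x) \<longlonglongrightarrow> d x * indicator (box a b) x"
      by (auto intro!: tendsto_mult box_bump_tendsto)
    show "AE x in lborel. norm (d x * box_bump n a b x) \<le> \<bar>indicator (box a b) x * d x\<bar>" for n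
    proof (rule AE_I2)
      fix x
      show "norm (d x * box_bump n a b x) \<le> \<bar>indicator (box a b) x * d x\<bar>"
        using box_bump_bounds[of n a b x] box_bump_outside[of x a b n]
        by (cases "x \<in> box a b") (auto simp: abs_mult mult_left_le)
    qed
  qed auto
  then have "(\<integral>x. d x * indicator (box a b) x \<partial>lborel) = 0"
    by (simp add: zero[OF box_bump_test] LIMSEQ_const_iff)
  then show "(LINT x:box a b|lborel. d x) = 0"
    by (simp add: set_lebesgue_integral_def mult.commute)
qed

section \<open>The Gaussian and its derivatives\<close>

text \<open>
  Polynomials times the Gaussian, generated so that closure under partial derivatives and integrability
  both follow by induction.
\<close>

inductive_set gaussian_polys :: "(real ^ 'n::finite \<Rightarrow> real) set" where
  gaussian: "(\<lambda>x. exp (- (x \<bullet> x) / 4)) \<in> gaussian_polys"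
| coordinate: "k \<in> gaussian_polys \<Longrightarrow> (\<lambda>x. x $ i * k x) \<in> gaussian_polys"
| combination: "k \<in> gaussian_polys \<Longrightarrow> l \<in> gaussian_polys \<Longrightarrow> (\<lambda>x. a * k x + b * l x) \<in> gaussian_polys"

lemma gaussian_has_derivative:
  "((\<lambda>x :: real ^ 'n::finite. exp (- (x \<bullet> x) / 4)) has_derivative
     (\<lambda>h. (x \<bullet> h) * (- 1 / 2) * exp (- (x \<bullet> x) / 4))) (at x)"
  by (auto intro!: derivative_eq_intros simp: inner_commute)

lemma gaussian_partial_derivative:
  "partial_derivative i (\<lambda>x :: real ^ 'n::finite. exp (- (x \<bullet> x) / 4))
     = (\<lambda>x. - (1/2) * (x $ i * exp (- (x \<bullet> x) / 4)))"
proof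
  fix x :: "real ^ 'n"
  show "partial_derivative i (\<lambda>x :: real ^ 'n. exp (- (x \<bullet> x) / 4)) x
      = - (1/2) * (x $ i * exp (- (x \<bullet> x) / 4))"
    unfolding partial_derivative_eqI[OF gaussian_has_derivative] by (simp add: inner_axis)
qed

lemma gaussian_polys_scale: "k \<in> gaussian_polys \<Longrightarrow> (\<lambda>x. c * k x) \<in> gaussian_polys"
  using combination[of k k c 0] by simp

lemma gaussian_polys_derivative:
  assumes "k \<in> gaussian_polys"
  shows "(\<forall>x. k differentiable (at x)) \<and> partial_derivative i k \<in> gaussian_polys"
  using assms
proof induct
  case gaussian
  show ?case
    unfolding gaussian_partial_derivative
    by (intro conjI allI differentiableI[OF gaussian_has_derivative] gaussian_polys_scale
        gaussian_polys.intros)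
next
  case (coordinate k j)
  then have D: "((\<lambda>x. x $ j * k x) has_derivative (\<lambda>h. x $ j * (\<Sum>i\<in>UNIV. h $ i * partial_derivative i k x)
      + h $ j * k x)) (at x)" for x
    by (intro has_derivative_mult has_derivative_partial_derivatives
        bounded_linear.has_derivative[OF bounded_linear_vec_nth] has_derivative_ident) auto
  have "partial_derivative i (\<lambda>x. x $ j * k x)
      = (\<lambda>x. 1 * (x $ j * partial_derivative i k x) + axis i 1 $ j * k x)"
    by (auto simp: partial_derivative_eqI[OF D])
  moreover have "\<dots> \<in> gaussian_polys" using coordinate by (intro gaussian_polys.intros) auto
  ultimately show ?case using differentiableI[OF D] by simp
next
  case (combination k l a b)
  then have D: "((\<lambda>x. a * k x + b * l x) has_derivative (\<lambda>h. a * (\<Sum>i\<in>UNIV. h $ i * partial_derivative i k x)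
      + b * (\<Sum>i\<in>UNIV. h $ i * partial_derivative i l x))) (at x)" for x
    by (intro has_derivative_add has_derivative_mult_right has_derivative_partial_derivatives) auto
  have "partial_derivative i (\<lambda>x. a * k x + b * l x)
      = (\<lambda>x. a * partial_derivative i k x + b * partial_derivative i l x)"
    by (auto simp: partial_derivative_eqI[OF D])
  moreover have "\<dots> \<in> gaussian_polys" using combination by (intro gaussian_polys.intros) auto
  ultimately show ?case using differentiableI[OF D] by simp
qed

lemma gaussian_polys_smooth: "k \<in> gaussian_polys \<Longrightarrow> smooth k"
  by (rule smooth_coinduct[of _ gaussian_polys]) (auto dest: gaussian_polys_derivative)

lemma gaussian_polys_iter_partial: "k \<in> gaussian_polys \<Longrightarrow> iter_partial is k \<in> gaussian_polys"
  by (induct "is") (auto dest: gaussian_polys_derivative)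

lemma gaussian_polys_sum:
  assumes "finite I" and "\<And>i. i \<in> I \<Longrightarrow> k i \<in> gaussian_polys"
  shows "(\<lambda>x. \<Sum>i\<in>I. k i x) \<in> gaussian_polys"
  using assms
proof (induct I rule: finite_induct)
  case empty
  show ?case using combination[OF gaussian gaussian, of 0 0] by simp
next
  case (insert i I)
  then show ?case using combination[of "k i" "\<lambda>x. \<Sum>i\<in>I. k i x" 1 1] by simp
qed

lemma gaussian_polys_laplacian: "k \<in> gaussian_polys \<Longrightarrow> laplacian k \<in> gaussian_polys"
  unfolding laplacian_alt by (intro gaussian_polys_sum gaussian_polys_iter_partial) auto

lemma gaussian_polys_bound:
  assumes "k \<in> gaussian_polys"
  shows "\<exists>C n. 0 \<le> C \<and> (\<forall>x. \<bar>k x\<bar> \<le> C * (1 + x \<bullet> x) ^ n * exp (- (x \<bullet> x) / 4))"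
  using assms
proof induct
  case gaussian
  show ?case by (rule exI[of _ 1], rule exI[of _ 0]) simp
next
  case (coordinate k j)
  then obtain C n where C: "0 \<le> C" "\<And>x. \<bar>k x\<bar> \<le> C * (1 + x \<bullet> x) ^ n * exp (- (x \<bullet> x) / 4)"
    by blast
  have "\<bar>x $ j * k x\<bar> \<le> C * (1 + x \<bullet> x) ^ Suc n * exp (- (x \<bullet> x) / 4)" for x
  proof -
    have "\<bar>x $ j\<bar> \<le> norm x" by (rule component_le_norm_cart)
    also have "norm x \<le> 1 + (norm x)\<^sup>2"
      using sum_squares_bound[of "norm x" 1] norm_ge_zero[of x] unfolding power_one mult_1_right by linarith
    finally have "\<bar>x $ j\<bar> \<le> 1 + x \<bullet> x" by (simp add: power2_norm_eq_inner)
    then have "\<bar>x $ j\<bar> * \<bar>k x\<bar> \<le> (1 + x \<bullet> x) * (C * (1 + x \<bullet> x) ^ n * exp (- (x \<bullet> x) / 4))"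
      by (intro mult_mono C) auto
    then show ?thesis by (simp add: abs_mult mult_ac)
  qed
  then show ?case using C(1) by blast
next
  case (combination k l a b)
  then obtain C n D m where C: "0 \<le> C" "\<And>x. \<bar>k x\<bar> \<le> C * (1 + x \<bullet> x) ^ n * exp (- (x \<bullet> x) / 4)"
    and D: "0 \<le> D" "\<And>x. \<bar>l x\<bar> \<le> D * (1 + x \<bullet> x) ^ m * exp (- (x \<bullet> x) / 4)"
    by blast
  have "\<bar>a * k x + b * l x\<bar> \<le> (\<bar>a\<bar> * C + \<bar>b\<bar> * D) * (1 + x \<bullet> x) ^ (n + m) * exp (- (x \<bullet> x) / 4)" for x
  proof -
    have k: "\<bar>k x\<bar> \<le> C * (1 + x \<bullet> x) ^ (n + m) * exp (- (x \<bullet> x) / 4)"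
      by (rule order_trans[OF C(2)]) (intro mult_right_mono mult_left_mono power_increasing C; simp)
    have l: "\<bar>l x\<bar> \<le> D * (1 + x \<bullet> x) ^ (n + m) * exp (- (x \<bullet> x) / 4)"
      by (rule order_trans[OF D(2)]) (intro mult_right_mono mult_left_mono power_increasing D; simp)
    have "\<bar>a * k x + b * l x\<bar> \<le> \<bar>a\<bar> * \<bar>k x\<bar> + \<bar>b\<bar> * \<bar>l x\<bar>"
      by (simp add: abs_mult[symmetric] abs_triangle_ineq)
    also have "\<dots> \<le> \<bar>a\<bar> * (C * (1 + x \<bullet> x) ^ (n + m) * exp (- (x \<bullet> x) / 4))
        + \<bar>b\<bar> * (D * (1 + x \<bullet> x) ^ (n + m) * exp (- (x \<bullet> x) / 4))"
      by (intro add_mono mult_left_mono k l) auto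
    finally show ?thesis by (simp add: algebra_simps)
  qed
  moreover have "0 \<le> \<bar>a\<bar> * C + \<bar>b\<bar> * D" using C D by simp
  ultimately show ?case by blast
qed

lemma integrable_gaussian: "integrable lborel (\<lambda>x :: 'a::euclidean_space. exp (- (x \<bullet> x) / 8))"
proof (rule integrableI_bounded)
  have "integrable lborel (\<lambda>t. sqrt (2 * pi * 2\<^sup>2) * normal_density 0 2 t)"
    by (intro integrable_mult_right) (simp add: integrable_normal_density)
  then have i: "integrable lborel (\<lambda>t::real. exp (- t\<^sup>2 / 8))"
    by (simp add: normal_density_def)
  have "exp (- (x \<bullet> x) / 8) = (\<Prod>b\<in>Basis. exp (- (x \<bullet> b)\<^sup>2 / 8))" for x :: 'a
    by (subst euclidean_inner) (simp add: exp_sum[symmetric] sum_divide_distrib sum_negf power2_eq_square)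
  then have "(\<integral>\<^sup>+x. ennreal (norm (exp (- (x \<bullet> x) / 8))) \<partial>(lborel :: 'a measure))
      = (\<integral>\<^sup>+x. (\<Prod>b\<in>Basis. ennreal (exp (- (x \<bullet> b)\<^sup>2 / 8))) \<partial>(lborel :: 'a measure))"
    by (simp add: prod_ennreal abs_prod)
  also have "\<dots> = (\<Prod>b\<in>(Basis :: 'a set). \<integral>\<^sup>+t. ennreal (exp (- t\<^sup>2 / 8)) \<partial>lborel)"
    by (rule nn_integral_lborel_prod) auto
  also have "\<dots> < \<infinity>"
    using i by (auto simp: integrable_iff_bounded ennreal_prod_eq_top power_less_top_ennreal)
  finally show "(\<integral>\<^sup>+x. ennreal (norm (exp (- (x \<bullet> x) / 8))) \<partial>(lborel :: 'a measure)) < \<infinity>" .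
qed auto

lemma gaussian_polys_integrable:
  assumes "k \<in> gaussian_polys"
  shows "integrable lborel k"
proof -
  obtain C n where C: "0 \<le> C" "\<And>x. \<bar>k x\<bar> \<le> C * (1 + x \<bullet> x) ^ n * exp (- (x \<bullet> x) / 4)"
    using gaussian_polys_bound[OF assms] by blast
  define K where "K = C * (8 ^ n * fact n * exp (1/8))"
  have "\<bar>k x\<bar> \<le> K * exp (- (x \<bullet> x) / 8)" for x
  proof -
    have "((1 + x \<bullet> x) / 8) ^ n \<le> fact n * exp ((1 + x \<bullet> x) / 8)"
      by (rule power_le_fact_exp) simp
    then have "(1 + x \<bullet> x) ^ n \<le> 8 ^ n * fact n * exp ((1 + x \<bullet> x) / 8)"
      by (simp add: power_divide divide_le_eq mult_ac)
    then have "C * (1 + x \<bullet> x) ^ n * exp (- (x \<bullet> x) / 4)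
        \<le> C * (8 ^ n * fact n * exp ((1 + x \<bullet> x) / 8)) * exp (- (x \<bullet> x) / 4)"
      using C(1) by (intro mult_right_mono mult_left_mono) auto
    also have "\<dots> = C * (8 ^ n * fact n) * (exp ((1 + x \<bullet> x) / 8) * exp (- (x \<bullet> x) / 4))"
      by (simp only: mult_ac)
    also have "exp ((1 + x \<bullet> x) / 8) * exp (- (x \<bullet> x) / 4) = exp (1/8) * exp (- (x \<bullet> x) / 8)"
      by (simp only: exp_add[symmetric]) (simp add: field_simps)
    finally show ?thesis
      using C(2)[of x] by (simp add: K_def mult_ac)
  qed
  then show ?thesis
    using smooth_borel[OF gaussian_polys_smooth[OF assms]]
    by (intro Bochner_Integration.integrable_bound[OF integrable_mult_right[OF integrable_gaussian, of K]])
       (auto intro: order_trans[OF _ abs_ge_self])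
qed

lemma gaussian_integral_pos: "(\<integral>x. exp (- (x \<bullet> x) / 4) \<partial>(lborel :: (real ^ 'n::finite) measure)) > 0"
proof -
  have i: "integrable lborel (\<lambda>x :: real ^ 'n. exp (- (x \<bullet> x) / 4))"
    by (intro gaussian_polys_integrable gaussian)
  have "(\<integral>x. exp (- (x \<bullet> x) / 4) \<partial>(lborel :: (real ^ 'n) measure)) \<noteq> 0"
    using integral_nonneg_eq_0_iff_AE[OF i]
    by (simp add: eventually_const_iff ae_filter_eq_bot_iff)
  moreover have "(\<integral>x. exp (- (x \<bullet> x) / 4) \<partial>(lborel :: (real ^ 'n) measure)) \<ge> 0"
    by (rule integral_nonneg_AE) simp
  ultimately show ?thesis by (simp only: less_le not_sym simp_thms)
qed

definition gauss :: "real ^ 'n::finite \<Rightarrow> real" where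
  "gauss x = exp (- (x \<bullet> x) / 4) / (\<integral>y. exp (- (y \<bullet> y) / 4) \<partial>(lborel :: (real ^ 'n) measure))"

lemma gauss_gaussian_poly: "(gauss :: real ^ 'n::finite \<Rightarrow> real) \<in> gaussian_polys"
proof -
  let ?c = "\<integral>y. exp (- (y \<bullet> y) / 4) \<partial>(lborel :: (real ^ 'n) measure)"
  have "gauss = (\<lambda>x :: real ^ 'n. inverse ?c * exp (- (x \<bullet> x) / 4))"
    unfolding gauss_def[abs_def] by (simp only: divide_inverse[of _ ?c] mult.commute)
  then show ?thesis
    by (rule ssubst) (rule gaussian_polys_scale[OF gaussian])
qed

lemma gauss_integral: "(\<integral>x. gauss x \<partial>(lborel :: (real ^ 'n::finite) measure)) = 1"
  using gaussian_integral_pos[where 'n='n] by (simp add: gauss_def[abs_def])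

lemma gauss_nonneg: "0 \<le> gauss x" for x :: "real ^ 'n::finite"
  using gaussian_integral_pos[where 'n='n] by (simp add: gauss_def)

text \<open>
  This first-order equation is what makes the heat averages below solve the heat equation.
\<close>

lemma gauss_partial_derivative: "partial_derivative i gauss x = - (1/2) * (x $ i * gauss x)"
  for x :: "real ^ 'n::finite"
proof -
  have D: "((gauss :: real ^ 'n \<Rightarrow> real) has_derivative (\<lambda>h. (x \<bullet> h) * (- 1 / 2) * exp (- (x \<bullet> x) / 4)
     / (\<integral>y. exp (- (y \<bullet> y) / 4) \<partial>(lborel :: (real ^ 'n) measure)))) (at x)"
    unfolding gauss_def[abs_def]
    by (rule bounded_linear.has_derivative[OF bounded_linear_divide gaussian_has_derivative])
  show ?thesis
    by (simp add: partial_derivative_eqI[OF D] inner_axis gauss_def)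
qed

section \<open>Heat averages of test functions\<close>

text \<open>
  The value at the origin of the heat flow at time \<open>t\<close> with initial value \<open>w\<close>, written with the
  substitution that turns the heat kernel into the fixed density \<open>gauss\<close>.
\<close>

definition heat_average :: "(real ^ 'n::finite \<Rightarrow> real) \<Rightarrow> real \<Rightarrow> real" where
  "heat_average w t = (\<integral>y. gauss y * w (sqrt t *\<^sub>R y) \<partial>lborel)"

lemma integrable_mult_bounded:
  fixes k w :: "'a \<Rightarrow> real"
  assumes "integrable M k" and "w \<in> borel_measurable M" and "\<And>x. \<bar>w x\<bar> \<le> B"
  shows "integrable M (\<lambda>x. k x * w x)"
proof (rule Bochner_Integration.integrable_bound[OF integrable_mult_right[OF assms(1), of B]])
  show "AE x in M. norm (k x * w x) \<le> norm (B * k x)"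
    using order_trans[OF assms(3) abs_ge_self]
    by (auto simp: abs_mult mult.commute[of B] intro!: mult_left_mono)
qed (use assms borel_measurable_integrable in auto)

lemma integrable_gaussian_poly_test:
  assumes "k \<in> gaussian_polys" and "w \<in> test_functions"
  shows "integrable lborel (\<lambda>y. k y * w (c *\<^sub>R y))"
proof -
  obtain B where "\<And>x. \<bar>w x\<bar> \<le> B" using test_bounded[OF assms(2)] by blast
  then show ?thesis
    using test_borel[OF assms(2)]
    by (intro integrable_mult_bounded[of _ _ _ B] gaussian_polys_integrable assms) auto
qed

lemma heat_average_bounded:
  fixes w :: "real ^ 'n::finite \<Rightarrow> real"
  assumes "w \<in> test_functions"
  obtains B where "\<And>t. \<bar>heat_average w t\<bar> \<le> B"
proof -
  obtain B where B: "\<And>x. \<bar>w x\<bar> \<le> B" using test_bounded[OF assms] by blast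
  have "\<bar>heat_average w t\<bar> \<le> B" for t
  proof -
    have "\<bar>heat_average w t\<bar> \<le> (\<integral>y. gauss y * B \<partial>(lborel :: (real ^ 'n) measure))"
      unfolding heat_average_def real_norm_def[symmetric]
    proof (rule Bochner_Integration.integral_norm_bound_integral)
      show "integrable lborel (\<lambda>y. gauss y * w (sqrt t *\<^sub>R y))"
        by (intro integrable_gaussian_poly_test gauss_gaussian_poly assms)
      show "integrable lborel (\<lambda>y :: real ^ 'n. gauss y * B)"
        by (intro integrable_mult_left gaussian_polys_integrable gauss_gaussian_poly)
      show "norm (gauss y * w (sqrt t *\<^sub>R y)) \<le> gauss y * B" for y
        using B gauss_nonneg[of y] by (simp add: abs_mult mult_left_mono)
    qed
    then show ?thesis by (simp add: gauss_integral)
  qed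
  then show ?thesis by (rule that)
qed

lemma heat_average_tendsto:
  fixes w :: "real ^ 'n::finite \<Rightarrow> real"
  assumes "w \<in> test_functions"
  shows "(heat_average w \<longlongrightarrow> w 0) (at_right 0)"
proof -
  obtain B where B: "\<And>x. \<bar>w x\<bar> \<le> B" using test_bounded[OF assms] by blast
  have c: "isCont w x" for x
    using smooth_continuous[OF test_smooth[OF assms]] by (simp add: continuous_on_eq_continuous_at)
  have "((\<lambda>t. \<integral>y. gauss y * w (sqrt t *\<^sub>R y) \<partial>lborel) \<longlongrightarrow> (\<integral>y. gauss y * w 0 \<partial>(lborel :: (real ^ 'n) measure))) (at_right 0)"
    unfolding tendsto_at_iff_sequentially comp_def
  proof (intro allI impI)
    fix X :: "nat \<Rightarrow> real" assume "\<forall>i. X i \<in> {0<..} - {0}" and X: "X \<longlonglongrightarrow> 0"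
    show "(\<lambda>n. \<integral>y. gauss y * w (sqrt (X n) *\<^sub>R y) \<partial>lborel) \<longlonglongrightarrow> (\<integral>y. gauss y * w 0 \<partial>(lborel :: (real ^ 'n) measure))"
    proof (rule integral_dominated_convergence[where w="\<lambda>y :: real ^ 'n. gauss y * B"])
      show "integrable lborel (\<lambda>y :: real ^ 'n. gauss y * B)"
        by (intro integrable_mult_left gaussian_polys_integrable gauss_gaussian_poly)
      show "(\<lambda>y. gauss y * w (sqrt (X n) *\<^sub>R y)) \<in> borel_measurable lborel" for n
        by (intro borel_measurable_integrable integrable_gaussian_poly_test gauss_gaussian_poly assms)
      show "(\<lambda>y :: real ^ 'n. gauss y * w 0) \<in> borel_measurable lborel"
        by (intro borel_measurable_integrable integrable_mult_left gaussian_polys_integrable gauss_gaussian_poly)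
      show "AE y :: real ^ 'n in lborel. norm (gauss y * w (sqrt (X n) *\<^sub>R y)) \<le> gauss y * B" for n
        using B by (intro AE_I2) (simp add: abs_mult mult_left_mono gauss_nonneg)
      show "AE y in lborel. (\<lambda>n. gauss y * w (sqrt (X n) *\<^sub>R y)) \<longlonglongrightarrow> gauss y * w 0"
      proof (rule AE_I2)
        fix y :: "real ^ 'n"
        have "(\<lambda>n. sqrt (X n) *\<^sub>R y) \<longlonglongrightarrow> sqrt 0 *\<^sub>R y"
          by (intro tendsto_intros X)
        then show "(\<lambda>n. gauss y * w (sqrt (X n) *\<^sub>R y)) \<longlonglongrightarrow> gauss y * w 0"
          by (intro tendsto_mult_left isCont_tendsto_compose[OF c]) simp
      qed
    qed
  qed
  then show ?thesis
    unfolding heat_average_def[abs_def] by (simp add: gauss_integral)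
qed

text \<open>
  Differentiation under the integral brings down \<open>y\<close> from the chain rule.  The product of \<open>y $ i\<close> and
  \<open>gauss y\<close> is a partial derivative of \<open>gauss\<close>, and integration by parts turns it into
  a second derivative of \<open>w\<close>.
\<close>

lemma heat_average_has_real_derivative:
  fixes w :: "real ^ 'n::finite \<Rightarrow> real"
  assumes w: "w \<in> test_functions" and "t > 0"
  shows "(heat_average w has_real_derivative heat_average (laplacian w) t) (at t)"
proof -
  have D: "partial_derivative i w \<in> test_functions" for i
    using w by (rule test_partial_derivative)
  have "\<exists>C. \<forall>x. \<bar>partial_derivative i w x\<bar> \<le> C" for i
    using test_bounded[OF D[of i]] by blast
  then obtain C where C: "\<And>i x. \<bar>partial_derivative i w x\<bar> \<le> C i"
    by metis
  define f' where "f' s y = (\<Sum>i\<in>UNIV. (y $ i * gauss y) * partial_derivative i w (sqrt s *\<^sub>R y)) / (2 * sqrt s)"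
    for s and y :: "real ^ 'n"
  have co: "(\<lambda>y. y $ i * gauss y) \<in> gaussian_polys" for i
    by (intro gaussian_polys.coordinate gauss_gaussian_poly)
  have int: "integrable lborel (\<lambda>y. (y $ i * gauss y) * partial_derivative i w (sqrt s *\<^sub>R y))" for i s
    by (intro integrable_gaussian_poly_test co D)
  have "((\<lambda>t. \<integral>y. gauss y * w (sqrt t *\<^sub>R y) \<partial>lborel) has_real_derivative (\<integral>y. f' t y \<partial>lborel)) (at t)"
  proof (rule has_real_derivative_integral[where \<delta>="t/2" and
        B="\<lambda>y. (\<Sum>i\<in>UNIV. \<bar>y $ i * gauss y\<bar> * C i) / (2 * sqrt (t/2))"])
    show "integrable lborel (\<lambda>y. gauss y * w (sqrt s *\<^sub>R y))" for s
      by (intro integrable_gaussian_poly_test gauss_gaussian_poly w)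
    show "integrable lborel (\<lambda>y :: real ^ 'n. (\<Sum>i\<in>UNIV. \<bar>y $ i * gauss y\<bar> * C i) / (2 * sqrt (t/2)))"
      using gaussian_polys_integrable[OF co]
      by (intro integrable_divide Bochner_Integration.integrable_sum integrable_mult_left integrable_abs) auto
    show "f' t \<in> borel_measurable lborel"
      unfolding f'_def[abs_def] using int by (intro borel_measurable_divide borel_measurable_sum) auto
    fix s :: real and y :: "real ^ 'n" assume "\<bar>s - t\<bar> < t/2"
    then have s: "s > 0" "t / 2 \<le> s" by (auto simp: abs_if split: if_splits)
    have "((\<lambda>s. sqrt s *\<^sub>R y) has_derivative (\<lambda>h. (h / (2 * sqrt s)) *\<^sub>R y)) (at s)"
    proof (rule has_derivative_scaleR_left)
      show "(sqrt has_derivative (\<lambda>h. h / (2 * sqrt s))) (at s)"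
        using DERIV_real_sqrt[OF s(1)] unfolding has_field_derivative_def
        by (rule has_derivative_eq_rhs) (simp add: fun_eq_iff field_simps)
    qed
    from has_derivative_compose[OF this has_derivative_partial_derivatives[OF
          smooth_differentiable[OF test_smooth[OF w]]]]
    have "((\<lambda>s. w (sqrt s *\<^sub>R y)) has_real_derivative
        (\<Sum>i\<in>UNIV. y $ i * partial_derivative i w (sqrt s *\<^sub>R y)) / (2 * sqrt s)) (at s)"
      unfolding has_field_derivative_def
      by (rule has_derivative_eq_rhs) (simp add: fun_eq_iff sum_distrib_left sum_divide_distrib mult_ac)
    from DERIV_cmult[OF this, of "gauss y"]
    show "((\<lambda>s. gauss y * w (sqrt s *\<^sub>R y)) has_real_derivative f' s y) (at s)"
      by (simp add: f'_def sum_distrib_left mult_ac)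
    have "\<bar>f' s y\<bar> = \<bar>\<Sum>i\<in>UNIV. (y $ i * gauss y) * partial_derivative i w (sqrt s *\<^sub>R y)\<bar> / (2 * sqrt s)"
      using s by (simp add: f'_def)
    also have "\<dots> \<le> (\<Sum>i\<in>UNIV. \<bar>y $ i * gauss y\<bar> * C i) / (2 * sqrt (t/2))"
    proof (rule frac_le)
      show "\<bar>\<Sum>i\<in>UNIV. (y $ i * gauss y) * partial_derivative i w (sqrt s *\<^sub>R y)\<bar>
          \<le> (\<Sum>i\<in>UNIV. \<bar>y $ i * gauss y\<bar> * C i)"
        by (rule order_trans[OF sum_abs]) (intro sum_mono, simp add: abs_mult C mult_left_mono)
      show "0 \<le> (\<Sum>i\<in>UNIV. \<bar>y $ i * gauss y\<bar> * C i)"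
        using order_trans[OF abs_ge_zero C] by (intro sum_nonneg mult_nonneg_nonneg) auto
    qed (use s \<open>t > 0\<close> in auto)
    finally show "\<bar>f' s y\<bar> \<le> (\<Sum>i\<in>UNIV. \<bar>y $ i * gauss y\<bar> * C i) / (2 * sqrt (t/2))" .
  qed (use \<open>t > 0\<close> in auto)
  moreover have "(\<integral>y. f' t y \<partial>lborel) = heat_average (laplacian w) t"
  proof -
    have ibp: "(\<integral>y. (y $ i * gauss y) * partial_derivative i w (sqrt t *\<^sub>R y) \<partial>lborel)
        = 2 * sqrt t * (\<integral>y. gauss y * iter_partial [i, i] w (sqrt t *\<^sub>R y) \<partial>lborel)" for i
    proof -
      have tst: "(\<lambda>y. partial_derivative i w (sqrt t *\<^sub>R y)) \<in> test_functions"
        using test_affine[OF D[of i], of "sqrt t" 0] \<open>t > 0\<close> by simp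
      have pd: "partial_derivative i (\<lambda>y. partial_derivative i w (sqrt t *\<^sub>R y))
          = (\<lambda>y. sqrt t * iter_partial [i, i] w (sqrt t *\<^sub>R y))"
        using partial_derivative_affine[where \<phi>="partial_derivative i w" and i=i and a=0 and c="sqrt t"] D
        by (simp add: smooth_differentiable test_smooth)
      have "(\<integral>y. (y $ i * gauss y) * partial_derivative i w (sqrt t *\<^sub>R y) \<partial>lborel)
          = (\<integral>y. (-2) * (partial_derivative i gauss y * partial_derivative i w (sqrt t *\<^sub>R y)) \<partial>lborel)"
        by (simp add: gauss_partial_derivative mult_ac)
      also have "\<dots> = (-2) * (\<integral>y. partial_derivative i gauss y * partial_derivative i w (sqrt t *\<^sub>R y) \<partial>lborel)"
        by (rule integral_mult_right_zero)
      also have "\<dots> = 2 * (\<integral>y. gauss y * (sqrt t * iter_partial [i, i] w (sqrt t *\<^sub>R y)) \<partial>lborel)"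
        using integration_by_parts[OF gaussian_polys_smooth[OF gauss_gaussian_poly] tst, of i]
        unfolding pd by simp
      also have "\<dots> = 2 * (\<integral>y. sqrt t * (gauss y * iter_partial [i, i] w (sqrt t *\<^sub>R y)) \<partial>lborel)"
        by (simp only: mult_ac)
      finally show ?thesis by simp
    qed
    have int2: "integrable lborel (\<lambda>y. gauss y * iter_partial [i, i] w (sqrt t *\<^sub>R y))" for i
      by (intro integrable_gaussian_poly_test gauss_gaussian_poly test_iter_partial w)
    have "(\<integral>y. f' t y \<partial>lborel)
        = (\<integral>y. (\<Sum>i\<in>UNIV. (y $ i * gauss y) * partial_derivative i w (sqrt t *\<^sub>R y)) \<partial>lborel) / (2 * sqrt t)"
      unfolding f'_def by (rule integral_divide_zero)
    also have "\<dots> = (\<Sum>i\<in>UNIV. 2 * sqrt t * (\<integral>y. gauss y * iter_partial [i, i] w (sqrt t *\<^sub>R y) \<partial>lborel)) / (2 * sqrt t)"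
      by (simp only: Bochner_Integration.integral_sum[OF int] ibp)
    also have "\<dots> = (\<Sum>i\<in>UNIV. \<integral>y. gauss y * iter_partial [i, i] w (sqrt t *\<^sub>R y) \<partial>lborel)"
      using \<open>t > 0\<close> by (simp add: sum_distrib_left[symmetric] del: iter_partial.simps)
    also have "\<dots> = heat_average (laplacian w) t"
      unfolding heat_average_def laplacian_def sum_distrib_left
      by (rule Bochner_Integration.integral_sum[OF int2, symmetric])
    finally show ?thesis .
  qed
  ultimately show ?thesis
    unfolding heat_average_def[abs_def] by simp
qed

text \<open>
  Moving both Laplacians to the Gaussian exhibits the decay \<open>1 / t\<^sup>2\<close> in time, the gain on which the
  absolute convergence of the fundamental solution rests.
\<close>

lemma heat_average_bilaplacian:
  fixes w :: "real ^ 'n::finite \<Rightarrow> real"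
  assumes w: "w \<in> test_functions" and "t > 0"
  shows "heat_average (laplacian (laplacian w)) t
    = (\<integral>y. laplacian (laplacian gauss) y * w (sqrt t *\<^sub>R y) \<partial>lborel) / t\<^sup>2"
proof -
  let ?v = "\<lambda>y. w (sqrt t *\<^sub>R y)"
  have v: "?v \<in> test_functions"
    using test_affine[OF w, of "sqrt t" 0] \<open>t > 0\<close> by simp
  have l: "laplacian ?v = (\<lambda>y. t * laplacian w (sqrt t *\<^sub>R y))"
    using laplacian_affine[OF test_smooth[OF w], of 0 "sqrt t"] \<open>t > 0\<close> by simp
  let ?v' = "\<lambda>y. laplacian w (sqrt t *\<^sub>R y)"
  have v': "?v' \<in> test_functions"
    using test_affine[OF test_laplacian[OF w], of "sqrt t" 0] \<open>t > 0\<close> by simp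
  have l': "laplacian ?v' = (\<lambda>y. t * laplacian (laplacian w) (sqrt t *\<^sub>R y))"
    using laplacian_affine[OF test_smooth[OF test_laplacian[OF w]], of 0 "sqrt t"] \<open>t > 0\<close> by simp
  have s: "smooth (gauss :: real ^ 'n \<Rightarrow> real)"
    by (intro gaussian_polys_smooth gauss_gaussian_poly)
  have "(\<integral>y. laplacian (laplacian gauss) y * ?v y \<partial>lborel) = (\<integral>y. t * (laplacian gauss y * ?v' y) \<partial>lborel)"
    using laplacian_integration_by_parts[OF smooth_laplacian[OF s] v] unfolding l by (simp add: mult_ac)
  also have "\<dots> = t * (\<integral>y. laplacian gauss y * ?v' y \<partial>lborel)"
    by (rule integral_mult_right_zero)
  also have "(\<integral>y. laplacian gauss y * ?v' y \<partial>lborel)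
      = (\<integral>y. t * (gauss y * laplacian (laplacian w) (sqrt t *\<^sub>R y)) \<partial>lborel)"
    using laplacian_integration_by_parts[OF s v'] unfolding l' by (simp add: mult_ac)
  also have "\<dots> = t * heat_average (laplacian (laplacian w)) t"
    unfolding heat_average_def by (rule integral_mult_right_zero)
  finally show ?thesis
    using \<open>t > 0\<close> by (simp add: power2_eq_square)
qed

lemma heat_average_bilaplacian_decay:
  fixes w :: "real ^ 'n::finite \<Rightarrow> real"
  assumes w: "w \<in> test_functions"
  obtains B where "\<And>t. t > 0 \<Longrightarrow> \<bar>heat_average (laplacian (laplacian w)) t\<bar> \<le> B / t\<^sup>2"
proof -
  obtain B where B: "\<And>x. \<bar>w x\<bar> \<le> B" using test_bounded[OF w] by blast
  let ?k = "laplacian (laplacian gauss) :: real ^ 'n \<Rightarrow> real"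
  have k: "?k \<in> gaussian_polys"
    by (intro gaussian_polys_laplacian gauss_gaussian_poly)
  have "\<bar>heat_average (laplacian (laplacian w)) t\<bar> \<le> (\<integral>y. \<bar>?k y\<bar> * B \<partial>lborel) / t\<^sup>2" if "t > 0" for t
  proof -
    have "\<bar>\<integral>y. ?k y * w (sqrt t *\<^sub>R y) \<partial>lborel\<bar> \<le> (\<integral>y. \<bar>?k y\<bar> * B \<partial>lborel)"
      unfolding real_norm_def[symmetric, of "lebesgue_integral _ _"]
    proof (rule Bochner_Integration.integral_norm_bound_integral)
      show "integrable lborel (\<lambda>y. ?k y * w (sqrt t *\<^sub>R y))"
        by (intro integrable_gaussian_poly_test k w)
      show "integrable lborel (\<lambda>y. \<bar>?k y\<bar> * B)"
        by (intro integrable_mult_left integrable_abs gaussian_polys_integrable k)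
      show "norm (?k y * w (sqrt t *\<^sub>R y)) \<le> \<bar>?k y\<bar> * B" for y
        using B by (simp add: abs_mult mult_left_mono)
    qed
    then show ?thesis
      by (simp add: heat_average_bilaplacian[OF w that] divide_right_mono)
  qed
  then show ?thesis by (rule that)
qed

section \<open>The weights in time\<close>

definition osc :: "real \<Rightarrow> real \<Rightarrow> real" where
  "osc s t = sin (s * t) / s"

text \<open>
  A smooth switch that tends to one exponentially fast and vanishes to second order at \<open>t = 0\<close>.
\<close>

definition cutoff :: "real \<Rightarrow> real" where
  "cutoff t = (1 - exp (- t))\<^sup>2"

definition cutoff' :: "real \<Rightarrow> real" where
  "cutoff' t = 2 * exp (- t) * (1 - exp (- t))"

definition cutoff'' :: "real \<Rightarrow> real" where
  "cutoff'' t = 2 * exp (- t) * (2 * exp (- t) - 1)"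

text \<open>
  The function \<open>\<beta>\<close> of the decomposition \<open>sin (s t) / s = \<alpha> + \<beta>''\<close>.  Without the cutoff, the factor
  \<open>- 1 / s\<^sup>2\<close> would make \<open>\<beta>''\<close> equal to \<open>sin (s t) / s\<close>; the cutoff makes \<open>\<beta>\<close> of order \<open>t\<^sup>3\<close> at the
  origin at the price of the exponentially small remainder \<open>\<alpha>\<close>.
\<close>

definition late_weight :: "real \<Rightarrow> real \<Rightarrow> real" where
  "late_weight s t = - (osc s t * cutoff t) / s\<^sup>2"

definition late_weight' :: "real \<Rightarrow> real \<Rightarrow> real" where
  "late_weight' s t = - (cos (s * t) * cutoff t + osc s t * cutoff' t) / s\<^sup>2"

definition late_weight'' :: "real \<Rightarrow> real \<Rightarrow> real" where
  "late_weight'' s t = osc s t * cutoff t - (2 * cos (s * t) * cutoff' t + osc s t * cutoff'' t) / s\<^sup>2"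

definition early_weight :: "real \<Rightarrow> real \<Rightarrow> real" where
  "early_weight s t = osc s t - late_weight'' s t"

lemma osc_deriv: "s \<noteq> 0 \<Longrightarrow> (osc s has_real_derivative cos (s * t)) (at t)"
  unfolding osc_def[abs_def] by (auto intro!: derivative_eq_intros)

lemma cos_deriv: "s \<noteq> 0 \<Longrightarrow> ((\<lambda>t. cos (s * t)) has_real_derivative - (s\<^sup>2 * osc s t)) (at t)"
  unfolding osc_def by (auto intro!: derivative_eq_intros simp: power2_eq_square)

lemma cutoff_deriv: "(cutoff has_real_derivative cutoff' t) (at t)"
  unfolding cutoff_def[abs_def] cutoff'_def by (auto intro!: derivative_eq_intros)

lemma cutoff'_deriv: "(cutoff' has_real_derivative cutoff'' t) (at t)"
  unfolding cutoff'_def[abs_def] cutoff''_def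
  by (auto intro!: derivative_eq_intros simp: algebra_simps)

lemma late_weight_deriv:
  assumes "s \<noteq> 0"
  shows "(late_weight s has_real_derivative late_weight' s t) (at t)"
proof -
  have "((\<lambda>t. - (osc s t * cutoff t) / s\<^sup>2) has_real_derivative
     - (cos (s * t) * cutoff t + cutoff' t * osc s t) / s\<^sup>2) (at t)"
    by (intro DERIV_cdivide DERIV_minus DERIV_mult osc_deriv cutoff_deriv assms)
  then show ?thesis
    unfolding late_weight_def[abs_def] late_weight'_def by (simp only: mult.commute)
qed

lemma late_weight'_deriv:
  assumes "s \<noteq> 0"
  shows "(late_weight' s has_real_derivative late_weight'' s t) (at t)"
proof -
  have "((\<lambda>t. - (cos (s * t) * cutoff t + osc s t * cutoff' t) / s\<^sup>2) has_real_derivative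
     - ((- (s\<^sup>2 * osc s t)) * cutoff t + cutoff' t * cos (s * t)
        + (cos (s * t) * cutoff' t + cutoff'' t * osc s t)) / s\<^sup>2) (at t)"
    by (intro DERIV_cdivide DERIV_minus DERIV_add DERIV_mult osc_deriv cos_deriv cutoff_deriv cutoff'_deriv assms)
  moreover have "- ((- (s\<^sup>2 * osc s t)) * cutoff t + cutoff' t * cos (s * t)
        + (cos (s * t) * cutoff' t + cutoff'' t * osc s t)) / s\<^sup>2 = late_weight'' s t"
    using assms unfolding late_weight''_def by (simp add: field_simps)
  ultimately show ?thesis
    unfolding late_weight'_def[abs_def] by simp
qed

lemma osc_bounds:
  assumes "s > 0" "t \<ge> 0"
  shows "\<bar>osc s t\<bar> \<le> t" "\<bar>osc s t\<bar> \<le> 1 / s"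
proof -
  show "\<bar>osc s t\<bar> \<le> t"
    using assms abs_sin_x_le_abs_x[of "s * t"] by (simp add: osc_def abs_mult divide_le_eq mult.commute)
  show "\<bar>osc s t\<bar> \<le> 1 / s"
    using assms by (simp add: osc_def divide_right_mono)
qed

lemma exp_minus_bounds:
  assumes "(t::real) \<ge> 0"
  shows "0 \<le> 1 - exp (- t)" "1 - exp (- t) \<le> t" "1 - exp (- t) \<le> 1"
  using assms exp_ge_add_one_self[of "- t"] by auto

text \<open>
  In \<open>osc s t - late_weight'' s t\<close> the oscillation is multiplied by \<open>1 - cutoff t\<close>, and every other
  term contains a derivative of the cutoff; all of these are exponentially small, and each vanishes at
  \<open>t = 0\<close>.
\<close>

lemma early_weight_bound:
  assumes "s > 0" "t \<ge> 0"
  shows "\<bar>early_weight s t\<bar> \<le> (2 + 6 / s\<^sup>2) * (t * exp (- t))"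
proof -
  let ?e = "exp (- t)"
  note e = exp_minus_bounds[OF assms(2)]
  have c: "\<bar>1 - cutoff t\<bar> \<le> 2 * ?e"
  proof -
    have "1 - cutoff t = ?e * (2 - ?e)" by (simp add: cutoff_def power2_eq_square algebra_simps)
    moreover have "\<bar>2 - ?e\<bar> \<le> 2"
      using e exp_gt_zero[of "- t"] unfolding abs_le_iff by linarith
    ultimately show ?thesis by (simp add: abs_mult mult.commute)
  qed
  have c': "\<bar>cutoff' t\<bar> \<le> 2 * ?e * t"
    using e by (simp add: cutoff'_def abs_mult)
  have c'': "\<bar>cutoff'' t\<bar> \<le> 2 * ?e"
  proof -
    have "\<bar>2 * ?e - 1\<bar> \<le> 1" using e by (simp add: abs_le_iff)
    then show ?thesis by (simp add: cutoff''_def abs_mult)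
  qed
  have "early_weight s t = osc s t * (1 - cutoff t) + (2 * cos (s * t) * cutoff' t + osc s t * cutoff'' t) / s\<^sup>2"
    by (simp add: early_weight_def late_weight''_def algebra_simps)
  also have "\<bar>\<dots>\<bar> \<le> \<bar>osc s t\<bar> * \<bar>1 - cutoff t\<bar>
      + (2 * \<bar>cos (s * t)\<bar> * \<bar>cutoff' t\<bar> + \<bar>osc s t\<bar> * \<bar>cutoff'' t\<bar>) / s\<^sup>2"
  proof (rule order_trans[OF abs_triangle_ineq], rule add_mono)
    show "\<bar>(2 * cos (s * t) * cutoff' t + osc s t * cutoff'' t) / s\<^sup>2\<bar>
        \<le> (2 * \<bar>cos (s * t)\<bar> * \<bar>cutoff' t\<bar> + \<bar>osc s t\<bar> * \<bar>cutoff'' t\<bar>) / s\<^sup>2"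
      using abs_triangle_ineq[of "2 * cos (s * t) * cutoff' t" "osc s t * cutoff'' t"]
      by (simp add: abs_mult divide_right_mono)
  qed (simp add: abs_mult)
  also have "\<dots> \<le> t * (2 * ?e) + (2 * 1 * (2 * ?e * t) + t * (2 * ?e)) / s\<^sup>2"
    by (intro add_mono mult_mono divide_right_mono c c' c'' osc_bounds assms) (use assms in auto)
  also have "\<dots> = (2 + 6 / s\<^sup>2) * (t * ?e)"
    using assms by (simp add: field_simps)
  finally show ?thesis .
qed

text \<open>
  The factor \<open>1 + 1 / t\<close> dominates the powers of \<open>1 / sqrt t\<close> of exponent at most two that
  derivatives in space produce.
\<close>

lemma early_weight_decay:
  assumes "s > 0"
  obtains K where "\<And>t. t > 0 \<Longrightarrow> \<bar>early_weight s t\<bar> * (1 + 1 / t) \<le> K / (1 + t\<^sup>2)"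
proof -
  have "\<bar>early_weight s t\<bar> * (1 + 1 / t) \<le> (2 + 6 / s\<^sup>2) * (6 * exp 1) / (1 + t\<^sup>2)" if "t > 0" for t
  proof -
    have "(1 + t) * (1 + t\<^sup>2) \<le> (1 + t) ^ 3"
      using that by (simp add: power3_eq_cube power2_eq_square algebra_simps)
    also have "\<dots> \<le> fact 3 * exp (1 + t)"
      using that by (intro power_le_fact_exp) auto
    finally have "(1 + t) * (1 + t\<^sup>2) \<le> 6 * exp (1 + t)"
      by (simp add: fact_numeral)
    then have "(1 + t) * (1 + t\<^sup>2) * exp (- t) \<le> 6 * exp (1 + t) * exp (- t)"
      by (intro mult_right_mono) auto
    also have "\<dots> = 6 * exp 1"
      by (simp add: mult_exp_exp)
    finally have le: "(1 + t) * exp (- t) \<le> 6 * exp 1 / (1 + t\<^sup>2)"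
      using that by (simp add: le_divide_eq add_pos_nonneg mult_ac)
    have "\<bar>early_weight s t\<bar> * (1 + 1 / t) \<le> (2 + 6 / s\<^sup>2) * (t * exp (- t)) * (1 + 1 / t)"
      using early_weight_bound[OF assms, of t] that by (intro mult_right_mono) auto
    also have "\<dots> = (2 + 6 / s\<^sup>2) * ((1 + t) * exp (- t))"
      using that by (simp add: field_simps)
    also have "\<dots> \<le> (2 + 6 / s\<^sup>2) * (6 * exp 1 / (1 + t\<^sup>2))"
      using assms by (intro mult_left_mono le) auto
    finally show ?thesis by simp
  qed
  then show ?thesis by (rule that)
qed

lemma late_weight_bounds:
  assumes "s > 0" "t \<ge> 0"
  shows "\<bar>late_weight s t\<bar> \<le> t ^ 3 / s\<^sup>2" "\<bar>late_weight s t\<bar> \<le> 1 / s ^ 3"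
proof -
  note e = exp_minus_bounds[OF assms(2)]
  have eq: "\<bar>late_weight s t\<bar> = \<bar>osc s t\<bar> * (1 - exp (- t))\<^sup>2 / s\<^sup>2"
    by (simp add: late_weight_def cutoff_def abs_mult)
  have "\<bar>osc s t\<bar> * (1 - exp (- t))\<^sup>2 / s\<^sup>2 \<le> t * t\<^sup>2 / s\<^sup>2"
    by (intro divide_right_mono mult_mono power_mono osc_bounds e assms) (use assms in auto)
  then show "\<bar>late_weight s t\<bar> \<le> t ^ 3 / s\<^sup>2"
    unfolding eq by (simp add: power3_eq_cube power2_eq_square mult.assoc)
  have "\<bar>osc s t\<bar> * (1 - exp (- t))\<^sup>2 / s\<^sup>2 \<le> (1 / s) * 1\<^sup>2 / s\<^sup>2"
    by (intro divide_right_mono mult_mono power_mono osc_bounds e assms) (use assms in auto)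
  then show "\<bar>late_weight s t\<bar> \<le> 1 / s ^ 3"
    unfolding eq by (simp add: power3_eq_cube power2_eq_square mult.assoc)
qed

text \<open>
  Here the additional division by \<open>t\<^sup>2\<close> comes from the second time derivative of the heat kernel.
  Near the origin it is absorbed by the order \<open>t\<^sup>3\<close> of the weight; at infinity it supplies the decay.
\<close>

lemma late_weight_decay:
  assumes "s > 0"
  obtains K where "\<And>t. t > 0 \<Longrightarrow> \<bar>late_weight s t\<bar> / t\<^sup>2 * (1 + 1 / t) \<le> K / (1 + t\<^sup>2)"
proof -
  define K where "K = 4 / s\<^sup>2 + 4 / s ^ 3"
  have K: "4 / s\<^sup>2 \<le> K" "4 / s ^ 3 \<le> K" using assms by (auto simp: K_def)
  have "\<bar>late_weight s t\<bar> / t\<^sup>2 * (1 + 1 / t) \<le> K / (1 + t\<^sup>2)" if "t > 0" for t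
  proof (cases "t \<le> 1")
    case True
    have "t * (1 + 1 / t) * (1 + t\<^sup>2) \<le> 2 * 2"
      using True that power_le_one[of t 2] by (intro mult_mono) (auto simp: field_simps)
    then have le: "t * (1 + 1 / t) \<le> 4 / (1 + t\<^sup>2)"
      by (simp add: le_divide_eq add_pos_nonneg)
    have "\<bar>late_weight s t\<bar> / t\<^sup>2 * (1 + 1 / t) \<le> (t ^ 3 / s\<^sup>2) / t\<^sup>2 * (1 + 1 / t)"
      using that assms by (intro mult_right_mono divide_right_mono late_weight_bounds) auto
    also have "\<dots> = (1 / s\<^sup>2) * (t * (1 + 1 / t))"
      using that by (simp add: power3_eq_cube power2_eq_square)
    also have "\<dots> \<le> (1 / s\<^sup>2) * (4 / (1 + t\<^sup>2))"
      by (intro mult_left_mono le) auto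
    also have "\<dots> = (4 / s\<^sup>2) / (1 + t\<^sup>2)" by simp
    also have "\<dots> \<le> K / (1 + t\<^sup>2)"
      by (intro divide_right_mono K) (simp add: add_nonneg_nonneg)
    finally show ?thesis .
  next
    case False
    then have t: "t \<ge> 1" by simp
    have "(1 + 1 / t) * (1 + t\<^sup>2) \<le> 2 * (2 * t\<^sup>2)"
      using t one_le_power[of t 2] by (intro mult_mono) (auto simp: field_simps)
    then have le: "(1 / t\<^sup>2) * (1 + 1 / t) \<le> 4 / (1 + t\<^sup>2)"
      using that by (simp add: le_divide_eq divide_le_eq add_pos_nonneg)
    have "\<bar>late_weight s t\<bar> / t\<^sup>2 * (1 + 1 / t) \<le> (1 / s ^ 3) / t\<^sup>2 * (1 + 1 / t)"
      using that assms by (intro mult_right_mono divide_right_mono late_weight_bounds) auto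
    also have "\<dots> = (1 / s ^ 3) * ((1 / t\<^sup>2) * (1 + 1 / t))"
      by simp
    also have "\<dots> \<le> (1 / s ^ 3) * (4 / (1 + t\<^sup>2))"
      using assms by (intro mult_left_mono le) auto
    also have "\<dots> = (4 / s ^ 3) / (1 + t\<^sup>2)" by simp
    also have "\<dots> \<le> K / (1 + t\<^sup>2)"
      by (intro divide_right_mono K) (simp add: add_nonneg_nonneg)
    finally show ?thesis .
  qed
  then show ?thesis by (rule that)
qed

lemma weights_measurable [measurable]:
  "early_weight s \<in> borel_measurable borel" "late_weight s \<in> borel_measurable borel"
  unfolding early_weight_def[abs_def] late_weight''_def[abs_def] late_weight_def[abs_def]
    osc_def[abs_def] cutoff_def[abs_def] cutoff'_def[abs_def] cutoff''_def[abs_def]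
  by measurable

lemma integrable_Cauchy_density:
  "integrable lborel (\<lambda>t::real. K / (1 + t\<^sup>2))"
proof -
  have "integrable lborel (\<lambda>t::real. K * inverse (1 + t\<^sup>2))"
    using integrable_inverse_1_plus_square
    by (intro integrable_mult_right) (simp add: set_integrable_def)
  then show ?thesis by (simp add: divide_inverse)
qed

lemma late_weight'_bounded:
  assumes "s > 0" "t \<ge> 0"
  shows "\<bar>late_weight' s t\<bar> \<le> (1 + 2 / s) / s\<^sup>2"
proof -
  note e = exp_minus_bounds[OF assms(2)]
  have c: "\<bar>cutoff t\<bar> \<le> 1" using e by (simp add: cutoff_def power_le_one)
  have c': "\<bar>cutoff' t\<bar> \<le> 2"
  proof -
    have "\<bar>cutoff' t\<bar> = 2 * (exp (- t) * (1 - exp (- t)))" using e by (simp add: cutoff'_def abs_mult)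
    also have "\<dots> \<le> 2 * (1 * 1)" using e by (intro mult_left_mono mult_mono) auto
    finally show ?thesis by simp
  qed
  have "\<bar>late_weight' s t\<bar> = \<bar>cos (s * t) * cutoff t + osc s t * cutoff' t\<bar> / s\<^sup>2"
    by (simp only: late_weight'_def abs_divide abs_minus_cancel abs_power2)
  also have "\<dots> \<le> (\<bar>cos (s * t)\<bar> * \<bar>cutoff t\<bar> + \<bar>osc s t\<bar> * \<bar>cutoff' t\<bar>) / s\<^sup>2"
    using abs_triangle_ineq[of "cos (s * t) * cutoff t" "osc s t * cutoff' t"]
    by (simp add: abs_mult divide_right_mono)
  also have "\<dots> \<le> (1 * 1 + (1 / s) * 2) / s\<^sup>2"
    by (intro divide_right_mono add_mono mult_mono c c' osc_bounds assms) (use assms in auto)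
  finally show ?thesis by simp
qed

section \<open>The fundamental identity\<close>

lemma tendsto_mult_bounded_zero:
  fixes f g :: "real \<Rightarrow> real"
  assumes "\<forall>\<^sub>F t in F. \<bar>f t\<bar> \<le> B" and "(g \<longlongrightarrow> 0) F"
  shows "((\<lambda>t. f t * g t) \<longlongrightarrow> 0) F"
proof (rule Lim_null_comparison)
  show "\<forall>\<^sub>F t in F. norm (f t * g t) \<le> B * \<bar>g t\<bar>"
    using assms(1) by eventually_elim (simp add: abs_mult mult_right_mono)
  show "((\<lambda>t. B * \<bar>g t\<bar>) \<longlongrightarrow> 0) F"
    using tendsto_mult_left[OF tendsto_rabs[OF assms(2)], of B] by simp
qed

lemma heat_bilaplacian_tendsto_zero:
  fixes w :: "real ^ 'n::finite \<Rightarrow> real"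
  assumes w: "w \<in> test_functions"
  shows "(heat_average (laplacian (laplacian w)) \<longlongrightarrow> 0) at_top"
proof -
  obtain B where B: "\<And>t. t > 0 \<Longrightarrow> \<bar>heat_average (laplacian (laplacian w)) t\<bar> \<le> B / t\<^sup>2"
    using heat_average_bilaplacian_decay[OF w] by blast
  show ?thesis
  proof (rule Lim_null_comparison)
    show "\<forall>\<^sub>F t in at_top. norm (heat_average (laplacian (laplacian w)) t) \<le> B / t\<^sup>2"
      using eventually_gt_at_top[of 0] by eventually_elim (use B in simp)
    show "((\<lambda>t. B / t\<^sup>2) \<longlongrightarrow> 0) at_top"
      by (intro tendsto_divide_0[OF tendsto_const] filterlim_at_top_imp_at_infinity
          filterlim_pow_at_top filterlim_ident) auto
  qed
qed

text \<open>
  Write \<open>\<sigma>\<close> for \<open>osc s\<close>, so that \<open>\<sigma>'' = - s\<^sup>2 \<sigma>\<close>, and recall \<open>\<alpha> + \<beta>'' = \<sigma>\<close>.  Then \<open>G\<close> is the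
  derivative of \<open>(\<sigma> + s\<^sup>2 \<beta>) V\<^sub>1 - (\<sigma>' + s\<^sup>2 \<beta>') V\<^sub>0 + \<beta> V\<^sub>3 - \<beta>' V\<^sub>2\<close>.  At infinity the first
  two coefficients vanish exponentially while \<open>V\<^sub>2\<close> and \<open>V\<^sub>3\<close> decay.  At the origin only \<open>\<sigma>' = 1\<close>
  is left.
\<close>

lemma weighted_heat_averages_integral:
  fixes w :: "real ^ 'n::finite \<Rightarrow> real"
  assumes w: "w \<in> test_functions" and s: "s > 0"
  defines "V \<equiv> \<lambda>j. heat_average ((laplacian ^^ j) w)"
  defines "G \<equiv> \<lambda>t. early_weight s t * (V 2 t + s\<^sup>2 * V 0 t) + late_weight s t * (V 4 t + s\<^sup>2 * V 2 t)"
  shows "set_integrable lborel {0<..} G" and "(LINT t:{0<..}|lborel. G t) = w 0"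
proof -
  have wj: "(laplacian ^^ j) w \<in> test_functions" for j
    by (induct j) (auto intro: w test_laplacian)
  have V: "(V j has_real_derivative V (Suc j) t) (at t)" if "t > 0" for j t
    using heat_average_has_real_derivative[OF wj that] by (simp add: V_def)
  have Vb: "\<exists>B. \<forall>t. \<bar>V j t\<bar> \<le> B" for j
    using heat_average_bounded[OF wj] unfolding V_def by blast
  have Vd: "\<exists>B. \<forall>t>0. \<bar>V (Suc (Suc j)) t\<bar> \<le> B / t\<^sup>2" for j
    using heat_average_bilaplacian_decay[OF wj[of j]] unfolding V_def by simp blast
  have V0: "(V j \<longlongrightarrow> (laplacian ^^ j) w 0) (at_right 0)" for j
    using heat_average_tendsto[OF wj] by (simp add: V_def)
  have Vinf: "(V (Suc (Suc j)) \<longlongrightarrow> 0) at_top" for j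
    using heat_bilaplacian_tendsto_zero[OF wj[of j]] by (simp add: V_def)
  \<comment> \<open>The antiderivative \<open>(\<sigma> + s\<^sup>2 \<beta>) V\<^sub>1 - (\<sigma>' + s\<^sup>2 \<beta>') V\<^sub>0 + \<beta> V\<^sub>3 - \<beta>' V\<^sub>2\<close>.\<close>
  define F where "F t = (osc s t + s\<^sup>2 * late_weight s t) * V 1 t
      - (cos (s * t) + s\<^sup>2 * late_weight' s t) * V 0 t
      + late_weight s t * V 3 t - late_weight' s t * V 2 t" for t
  have F: "(F has_real_derivative G t) (at t)" if "t > 0" for t
  proof -
    have V': "(V 0 has_real_derivative V 1 t) (at t)" "(V 1 has_real_derivative V 2 t) (at t)"
      "(V 2 has_real_derivative V 3 t) (at t)" "(V 3 has_real_derivative V 4 t) (at t)"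
      using V[OF that, of 0] V[OF that, of 1] V[OF that, of 2] V[OF that, of 3]
      by (simp_all add: eval_nat_numeral)
    have "(F has_real_derivative
        ((cos (s * t) + s\<^sup>2 * late_weight' s t) * V 1 t + V 2 t * (osc s t + s\<^sup>2 * late_weight s t)
        - ((- (s\<^sup>2 * osc s t) + s\<^sup>2 * late_weight'' s t) * V 0 t
           + V 1 t * (cos (s * t) + s\<^sup>2 * late_weight' s t))
        + (late_weight' s t * V 3 t + V 4 t * late_weight s t)
        - (late_weight'' s t * V 2 t + V 3 t * late_weight' s t))) (at t)"
      unfolding F_def[abs_def] using s
      by (intro DERIV_add DERIV_diff DERIV_mult DERIV_cmult osc_deriv cos_deriv late_weight_deriv
          late_weight'_deriv V') auto
    then show ?thesis
      by (rule DERIV_cong) (simp add: G_def early_weight_def algebra_simps del: One_nat_def)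
  qed
  have w_cont: "isCont (early_weight s) t" "isCont (late_weight s) t" for t
    unfolding early_weight_def[abs_def] late_weight''_def[abs_def] late_weight_def[abs_def]
      osc_def[abs_def] cutoff_def[abs_def] cutoff'_def[abs_def] cutoff''_def[abs_def]
    using s by (intro continuous_intros; simp)+
  have G_cont: "isCont G t" if "t > 0" for t
    unfolding G_def by (intro continuous_intros w_cont DERIV_isCont[OF V[OF that]])
  show int: "set_integrable lborel {0<..} G"
  proof -
    obtain K1 where K1: "\<And>t. t > 0 \<Longrightarrow> \<bar>early_weight s t\<bar> * (1 + 1 / t) \<le> K1 / (1 + t\<^sup>2)"
      using early_weight_decay[OF s] by blast
    obtain K2 where K2: "\<And>t. t > 0 \<Longrightarrow> \<bar>late_weight s t\<bar> / t\<^sup>2 * (1 + 1 / t) \<le> K2 / (1 + t\<^sup>2)"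
      using late_weight_decay[OF s] by blast
    obtain B0 B2 where B0: "\<And>t. \<bar>V 0 t\<bar> \<le> B0" and B2: "\<And>t. \<bar>V 2 t\<bar> \<le> B2"
      using Vb by blast
    obtain D2 where D2: "\<And>t. t > 0 \<Longrightarrow> \<bar>V 2 t\<bar> \<le> D2 / t\<^sup>2"
      using Vd[of 0] by (auto simp: numeral_2_eq_2)
    obtain D4 where D4: "\<And>t. t > 0 \<Longrightarrow> \<bar>V 4 t\<bar> \<le> D4 / t\<^sup>2"
      using Vd[of 2] by (auto simp: numeral_eq_Suc)
    define B where "B = B2 + s\<^sup>2 * B0"
    define D where "D = D4 + s\<^sup>2 * D2"
    have B: "0 \<le> B" using order_trans[OF abs_ge_zero B0] order_trans[OF abs_ge_zero B2] by (simp add: B_def)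
    have D: "0 \<le> D" using order_trans[OF abs_ge_zero D2[of 1]] order_trans[OF abs_ge_zero D4[of 1]] by (simp add: D_def)
    have G_le: "\<bar>G t\<bar> \<le> (B * K1 + D * K2) / (1 + t\<^sup>2)" if t: "t > 0" for t
    proof -
      have 1: "\<bar>V 2 t + s\<^sup>2 * V 0 t\<bar> \<le> B"
        using abs_triangle_ineq[of "V 2 t" "s\<^sup>2 * V 0 t"] mult_left_mono[OF B0[of t], of "s\<^sup>2"] B2[of t]
        by (simp add: B_def abs_mult)
      have 2: "\<bar>V 4 t + s\<^sup>2 * V 2 t\<bar> \<le> D / t\<^sup>2"
        using abs_triangle_ineq[of "V 4 t" "s\<^sup>2 * V 2 t"] mult_left_mono[OF D2[OF t], of "s\<^sup>2"] D4[OF t]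
        by (simp add: D_def abs_mult add_divide_distrib)
      have grow: "x \<le> x * (1 + 1 / t)" if "0 \<le> x" for x :: real
        using mult_left_mono[of 1 "1 + 1 / t" x] that t by simp
      have le1: "\<bar>early_weight s t\<bar> \<le> K1 / (1 + t\<^sup>2)"
        by (rule order_trans[OF grow K1[OF t]]) simp
      have le2: "\<bar>late_weight s t\<bar> / t\<^sup>2 \<le> K2 / (1 + t\<^sup>2)"
        by (rule order_trans[OF grow K2[OF t]]) simp
      have "\<bar>G t\<bar> \<le> \<bar>early_weight s t\<bar> * \<bar>V 2 t + s\<^sup>2 * V 0 t\<bar> + \<bar>late_weight s t\<bar> * \<bar>V 4 t + s\<^sup>2 * V 2 t\<bar>"
        unfolding G_def by (rule order_trans[OF abs_triangle_ineq]) (simp add: abs_mult)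
      also have "\<dots> \<le> \<bar>early_weight s t\<bar> * B + \<bar>late_weight s t\<bar> * (D / t\<^sup>2)"
        by (intro add_mono mult_left_mono 1 2) auto
      also have "\<dots> = B * \<bar>early_weight s t\<bar> + D * (\<bar>late_weight s t\<bar> / t\<^sup>2)"
        by simp
      also have "\<dots> \<le> B * (K1 / (1 + t\<^sup>2)) + D * (K2 / (1 + t\<^sup>2))"
        by (intro add_mono mult_left_mono le1 le2 B D)
      finally show ?thesis by (simp add: add_divide_distrib)
    qed
    have "set_borel_measurable borel {0<..} G"
      unfolding set_borel_measurable_def
      by (intro borel_measurable_continuous_on_indicator)
         (auto simp: continuous_on_eq_continuous_at intro: G_cont)
    then show ?thesis
      unfolding set_integrable_def set_borel_measurable_def
    proof (intro Bochner_Integration.integrable_bound[OF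
          integrable_Cauchy_density[of "\<bar>B * K1 + D * K2\<bar>"]] AE_I2)
      show "norm (indicator {0<..} t *\<^sub>R G t) \<le> norm (\<bar>B * K1 + D * K2\<bar> / (1 + t\<^sup>2))" for t
        using order_trans[OF G_le divide_right_mono[OF abs_ge_self], of t]
        by (cases "t > 0") (simp_all add: add_nonneg_nonneg)
    qed simp
  qed
  have "(LBINT t=0..\<infinity>. G t) = 0 - (- w 0)"
  proof (rule interval_integral_FTC_integrable[of _ _ F])
    show "(F has_vector_derivative G t) (at t)" if "0 < ereal t" for t
      using F that by (simp add: has_real_derivative_iff_has_vector_derivative)
    show "isCont G t" if "0 < ereal t" for t
      using G_cont that by simp
    have e: "einterval 0 \<infinity> = {0<..}"
      by (auto simp: einterval_def)
    show "set_integrable lborel (einterval 0 \<infinity>) G"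
      using int unfolding e .
    have "isCont (\<lambda>t. osc s t + s\<^sup>2 * late_weight s t) 0" "isCont (\<lambda>t. cos (s * t) + s\<^sup>2 * late_weight' s t) 0"
      "isCont (late_weight s) 0" "isCont (late_weight' s) 0"
      using s by (intro continuous_intros DERIV_isCont[OF osc_deriv] DERIV_isCont[OF late_weight_deriv]
          DERIV_isCont[OF late_weight'_deriv]; simp)+
    then have "((\<lambda>t. osc s t + s\<^sup>2 * late_weight s t) \<longlongrightarrow> 0) (at_right 0)"
      "((\<lambda>t. cos (s * t) + s\<^sup>2 * late_weight' s t) \<longlongrightarrow> 1) (at_right 0)"
      "(late_weight s \<longlongrightarrow> 0) (at_right 0)" "(late_weight' s \<longlongrightarrow> 0) (at_right 0)"
      unfolding isCont_def by (auto dest!: filterlim_at_split[THEN iffD1, THEN conjunct2]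
          simp: osc_def late_weight_def late_weight'_def cutoff_def cutoff'_def)
    then have "(F \<longlongrightarrow> 0 * (laplacian ^^ 1) w 0 - 1 * (laplacian ^^ 0) w 0
        + 0 * (laplacian ^^ 3) w 0 - 0 * (laplacian ^^ 2) w 0) (at_right 0)"
      unfolding F_def[abs_def] by (intro tendsto_add tendsto_diff tendsto_mult V0)
    then show "((F \<circ> real_of_ereal) \<longlongrightarrow> - w 0) (at_right 0)"
      by (simp add: zero_ereal_def ereal_tendsto_simps)
    have t0: "((\<lambda>t. V 1 t * (osc s t + s\<^sup>2 * late_weight s t)) \<longlongrightarrow> 0) at_top"
      "((\<lambda>t. V 0 t * (cos (s * t) + s\<^sup>2 * late_weight' s t)) \<longlongrightarrow> 0) at_top"
    proof -
      have z: "((\<lambda>t::real. exp (- t)) \<longlongrightarrow> 0) at_top"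
        by (intro filterlim_compose[OF exp_at_bot] filterlim_uminus_at_bot_at_top)
      have c: "((\<lambda>t. 1 - cutoff t) \<longlongrightarrow> 0) at_top"
        unfolding cutoff_def by (rule tendsto_eq_intros z refl)+ simp
      have c': "(cutoff' \<longlongrightarrow> 0) at_top"
        unfolding cutoff'_def[abs_def] by (rule tendsto_eq_intros z refl)+ simp
      have o: "\<forall>\<^sub>F t in at_top. \<bar>osc s t\<bar> \<le> 1 / s"
        using eventually_ge_at_top[of 0] by eventually_elim (use osc_bounds s in auto)
      have eq1: "osc s t + s\<^sup>2 * late_weight s t = osc s t * (1 - cutoff t)" for t
        using s by (simp add: late_weight_def algebra_simps)
      have eq2: "cos (s * t) + s\<^sup>2 * late_weight' s t = cos (s * t) * (1 - cutoff t) - osc s t * cutoff' t" for t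
      proof -
        have "s\<^sup>2 * late_weight' s t = - (cos (s * t) * cutoff t + osc s t * cutoff' t)"
          using s unfolding late_weight'_def by simp
        then show ?thesis by (simp add: algebra_simps)
      qed
      have l1: "((\<lambda>t. osc s t + s\<^sup>2 * late_weight s t) \<longlongrightarrow> 0) at_top"
        unfolding eq1 by (rule tendsto_mult_bounded_zero[OF o c])
      have "((\<lambda>t. cos (s * t) + s\<^sup>2 * late_weight' s t) \<longlongrightarrow> 0 - 0) at_top"
        unfolding eq2 by (intro tendsto_diff tendsto_mult_bounded_zero[OF o c'] tendsto_mult_bounded_zero[of _ 1, OF _ c]) simp
      then have l2: "((\<lambda>t. cos (s * t) + s\<^sup>2 * late_weight' s t) \<longlongrightarrow> 0) at_top"
        by simp
      obtain B0 B1 where B: "\<And>t. \<bar>V 0 t\<bar> \<le> B0" "\<And>t. \<bar>V 1 t\<bar> \<le> B1"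
        using Vb by blast
      show "((\<lambda>t. V 1 t * (osc s t + s\<^sup>2 * late_weight s t)) \<longlongrightarrow> 0) at_top"
        by (rule tendsto_mult_bounded_zero[OF always_eventually l1]) (use B in blast)
      show "((\<lambda>t. V 0 t * (cos (s * t) + s\<^sup>2 * late_weight' s t)) \<longlongrightarrow> 0) at_top"
        by (rule tendsto_mult_bounded_zero[OF always_eventually l2]) (use B in blast)
    qed
    have t1: "((\<lambda>t. late_weight s t * V 3 t) \<longlongrightarrow> 0) at_top"
      by (rule tendsto_mult_bounded_zero[where B="1 / s ^ 3"])
         (use late_weight_bounds(2)[OF s] Vinf[of 1] in \<open>auto simp: numeral_3_eq_3 intro: eventually_at_top_linorderI[of 0]\<close>)
    have t2: "((\<lambda>t. late_weight' s t * V 2 t) \<longlongrightarrow> 0) at_top"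
      by (rule tendsto_mult_bounded_zero[where B="(1 + 2 / s) / s\<^sup>2"])
         (use late_weight'_bounded[OF s] Vinf[of 0] in \<open>auto simp: numeral_2_eq_2 intro: eventually_at_top_linorderI[of 0]\<close>)
    have "(F \<longlongrightarrow> 0 - 0 + 0 - 0) at_top"
      unfolding F_def[abs_def] using t0 t1 t2 by (intro tendsto_add tendsto_diff) (simp_all add: mult.commute)
    then show "((F \<circ> real_of_ereal) \<longlongrightarrow> 0) (at_left \<infinity>)"
      by (simp add: ereal_tendsto_simps)
  qed simp
  then show "(LINT t:{0<..}|lborel. G t) = w 0"
    by (simp add: interval_lebesgue_integral_0_infty)
qed

section \<open>Convolution with a transported kernel\<close>

text \<open>
  Convolution of \<open>f\<close> with the image under \<open>\<Phi>\<close> of the signed measure with density \<open>\<kappa>\<close>.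
\<close>

definition transport :: "'b measure \<Rightarrow> ('b \<Rightarrow> 'a) \<Rightarrow> ('b \<Rightarrow> real) \<Rightarrow> ('a::euclidean_space \<Rightarrow> real) \<Rightarrow> 'a \<Rightarrow> real" where
  "transport M \<Phi> \<kappa> f x = (\<integral>\<omega>. \<kappa> \<omega> * f (x - \<Phi> \<omega>) \<partial>M)"

text \<open>
  Hoelder's inequality for the measure with density \<open>\<bar>\<kappa>\<bar>\<close>.  Young's inequality is the tangent
  bound for the \<open>p\<close>-th power at a point \<open>c\<close>; integrating it with \<open>c\<close> equal to the mean of \<open>a\<close> gives the claim.
\<close>

lemma jensen_powr:
  fixes \<kappa> a :: "'b \<Rightarrow> real"
  assumes p: "1 < p" and \<kappa>: "integrable M \<kappa>" and a: "\<And>\<omega>. 0 \<le> a \<omega>"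
    and a_meas: "a \<in> borel_measurable M" and J: "integrable M (\<lambda>\<omega>. \<bar>\<kappa> \<omega>\<bar> * a \<omega> powr p)"
  shows "(\<integral>\<omega>. \<bar>\<kappa> \<omega>\<bar> * a \<omega> \<partial>M) powr p
    \<le> (\<integral>\<omega>. \<bar>\<kappa> \<omega>\<bar> \<partial>M) powr (p - 1) * (\<integral>\<omega>. \<bar>\<kappa> \<omega>\<bar> * a \<omega> powr p \<partial>M)"
proof -
  define I where "I = (\<integral>\<omega>. \<bar>\<kappa> \<omega>\<bar> * a \<omega> \<partial>M)"
  define J where "J = (\<integral>\<omega>. \<bar>\<kappa> \<omega>\<bar> * a \<omega> powr p \<partial>M)"
  define N where "N = (\<integral>\<omega>. \<bar>\<kappa> \<omega>\<bar> \<partial>M)"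
  have "I \<ge> 0" "J \<ge> 0" "N \<ge> 0"
    unfolding I_def J_def N_def by (auto intro!: integral_nonneg_AE simp: a)
  have young: "x \<le> c powr (1 - p) * x powr p / p + (1 - 1 / p) * c" if "0 \<le> x" "0 < c" for x c
  proof (cases "x = 0")
    case True
    then show ?thesis using p that by simp
  next
    case False
    then have x: "x > 0" using that by simp
    have "((x / c) powr p) powr (1 / p) * 1 powr (1 - 1 / p) \<le> (1 / p) * (x / c) powr p + (1 - 1 / p) * 1"
      using p x that by (intro Youngs_inequality_0) auto
    then have "x / c \<le> (x / c) powr p / p + (1 - 1 / p)"
      using p x that by (simp add: powr_powr)
    then have "x \<le> c * ((x / c) powr p / p + (1 - 1 / p))"
      using that by (simp add: divide_le_eq mult.commute)
    also have "\<dots> = c * (x / c) powr p / p + (1 - 1 / p) * c"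
      by (simp add: algebra_simps)
    also have "c * (x / c) powr p = c powr (1 - p) * x powr p"
      using x that by (simp add: powr_divide powr_diff)
    finally show ?thesis .
  qed
  show ?thesis
  proof (cases "I = 0 \<or> N = 0")
    case True
    then have "I = 0"
    proof
      assume "N = 0"
      then have "AE \<omega> in M. \<bar>\<kappa> \<omega>\<bar> = 0"
        using integral_nonneg_eq_0_iff_AE[of M "\<lambda>\<omega>. \<bar>\<kappa> \<omega>\<bar>"] \<kappa> by (simp add: N_def)
      then have "AE \<omega> in M. \<bar>\<kappa> \<omega>\<bar> * a \<omega> = 0" by eventually_elim simp
      then show "I = 0" unfolding I_def by (rule integral_eq_zero_AE)
    qed
    then show ?thesis
      using \<open>J \<ge> 0\<close> by (simp add: I_def[symmetric] J_def[symmetric])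
  next
    case False
    then have I: "I > 0" and N: "N > 0" using \<open>I \<ge> 0\<close> \<open>N \<ge> 0\<close> by auto
    \<comment> \<open>The mean value of \<open>a\<close> is the point of tangency at which Young's inequality is sharp.\<close>
    define c where "c = I / N"
    have c: "c > 0" using I N by (simp add: c_def)
    have b: "integrable M (\<lambda>\<omega>. c powr (1 - p) / p * (\<bar>\<kappa> \<omega>\<bar> * a \<omega> powr p) + (1 - 1 / p) * c * \<bar>\<kappa> \<omega>\<bar>)"
      using \<kappa> J by (intro Bochner_Integration.integrable_add integrable_mult_right integrable_abs)
    have le: "\<bar>\<kappa> \<omega>\<bar> * a \<omega> \<le> c powr (1 - p) / p * (\<bar>\<kappa> \<omega>\<bar> * a \<omega> powr p) + (1 - 1 / p) * c * \<bar>\<kappa> \<omega>\<bar>" for \<omega>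
      using mult_left_mono[OF young[OF a c], of "\<bar>\<kappa> \<omega>\<bar>" \<omega>] by (simp add: algebra_simps)
    have "integrable M (\<lambda>\<omega>. \<bar>\<kappa> \<omega>\<bar> * a \<omega>)"
      by (rule Bochner_Integration.integrable_bound[OF b])
         (use \<kappa> a_meas a le in \<open>auto intro!: AE_I2 order_trans[OF _ abs_ge_self] simp: abs_mult\<close>)
    then have "I \<le> (\<integral>\<omega>. c powr (1 - p) / p * (\<bar>\<kappa> \<omega>\<bar> * a \<omega> powr p) + (1 - 1 / p) * c * \<bar>\<kappa> \<omega>\<bar> \<partial>M)"
      unfolding I_def by (rule integral_mono[OF _ b le])
    also have "\<dots> = c powr (1 - p) / p * J + (1 - 1 / p) * c * N"
      unfolding J_def N_def using \<kappa> J
      by (subst Bochner_Integration.integral_add) (auto intro!: integrable_mult_right integrable_abs)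
    also have "\<dots> = c powr (1 - p) * J / p + (1 - 1 / p) * I"
      using N by (simp add: c_def)
    finally have "I / p \<le> c powr (1 - p) * J / p"
      by (simp add: algebra_simps)
    then have "I \<le> c powr (1 - p) * J"
      using p by (simp add: divide_le_cancel)
    then have "I * c powr (p - 1) \<le> c powr (1 - p) * J * c powr (p - 1)"
      by (intro mult_right_mono) auto
    also have "\<dots> = J * c powr ((1 - p) + (p - 1))"
      by (simp only: powr_add mult_ac)
    finally have "I * c powr (p - 1) \<le> J"
      using c by simp
    then have "I * I powr (p - 1) / N powr (p - 1) \<le> J"
      using I N by (simp add: c_def powr_divide)
    then have "I powr 1 * I powr (p - 1) \<le> N powr (p - 1) * J"
      using I N by (simp add: divide_le_eq mult.commute)
    then have "I powr (1 + (p - 1)) \<le> N powr (p - 1) * J"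
      by (simp only: powr_add)
    then show ?thesis
      by (simp add: I_def[symmetric] J_def[symmetric] N_def[symmetric])
  qed
qed

text \<open>
  Makes the product of an $L^p$ function with a test function integrable: the summand \<open>1\<close> is paired with
  the integrability of the test function and the power with its boundedness.
\<close>

lemma abs_le_one_plus_powr:
  fixes x :: real
  assumes "1 \<le> p"
  shows "\<bar>x\<bar> \<le> 1 + \<bar>x\<bar> powr p"
proof (cases "\<bar>x\<bar> \<le> 1")
  case False
  then have "\<bar>x\<bar> powr 1 \<le> \<bar>x\<bar> powr p" using assms by (intro powr_mono) auto
  then show ?thesis using False by simp
qed (simp add: add_increasing2)

locale transported_kernel = sigma_finite_measure M for M :: "'b measure" +
  fixes \<Phi> :: "'b \<Rightarrow> 'a::euclidean_space" and \<kappa> :: "'b \<Rightarrow> real"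
  assumes \<Phi>_measurable [measurable]: "\<Phi> \<in> borel_measurable M"
    and kernel_integrable: "integrable M \<kappa>"
begin

sublocale pair_sigma_finite M "lborel :: 'a measure" ..

lemma kernel_measurable [measurable]: "\<kappa> \<in> borel_measurable M"
  using kernel_integrable by (rule borel_measurable_integrable)

lemma integrable_kernel_shift:
  fixes a :: "'a \<Rightarrow> real"
  assumes a: "integrable lborel a" and \<Psi>[measurable]: "\<Psi> \<in> borel_measurable M"
  shows "integrable (M \<Otimes>\<^sub>M lborel) (\<lambda>(\<omega>, x). \<kappa> \<omega> * a (\<Psi> \<omega> + x))"
proof (rule Fubini_integrable)
  have [measurable]: "a \<in> borel_measurable borel"
    using borel_measurable_integrable[OF a] by simp
  show "(\<lambda>(\<omega>, x). \<kappa> \<omega> * a (\<Psi> \<omega> + x)) \<in> borel_measurable (M \<Otimes>\<^sub>M lborel)"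
    by measurable
  have "(\<integral>x. norm (\<kappa> \<omega> * a (\<Psi> \<omega> + x)) \<partial>lborel) = \<bar>\<kappa> \<omega>\<bar> * (\<integral>x. \<bar>a x\<bar> \<partial>lborel)" for \<omega>
    using integral_translate[of "\<lambda>x. \<bar>a x\<bar>" "\<Psi> \<omega>"] by (simp add: abs_mult)
  then show "integrable M (\<lambda>\<omega>. \<integral>x. norm (case (\<omega>, x) of (\<omega>, x) \<Rightarrow> \<kappa> \<omega> * a (\<Psi> \<omega> + x)) \<partial>lborel)"
    using kernel_integrable by simp
  show "AE \<omega> in M. integrable lborel (\<lambda>x. case (\<omega>, x) of (\<omega>, x) \<Rightarrow> \<kappa> \<omega> * a (\<Psi> \<omega> + x))"
    using a integrable_translate[of a] by auto
qed

text \<open>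
  The two shifts are \<open>- \<Phi>\<close> and \<open>0\<close> when \<open>transport\<close> is paired with \<open>\<phi>\<close>, and \<open>0\<close> and \<open>\<Phi>\<close> after the
  translation of the space variable.
\<close>

lemma integrable_kernel_pair:
  fixes f \<phi> :: "'a \<Rightarrow> real"
  assumes p: "1 \<le> p" and [measurable]: "f \<in> borel_measurable borel" and f: "integrable lborel (\<lambda>x. \<bar>f x\<bar> powr p)"
    and \<phi>: "integrable lborel \<phi>" "\<And>x. \<bar>\<phi> x\<bar> \<le> B"
    and [measurable]: "\<Psi> \<in> borel_measurable M" "\<Psi>' \<in> borel_measurable M"
  shows "integrable (M \<Otimes>\<^sub>M lborel) (\<lambda>(\<omega>, x). \<kappa> \<omega> * (f (\<Psi> \<omega> + x) * \<phi> (\<Psi>' \<omega> + x)))"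
proof (rule Bochner_Integration.integrable_bound)
  have [measurable]: "\<phi> \<in> borel_measurable borel"
    using borel_measurable_integrable[OF \<phi>(1)] by simp
  show "integrable (M \<Otimes>\<^sub>M lborel) (\<lambda>z. \<bar>case z of (\<omega>, x) \<Rightarrow> \<kappa> \<omega> * \<phi> (\<Psi>' \<omega> + x)\<bar>
      + B * \<bar>case z of (\<omega>, x) \<Rightarrow> \<kappa> \<omega> * \<bar>f (\<Psi> \<omega> + x)\<bar> powr p\<bar>)"
    by (intro Bochner_Integration.integrable_add integrable_mult_right integrable_abs
        integrable_kernel_shift[OF \<phi>(1)] integrable_kernel_shift[OF f]) measurable
  show "(\<lambda>(\<omega>, x). \<kappa> \<omega> * (f (\<Psi> \<omega> + x) * \<phi> (\<Psi>' \<omega> + x))) \<in> borel_measurable (M \<Otimes>\<^sub>M lborel)"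
    by measurable
  have "\<bar>\<kappa> \<omega> * (f (\<Psi> \<omega> + x) * \<phi> (\<Psi>' \<omega> + x))\<bar> \<le> \<bar>\<kappa> \<omega> * \<phi> (\<Psi>' \<omega> + x)\<bar> + B * \<bar>\<kappa> \<omega> * \<bar>f (\<Psi> \<omega> + x)\<bar> powr p\<bar>" for \<omega> x
  proof -
    have "\<bar>f (\<Psi> \<omega> + x)\<bar> * \<bar>\<phi> (\<Psi>' \<omega> + x)\<bar> \<le> (1 + \<bar>f (\<Psi> \<omega> + x)\<bar> powr p) * \<bar>\<phi> (\<Psi>' \<omega> + x)\<bar>"
      by (intro mult_right_mono abs_le_one_plus_powr p) auto
    also have "\<dots> \<le> \<bar>\<phi> (\<Psi>' \<omega> + x)\<bar> + B * \<bar>f (\<Psi> \<omega> + x)\<bar> powr p"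
      using mult_left_mono[OF \<phi>(2)[of "\<Psi>' \<omega> + x"], of "\<bar>f (\<Psi> \<omega> + x)\<bar> powr p"] by (simp add: algebra_simps)
    finally have "\<bar>\<kappa> \<omega>\<bar> * (\<bar>f (\<Psi> \<omega> + x)\<bar> * \<bar>\<phi> (\<Psi>' \<omega> + x)\<bar>)
        \<le> \<bar>\<kappa> \<omega>\<bar> * (\<bar>\<phi> (\<Psi>' \<omega> + x)\<bar> + B * \<bar>f (\<Psi> \<omega> + x)\<bar> powr p)"
      by (rule mult_left_mono) simp
    then show ?thesis by (simp add: abs_mult algebra_simps)
  qed
  then show "AE z in M \<Otimes>\<^sub>M lborel. norm (case z of (\<omega>, x) \<Rightarrow> \<kappa> \<omega> * (f (\<Psi> \<omega> + x) * \<phi> (\<Psi>' \<omega> + x)))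
      \<le> norm (\<bar>case z of (\<omega>, x) \<Rightarrow> \<kappa> \<omega> * \<phi> (\<Psi>' \<omega> + x)\<bar>
      + B * \<bar>case z of (\<omega>, x) \<Rightarrow> \<kappa> \<omega> * \<bar>f (\<Psi> \<omega> + x)\<bar> powr p\<bar>)"
    by (intro AE_I2) (auto simp: split_beta intro: order_trans[OF _ abs_ge_self])
qed

lemma transport_measurable [measurable]:
  assumes [measurable]: "f \<in> borel_measurable borel"
  shows "transport M \<Phi> \<kappa> f \<in> borel_measurable borel"
  unfolding transport_def[abs_def] by measurable

text \<open>
  Young's convolution inequality, obtained from Jensen's inequality at almost every point and Fubini's
  theorem for the \<open>p\<close>-th power of \<open>f\<close>.
\<close>

lemma transport_powr_integrable:
  assumes p: "1 < p" and f_meas[measurable]: "f \<in> borel_measurable borel" and f: "integrable lborel (\<lambda>x. \<bar>f x\<bar> powr p)"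
  shows "integrable lborel (\<lambda>x. \<bar>transport M \<Phi> \<kappa> f x\<bar> powr p)"
proof -
  interpret sw: pair_sigma_finite "lborel :: 'a measure" M ..
  have "integrable (M \<Otimes>\<^sub>M lborel) (\<lambda>(\<omega>, x). \<kappa> \<omega> * \<bar>f (- \<Phi> \<omega> + x)\<bar> powr p)"
    using f by (intro integrable_kernel_shift) auto
  from integrable_abs[OF integrable_product_swap[OF this]]
  have i: "integrable (lborel \<Otimes>\<^sub>M M) (\<lambda>(x, \<omega>). \<bar>\<kappa> \<omega>\<bar> * \<bar>f (x - \<Phi> \<omega>)\<bar> powr p)"
    by (simp add: case_prod_unfold abs_mult)
  let ?J = "\<lambda>x. \<integral>\<omega>. \<bar>\<kappa> \<omega>\<bar> * \<bar>f (x - \<Phi> \<omega>)\<bar> powr p \<partial>M"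
  let ?N = "(\<integral>\<omega>. \<bar>\<kappa> \<omega>\<bar> \<partial>M) powr (p - 1)"
  have J: "integrable lborel ?J"
    using sw.integrable_fst'[OF i] by simp
  have ae: "AE x in lborel. integrable M (\<lambda>\<omega>. \<bar>\<kappa> \<omega>\<bar> * \<bar>f (x - \<Phi> \<omega>)\<bar> powr p)"
    using sw.AE_integrable_fst'[OF i] by simp
  show ?thesis
  proof (rule Bochner_Integration.integrable_bound[OF integrable_mult_right[OF J, of ?N]])
    show "(\<lambda>x. \<bar>transport M \<Phi> \<kappa> f x\<bar> powr p) \<in> borel_measurable lborel"
      by measurable
    show "AE x in lborel. norm (\<bar>transport M \<Phi> \<kappa> f x\<bar> powr p) \<le> norm (?N * ?J x)"
      using ae
    proof eventually_elim
      case (elim x)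
      have "\<bar>transport M \<Phi> \<kappa> f x\<bar> \<le> (\<integral>\<omega>. \<bar>\<kappa> \<omega>\<bar> * \<bar>f (x - \<Phi> \<omega>)\<bar> \<partial>M)"
        using integral_abs_bound[of M "\<lambda>\<omega>. \<kappa> \<omega> * f (x - \<Phi> \<omega>)"] by (simp add: transport_def abs_mult)
      then have "\<bar>transport M \<Phi> \<kappa> f x\<bar> powr p \<le> (\<integral>\<omega>. \<bar>\<kappa> \<omega>\<bar> * \<bar>f (x - \<Phi> \<omega>)\<bar> \<partial>M) powr p"
        using p by (intro powr_mono2) auto
      also have "\<dots> \<le> ?N * ?J x"
        by (rule jensen_powr) (use p kernel_integrable elim in auto)
      finally show ?case by (auto intro: order_trans[OF _ abs_ge_self])
    qed
  qed
qed

lemma transport_duality: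
  assumes "1 \<le> p" and [measurable]: "f \<in> borel_measurable borel" and "integrable lborel (\<lambda>x. \<bar>f x\<bar> powr p)"
    and \<phi>: "integrable lborel \<phi>" "\<And>x. \<bar>\<phi> x\<bar> \<le> B"
  shows "(\<integral>x. transport M \<Phi> \<kappa> f x * \<phi> x \<partial>lborel) = (\<integral>\<omega>. \<kappa> \<omega> * (\<integral>y. f y * \<phi> (\<Phi> \<omega> + y) \<partial>lborel) \<partial>M)"
proof -
  have [measurable]: "\<phi> \<in> borel_measurable borel"
    using borel_measurable_integrable[OF \<phi>(1)] by simp
  have i: "integrable (M \<Otimes>\<^sub>M lborel) (\<lambda>(\<omega>, x). \<kappa> \<omega> * (f (x - \<Phi> \<omega>) * \<phi> x))"
    using integrable_kernel_pair[OF assms, of "\<lambda>\<omega>. - \<Phi> \<omega>" "\<lambda>\<omega>. 0"] by simp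
  have "(\<integral>x. transport M \<Phi> \<kappa> f x * \<phi> x \<partial>lborel) = (\<integral>x. \<integral>\<omega>. \<kappa> \<omega> * (f (x - \<Phi> \<omega>) * \<phi> x) \<partial>M \<partial>lborel)"
    unfolding transport_def integral_mult_left_zero[symmetric] by (simp only: mult.assoc)
  also have "\<dots> = (\<integral>\<omega>. \<integral>x. \<kappa> \<omega> * (f (x - \<Phi> \<omega>) * \<phi> x) \<partial>lborel \<partial>M)"
    by (rule Fubini_integral[OF i])
  also have "\<dots> = (\<integral>\<omega>. \<kappa> \<omega> * (\<integral>y. f y * \<phi> (\<Phi> \<omega> + y) \<partial>lborel) \<partial>M)"
  proof -
    have "(\<integral>x. f (x - \<Phi> \<omega>) * \<phi> x \<partial>lborel) = (\<integral>y. f y * \<phi> (\<Phi> \<omega> + y) \<partial>lborel)" for \<omega>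
      using integral_translate[of "\<lambda>x. f (x - \<Phi> \<omega>) * \<phi> x" "\<Phi> \<omega>"] by simp
    then show ?thesis by simp
  qed
  finally show ?thesis .
qed

lemma kernel_pairing_swap:
  assumes "1 \<le> p" and "f \<in> borel_measurable borel" and "integrable lborel (\<lambda>x. \<bar>f x\<bar> powr p)"
    and "integrable lborel \<phi>" "\<And>x. \<bar>\<phi> x\<bar> \<le> B"
  shows "(\<integral>\<omega>. \<kappa> \<omega> * (\<integral>y. f y * \<phi> (\<Phi> \<omega> + y) \<partial>lborel) \<partial>M) = (\<integral>y. f y * (\<integral>\<omega>. \<kappa> \<omega> * \<phi> (\<Phi> \<omega> + y) \<partial>M) \<partial>lborel)"
proof -
  have i: "integrable (M \<Otimes>\<^sub>M lborel) (\<lambda>(\<omega>, y). \<kappa> \<omega> * (f y * \<phi> (\<Phi> \<omega> + y)))"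
    using integrable_kernel_pair[OF assms, of "\<lambda>\<omega>. 0" \<Phi>] by simp
  have "(\<integral>y. f y * (\<integral>\<omega>. \<kappa> \<omega> * \<phi> (\<Phi> \<omega> + y) \<partial>M) \<partial>lborel)
      = (\<integral>y. \<integral>\<omega>. \<kappa> \<omega> * (f y * \<phi> (\<Phi> \<omega> + y)) \<partial>M \<partial>lborel)"
    unfolding integral_mult_right_zero[symmetric] by (simp only: mult.left_commute)
  also have "\<dots> = (\<integral>\<omega>. \<integral>y. \<kappa> \<omega> * (f y * \<phi> (\<Phi> \<omega> + y)) \<partial>lborel \<partial>M)"
    by (rule Fubini_integral[OF i])
  finally show ?thesis by simp
qed

end

section \<open>The fundamental solution as a transported kernel\<close>

lemma (in pair_sigma_finite) integrable_product:
  fixes f g :: "_ \<Rightarrow> real"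
  assumes f: "integrable M1 f" and g: "integrable M2 g"
  shows "integrable (M1 \<Otimes>\<^sub>M M2) (\<lambda>(x, y). f x * g y)"
proof (rule Fubini_integrable)
  have [measurable]: "f \<in> borel_measurable M1" "g \<in> borel_measurable M2"
    using f g by auto
  show "(\<lambda>(x, y). f x * g y) \<in> borel_measurable (M1 \<Otimes>\<^sub>M M2)" by measurable
qed (use f g in \<open>auto simp: abs_mult\<close>)

definition parabolic :: "real \<times> (real ^ 'n::finite) \<Rightarrow> real ^ 'n" where
  "parabolic = (\<lambda>(t, y). sqrt t *\<^sub>R y)"

text \<open>
  For \<open>is = []\<close> this is the density of the fundamental solution.  Since \<open>\<partial>\<^sub>t\<^sup>2 h\<^sub>t = \<Delta>\<^sup>2 h\<^sub>t\<close>, the second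
  time derivative of the heat kernel becomes the bilaplacian of \<open>gauss\<close> divided by \<open>t\<^sup>2\<close> after parabolic
  scaling.  For general \<open>is\<close> it is the density of the corresponding derivative, each derivative
  costing one factor \<open>1 / sqrt t\<close>; the list is reversed because of \<open>iterated_integration_by_parts\<close>.
\<close>

definition green_kernel :: "real \<Rightarrow> 'n::finite list \<Rightarrow> real \<times> (real ^ 'n) \<Rightarrow> real" where
  "green_kernel s is = (\<lambda>(t, y). if t > 0 then (1 / sqrt t) ^ length is *
     (early_weight s t * iter_partial (rev is) gauss y
      + late_weight s t / t\<^sup>2 * iter_partial (rev is) (laplacian (laplacian gauss)) y) else 0)"

lemma parabolic_measurable [measurable]: "parabolic \<in> borel_measurable borel"
proof -
  have "parabolic \<in> borel_measurable (borel \<Otimes>\<^sub>M borel)"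
    unfolding parabolic_def by measurable
  then show ?thesis by (simp add: borel_prod)
qed

lemma gaussian_polys_measurable: "k \<in> gaussian_polys \<Longrightarrow> k \<in> borel_measurable borel"
  by (intro smooth_borel gaussian_polys_smooth)

context
  fixes s :: real
  assumes s: "s > 0"
begin

lemma green_kernel_integrable:
  fixes "is" :: "'n::finite list"
  assumes len: "length is \<le> 2"
  shows "integrable lborel (green_kernel s is)"
proof -
  obtain K1 where K1: "\<And>t. t > 0 \<Longrightarrow> \<bar>early_weight s t\<bar> * (1 + 1 / t) \<le> K1 / (1 + t\<^sup>2)"
    using early_weight_decay[OF s] by blast
  obtain K2 where K2: "\<And>t. t > 0 \<Longrightarrow> \<bar>late_weight s t\<bar> / t\<^sup>2 * (1 + 1 / t) \<le> K2 / (1 + t\<^sup>2)"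
    using late_weight_decay[OF s] by blast
  define k :: "real ^ 'n \<Rightarrow> real" where "k = iter_partial (rev is) gauss"
  define l :: "real ^ 'n \<Rightarrow> real" where "l = iter_partial (rev is) (laplacian (laplacian gauss))"
  have kl: "k \<in> gaussian_polys" "l \<in> gaussian_polys"
    unfolding k_def l_def
    by (intro gaussian_polys_iter_partial gaussian_polys_laplacian gauss_gaussian_poly)+
  have [measurable]: "k \<in> borel_measurable borel" "l \<in> borel_measurable borel"
    using kl by (auto intro: gaussian_polys_measurable)
  have dom: "integrable (lborel \<Otimes>\<^sub>M lborel) (\<lambda>z. (case z of (t, y) \<Rightarrow> K1 / (1 + t\<^sup>2) * \<bar>k y\<bar>)
      + (case z of (t, y) \<Rightarrow> K2 / (1 + t\<^sup>2) * \<bar>l y\<bar>))"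
    by (intro Bochner_Integration.integrable_add lborel_pair.integrable_product integrable_abs
        integrable_Cauchy_density gaussian_polys_integrable kl)
  have "integrable (lborel \<Otimes>\<^sub>M lborel) (green_kernel s is)"
  proof (rule Bochner_Integration.integrable_bound[OF dom])
    show "green_kernel s is \<in> borel_measurable (lborel \<Otimes>\<^sub>M lborel)"
      unfolding green_kernel_def k_def[symmetric] l_def[symmetric] by measurable
    have "\<bar>green_kernel s is (t, y)\<bar> \<le> K1 / (1 + t\<^sup>2) * \<bar>k y\<bar> + K2 / (1 + t\<^sup>2) * \<bar>l y\<bar>" for t y
    proof (cases "t > 0")
      case True
      have pow: "\<bar>(1 / sqrt t) ^ length is\<bar> \<le> 1 + 1 / t"
      proof -
        have "length is = 0 \<or> length is = 1 \<or> length is = 2" using len by linarith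
        moreover have "1 / sqrt t \<le> 1 + 1 / t"
        proof -
          have "2 * (1 / sqrt t) * 1 \<le> (1 / sqrt t)\<^sup>2 + 1\<^sup>2" by (rule sum_squares_bound)
          then have "2 * (1 / sqrt t) \<le> 1 / t + 1" using True by (simp add: power_divide)
          moreover have "0 \<le> 1 / sqrt t" using True by simp
          ultimately show ?thesis by linarith
        qed
        ultimately show ?thesis using True by (auto simp: power_divide)
      qed
      have "\<bar>green_kernel s is (t, y)\<bar> = \<bar>(1 / sqrt t) ^ length is\<bar>
          * \<bar>early_weight s t * k y + late_weight s t / t\<^sup>2 * l y\<bar>"
        using True by (simp only: green_kernel_def k_def l_def prod.case if_True abs_mult)
      also have "\<dots> \<le> (1 + 1 / t) * (\<bar>early_weight s t\<bar> * \<bar>k y\<bar> + \<bar>late_weight s t\<bar> / t\<^sup>2 * \<bar>l y\<bar>)"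
        by (intro mult_mono pow order_trans[OF abs_triangle_ineq])
           (use True in \<open>auto simp: abs_mult\<close>)
      also have "\<dots> = (\<bar>early_weight s t\<bar> * (1 + 1 / t)) * \<bar>k y\<bar> + (\<bar>late_weight s t\<bar> / t\<^sup>2 * (1 + 1 / t)) * \<bar>l y\<bar>"
        by (simp only: distrib_left mult_ac)
      also have "\<dots> \<le> K1 / (1 + t\<^sup>2) * \<bar>k y\<bar> + K2 / (1 + t\<^sup>2) * \<bar>l y\<bar>"
        by (intro add_mono mult_right_mono K1 K2 True) auto
      finally show ?thesis .
    next
      case False
      have "0 \<le> K1" "0 \<le> K2"
        using order_trans[of 0, OF _ K1[of 1]] order_trans[of 0, OF _ K2[of 1]] by simp_all
      then show ?thesis using False by (simp add: green_kernel_def)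
    qed
    then show "AE z in lborel \<Otimes>\<^sub>M lborel. norm (green_kernel s is z)
        \<le> norm ((case z of (t, y) \<Rightarrow> K1 / (1 + t\<^sup>2) * \<bar>k y\<bar>) + (case z of (t, y) \<Rightarrow> K2 / (1 + t\<^sup>2) * \<bar>l y\<bar>))"
      by (intro AE_I2) (auto simp: split_beta intro: order_trans[OF _ abs_ge_self])
  qed
  then show ?thesis by (simp add: lborel_prod)
qed

lemma green_kernel_transported:
  "length is \<le> 2 \<Longrightarrow> transported_kernel lborel parabolic (green_kernel s is)"
  by (intro transported_kernel.intro transported_kernel_axioms.intro green_kernel_integrable
      sigma_finite_lborel) auto

lemma green_kernel_pairing:
  fixes w :: "real ^ 'n::finite \<Rightarrow> real"
  assumes len: "length is \<le> 2" and w: "w \<in> test_functions"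
  shows "(\<integral>\<omega>. green_kernel s is \<omega> * w (parabolic \<omega>) \<partial>lborel)
    = (\<integral>t. \<integral>y. green_kernel s is (t, y) * w (sqrt t *\<^sub>R y) \<partial>lborel \<partial>lborel)"
proof -
  obtain B where B: "\<And>x. \<bar>w x\<bar> \<le> B" using test_bounded[OF w] by blast
  have [measurable]: "w \<in> borel_measurable borel" by (rule test_borel[OF w])
  have "integrable lborel (\<lambda>\<omega>. green_kernel s is \<omega> * w (parabolic \<omega>))"
    by (rule integrable_mult_bounded[OF green_kernel_integrable[OF len] _ B]) measurable
  then have "integrable (lborel \<Otimes>\<^sub>M lborel) (\<lambda>\<omega>. green_kernel s is \<omega> * w (parabolic \<omega>))"
    by (simp add: lborel_prod)
  from lborel_pair.integral_fst'[OF this] show ?thesis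
    by (simp add: lborel_prod parabolic_def)
qed

lemma green_kernel_slice:
  fixes w :: "real ^ 'n::finite \<Rightarrow> real"
  assumes w: "w \<in> test_functions" and t: "t > 0"
  shows "(\<integral>y. green_kernel s is (t, y) * w (sqrt t *\<^sub>R y) \<partial>lborel)
    = (1 / sqrt t) ^ length is * (early_weight s t * (\<integral>y. iter_partial (rev is) gauss y * w (sqrt t *\<^sub>R y) \<partial>lborel)
      + late_weight s t / t\<^sup>2 * (\<integral>y. iter_partial (rev is) (laplacian (laplacian gauss)) y * w (sqrt t *\<^sub>R y) \<partial>lborel))"
proof -
  define k :: "real ^ 'n \<Rightarrow> real" where "k = iter_partial (rev is) gauss"
  define l :: "real ^ 'n \<Rightarrow> real" where "l = iter_partial (rev is) (laplacian (laplacian gauss))"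
  have kl: "k \<in> gaussian_polys" "l \<in> gaussian_polys"
    unfolding k_def l_def
    by (intro gaussian_polys_iter_partial gaussian_polys_laplacian gauss_gaussian_poly)+
  have i: "integrable lborel (\<lambda>y. k y * w (sqrt t *\<^sub>R y))" "integrable lborel (\<lambda>y. l y * w (sqrt t *\<^sub>R y))"
    by (intro integrable_gaussian_poly_test kl w)+
  have "(\<integral>y. green_kernel s is (t, y) * w (sqrt t *\<^sub>R y) \<partial>lborel)
      = (\<integral>y. (1 / sqrt t) ^ length is * (early_weight s t * (k y * w (sqrt t *\<^sub>R y))
        + late_weight s t / t\<^sup>2 * (l y * w (sqrt t *\<^sub>R y))) \<partial>lborel)"
    using t by (simp only: green_kernel_def k_def l_def prod.case if_True distrib_right mult.assoc)
  also have "\<dots> = (1 / sqrt t) ^ length is * (early_weight s t * (\<integral>y. k y * w (sqrt t *\<^sub>R y) \<partial>lborel)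
      + late_weight s t / t\<^sup>2 * (\<integral>y. l y * w (sqrt t *\<^sub>R y) \<partial>lborel))"
    by (simp only: integral_mult_right_zero Bochner_Integration.integral_add[OF
          integrable_mult_right[OF i(1)] integrable_mult_right[OF i(2)]])
  finally show ?thesis unfolding k_def l_def .
qed

lemma green_kernel_iter_partial:
  fixes \<phi> :: "real ^ 'n::finite \<Rightarrow> real"
  assumes len: "length is \<le> 2" and \<phi>: "\<phi> \<in> test_functions"
  shows "(\<integral>\<omega>. green_kernel s [] \<omega> * iter_partial is \<phi> (parabolic \<omega>) \<partial>lborel)
    = (-1) ^ length is * (\<integral>\<omega>. green_kernel s is \<omega> * \<phi> (parabolic \<omega>) \<partial>lborel)"
proof -
  have "(\<integral>y. green_kernel s [] (t, y) * iter_partial is \<phi> (sqrt t *\<^sub>R y) \<partial>lborel)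
      = (-1) ^ length is * (\<integral>y. green_kernel s is (t, y) * \<phi> (sqrt t *\<^sub>R y) \<partial>lborel)" for t
  proof (cases "t > 0")
    case True
    have ibp: "(\<integral>y. k y * iter_partial is \<phi> (sqrt t *\<^sub>R y) \<partial>lborel)
        = (-1) ^ length is * (1 / sqrt t) ^ length is * (\<integral>y. iter_partial (rev is) k y * \<phi> (sqrt t *\<^sub>R y) \<partial>lborel)"
      if k: "k \<in> gaussian_polys" for k
    proof -
      have tst: "(\<lambda>y. \<phi> (sqrt t *\<^sub>R y)) \<in> test_functions"
        using test_affine[OF \<phi>, of "sqrt t" 0] True by simp
      have pd: "iter_partial is (\<lambda>y. \<phi> (sqrt t *\<^sub>R y)) = (\<lambda>y. sqrt t ^ length is * iter_partial is \<phi> (sqrt t *\<^sub>R y))"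
        using iter_partial_affine[OF test_smooth[OF \<phi>], of "is" 0 "sqrt t"] by simp
      have "sqrt t ^ length is * (\<integral>y. k y * iter_partial is \<phi> (sqrt t *\<^sub>R y) \<partial>lborel)
          = (\<integral>y. k y * iter_partial is (\<lambda>y. \<phi> (sqrt t *\<^sub>R y)) y \<partial>lborel)"
        unfolding pd integral_mult_right_zero[symmetric] by (simp only: mult.left_commute)
      also have "\<dots> = (-1) ^ length is * (\<integral>y. iter_partial (rev is) k y * \<phi> (sqrt t *\<^sub>R y) \<partial>lborel)"
        by (rule iterated_integration_by_parts[OF gaussian_polys_smooth[OF k] tst])
      finally show ?thesis
        using True by (simp add: power_divide field_simps)
    qed
    show ?thesis
      unfolding green_kernel_slice[OF \<phi> True] green_kernel_slice[OF test_iter_partial[OF \<phi>] True]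
      by (simp add: ibp gauss_gaussian_poly gaussian_polys_laplacian algebra_simps)
  next
    case False
    then show ?thesis by (simp add: green_kernel_def)
  qed
  then show ?thesis
    unfolding green_kernel_pairing[OF len \<phi>]
    by (subst green_kernel_pairing[OF _ test_iter_partial[OF \<phi>]]) simp_all
qed

text \<open>
  The slices in \<open>t\<close> are the integrand of \<open>weighted_heat_averages_integral\<close>.
\<close>

lemma green_kernel_fundamental:
  fixes w :: "real ^ 'n::finite \<Rightarrow> real"
  assumes w: "w \<in> test_functions"
    and L: "(\<lambda>x. laplacian (laplacian w) x + s\<^sup>2 * w x) \<in> test_functions"
  shows "(\<integral>\<omega>. green_kernel s [] \<omega> * (laplacian (laplacian w) (parabolic \<omega>) + s\<^sup>2 * w (parabolic \<omega>)) \<partial>lborel) = w 0"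
proof -
  let ?L = "\<lambda>x. laplacian (laplacian w) x + s\<^sup>2 * w x"
  let ?V = "\<lambda>j. heat_average ((laplacian ^^ j) w)"
  let ?G = "\<lambda>t. early_weight s t * (?V 2 t + s\<^sup>2 * ?V 0 t) + late_weight s t * (?V 4 t + s\<^sup>2 * ?V 2 t)"
  have w2: "laplacian (laplacian w) \<in> test_functions"
    by (intro test_laplacian w)
  have split: "(\<integral>y. k y * ?L (sqrt t *\<^sub>R y) \<partial>lborel)
      = (\<integral>y. k y * laplacian (laplacian w) (sqrt t *\<^sub>R y) \<partial>lborel) + s\<^sup>2 * (\<integral>y. k y * w (sqrt t *\<^sub>R y) \<partial>lborel)"
    if k: "k \<in> gaussian_polys" for k t
  proof -
    have "(\<integral>y. k y * ?L (sqrt t *\<^sub>R y) \<partial>lborel)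
        = (\<integral>y. k y * laplacian (laplacian w) (sqrt t *\<^sub>R y) + s\<^sup>2 * (k y * w (sqrt t *\<^sub>R y)) \<partial>lborel)"
      by (simp only: distrib_left mult.left_commute)
    also have "\<dots> = (\<integral>y. k y * laplacian (laplacian w) (sqrt t *\<^sub>R y) \<partial>lborel) + (\<integral>y. s\<^sup>2 * (k y * w (sqrt t *\<^sub>R y)) \<partial>lborel)"
      by (intro Bochner_Integration.integral_add integrable_mult_right integrable_gaussian_poly_test k w w2)
    finally show ?thesis by simp
  qed
  have "(\<integral>y. green_kernel s [] (t, y) * ?L (sqrt t *\<^sub>R y) \<partial>lborel) = indicator {0<..} t *\<^sub>R ?G t" for t
  proof (cases "t > 0")
    case True
    have 1: "(\<integral>y. laplacian (laplacian gauss) y * w (sqrt t *\<^sub>R y) \<partial>lborel) = t\<^sup>2 * ?V 2 t"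
      using heat_average_bilaplacian[OF w True] True by (simp add: numeral_2_eq_2)
    have 2: "(\<integral>y. laplacian (laplacian gauss) y * laplacian (laplacian w) (sqrt t *\<^sub>R y) \<partial>lborel) = t\<^sup>2 * ?V 4 t"
      using heat_average_bilaplacian[OF w2 True] True by (simp add: eval_nat_numeral)
    have 3: "(\<integral>y. gauss y * laplacian (laplacian w) (sqrt t *\<^sub>R y) \<partial>lborel) = ?V 2 t"
      "(\<integral>y. gauss y * w (sqrt t *\<^sub>R y) \<partial>lborel) = ?V 0 t"
      by (simp_all add: heat_average_def numeral_2_eq_2)
    have "(\<integral>y. green_kernel s [] (t, y) * ?L (sqrt t *\<^sub>R y) \<partial>lborel)
        = early_weight s t * (?V 2 t + s\<^sup>2 * ?V 0 t) + late_weight s t / t\<^sup>2 * (t\<^sup>2 * ?V 4 t + s\<^sup>2 * (t\<^sup>2 * ?V 2 t))"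
      unfolding green_kernel_slice[OF L True]
      by (simp only: list.size power_0 mult_1 rev.simps iter_partial.simps
          split[OF gauss_gaussian_poly] split[OF gaussian_polys_laplacian[OF gaussian_polys_laplacian[OF gauss_gaussian_poly]]] 1 2 3)
    also have "\<dots> = ?G t"
    proof -
      have "late_weight s t / t\<^sup>2 * (t\<^sup>2 * ?V 4 t + s\<^sup>2 * (t\<^sup>2 * ?V 2 t))
          = late_weight s t / t\<^sup>2 * (t\<^sup>2 * (?V 4 t + s\<^sup>2 * ?V 2 t))"
        by (simp only: distrib_left mult.left_commute)
      also have "\<dots> = late_weight s t * (?V 4 t + s\<^sup>2 * ?V 2 t)"
        using True by simp
      finally show ?thesis by simp
    qed
    finally show ?thesis using True by simp
  next
    case False
    then show ?thesis by (simp add: green_kernel_def)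
  qed
  then have "(\<integral>t. \<integral>y. green_kernel s [] (t, y) * ?L (sqrt t *\<^sub>R y) \<partial>lborel \<partial>lborel) = (LINT t:{0<..}|lborel. ?G t)"
    unfolding set_lebesgue_integral_def by presburger
  also have "\<dots> = w 0"
    by (rule weighted_heat_averages_integral(2)[OF w s])
  finally show ?thesis
    using green_kernel_pairing[OF _ L, of "[]"] by simp
qed

end

section \<open>Representatives, local integrability and the weak form\<close>

text \<open>
  Fubini's theorem is applied with Borel measurable representatives.
\<close>

lemma Lp_spaceD:
  assumes "f \<in> Lp_space p"
  obtains g where "g \<in> borel_measurable borel" and "AE x in lebesgue. f x = g x"
    and "integrable lborel (\<lambda>x. \<bar>g x\<bar> powr p)"
proof -
  obtain g where g: "g \<in> borel_measurable lborel" and ae: "AE x in lborel. f x = g x"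
    using completion_ex_borel_measurable_real[of f lborel] assms by (auto simp: Lp_space_def)
  have ae': "AE x in lebesgue. f x = g x"
    using AE_completion[OF ae] .
  have [measurable]: "g \<in> borel_measurable borel" using g by simp
  have fm: "f \<in> borel_measurable lebesgue" using assms by (simp add: Lp_space_def)
  have gm: "g \<in> borel_measurable lebesgue" using g by (rule measurable_completion)
  have "integrable lebesgue (\<lambda>x. \<bar>f x\<bar> powr p)"
    using assms by (simp add: Lp_space_def)
  then have "integrable lebesgue (\<lambda>x. \<bar>g x\<bar> powr p)"
    by (rule Bochner_Integration.integrable_cong_AE_imp) 
       (use ae' gm in \<open>auto elim!: eventually_mono\<close>)
  then have "integrable lborel (\<lambda>x. \<bar>g x\<bar> powr p)"
    by (subst (asm) integrable_completion) auto
  then show ?thesis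
    by (intro that[of g] ae') simp_all
qed

lemma Lp_spaceI:
  assumes "u \<in> borel_measurable borel" and "integrable lborel (\<lambda>x. \<bar>u x\<bar> powr p)"
  shows "u \<in> Lp_space p"
  using assms by (simp add: Lp_space_def measurable_completion integrable_completion)

lemma Lp_locally_integrable:
  fixes u :: "real ^ 'n::finite \<Rightarrow> real"
  assumes p: "1 \<le> p" and u: "u \<in> Lp_space p"
  shows "locally_integrable u"
  unfolding locally_integrable_def
proof (intro allI impI)
  fix K :: "(real ^ 'n) set" assume K: "compact K"
  have um: "u \<in> borel_measurable lebesgue" and ui: "integrable lebesgue (\<lambda>x. \<bar>u x\<bar> powr p)"
    using u by (auto simp: Lp_space_def)
  have KL: "K \<in> lmeasurable" using K by (rule lmeasurable_compact)
  have "integrable lebesgue (\<lambda>x. indicator K x *\<^sub>R u x)"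
  proof (rule Bochner_Integration.integrable_bound)
    show "integrable lebesgue (\<lambda>x. indicator K x + \<bar>u x\<bar> powr p)"
      using KL ui by (intro Bochner_Integration.integrable_add integrable_real_indicator) (auto simp: fmeasurable_def)
    show "(\<lambda>x. indicator K x *\<^sub>R u x) \<in> borel_measurable lebesgue"
      using KL um by (intro borel_measurable_scaleR borel_measurable_indicator) (auto simp: fmeasurable_def)
    show "AE x in lebesgue. norm (indicator K x *\<^sub>R u x) \<le> norm (indicator K x + \<bar>u x\<bar> powr p)"
      using abs_le_one_plus_powr[OF p] by (intro AE_I2) (auto simp: indicator_def)
  qed
  then show "u absolutely_integrable_on K"
    by (simp add: set_integrable_def)
qed

lemma locally_integrable_mult_test:
  assumes u: "locally_integrable u" and z: "z \<in> test_functions"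
  shows "integrable lebesgue (\<lambda>x. u x * z x)"
proof -
  let ?K = "closure {x. z x \<noteq> 0}"
  obtain B where B: "\<And>x. \<bar>z x\<bar> \<le> B" using test_bounded[OF z] by blast
  have "compact ?K" using z by (simp add: test_functions_def)
  then have "integrable lebesgue (\<lambda>x. indicator ?K x *\<^sub>R u x)"
    using u by (simp add: locally_integrable_def set_integrable_def)
  then have "integrable lebesgue (\<lambda>x. (indicator ?K x *\<^sub>R u x) * z x)"
    by (rule integrable_mult_bounded[OF _ _ B]) (use test_borel[OF z] in \<open>simp add: measurable_completion\<close>)
  moreover have "(\<lambda>x. (indicator ?K x *\<^sub>R u x) * z x) = (\<lambda>x. u x * z x)"
    using closure_subset[of "{x. z x \<noteq> 0}"] by (auto simp: fun_eq_iff indicator_def)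
  ultimately show ?thesis by (simp only:)
qed

lemma lebesgue_integral_representative:
  fixes u g z :: "'a::euclidean_space \<Rightarrow> real"
  assumes "u \<in> borel_measurable lebesgue" and g: "g \<in> borel_measurable borel"
    and "AE x in lebesgue. u x = g x" and z: "z \<in> borel_measurable borel"
  shows "(LINT x|lebesgue. u x * z x) = (\<integral>x. g x * z x \<partial>lborel)"
proof -
  have zl: "z \<in> borel_measurable lebesgue" and gl: "g \<in> borel_measurable lebesgue"
    using z g by (simp_all add: measurable_completion)
  have "(LINT x|lebesgue. u x * z x) = (LINT x|lebesgue. g x * z x)"
  proof (rule integral_cong_AE)
    show "(\<lambda>x. u x * z x) \<in> borel_measurable lebesgue"
      using assms(1) zl by (rule borel_measurable_times)
    show "(\<lambda>x. g x * z x) \<in> borel_measurable lebesgue"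
      using gl zl by (rule borel_measurable_times)
    show "AE x in lebesgue. u x * z x = g x * z x"
      using assms(3) by eventually_elim simp
  qed
  also have "\<dots> = (\<integral>x. g x * z x \<partial>lborel)"
    using z g by (intro integral_completion) simp
  finally show ?thesis .
qed

text \<open>
  The defining property of weak derivatives, with the test function \<open>laplacian z\<close>, moves the remaining
  Laplacian to the test function.  It holds for whichever weak derivative is selected, so the
  choice of a representative does not matter.
\<close>

lemma weakly_solves_iff:
  fixes u f :: "real ^ 'n::finite \<Rightarrow> real"
  assumes p: "1 \<le> p" and u: "u \<in> sobolev_space 2 p" and f: "f \<in> Lp_space p"
  shows "weakly_solves \<mu> f u \<longleftrightarrow> (\<forall>z\<in>test_functions.
    (LINT x|lebesgue. u x * (laplacian (laplacian z) x + (- \<mu>) * z x)) = (LINT x|lebesgue. f x * z x))"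
proof -
  have "(LINT x|lebesgue. weak_laplacian u x * laplacian z x) = (LINT x|lebesgue. (\<mu> * u x + f x) * z x)
      \<longleftrightarrow> (LINT x|lebesgue. u x * (laplacian (laplacian z) x + (- \<mu>) * z x)) = (LINT x|lebesgue. f x * z x)"
    if z: "z \<in> test_functions" for z
  proof -
    have ul: "locally_integrable u" and fl: "locally_integrable f"
      using Lp_locally_integrable[OF p] u f by (auto simp: sobolev_space_def)
    have W: "has_weak_derivative u [i, i] (weak_derivative [i, i] u)" for i
    proof -
      have "\<exists>g. has_weak_derivative u [i, i] g"
        using u unfolding sobolev_space_def by (auto dest!: spec[of _ "[i, i]"])
      then show ?thesis
        unfolding weak_derivative_def by (rule someI_ex)
    qed
    have lz: "laplacian z \<in> test_functions" "laplacian (laplacian z) \<in> test_functions"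
      by (intro test_laplacian z)+
    have i1: "integrable lebesgue (\<lambda>x. weak_derivative [i, i] u x * laplacian z x)" for i
      using W lz by (intro locally_integrable_mult_test) (auto simp: has_weak_derivative_def)
    have i2: "integrable lebesgue (\<lambda>x. u x * iter_partial [i, i] (laplacian z) x)" for i
      by (intro locally_integrable_mult_test ul test_iter_partial lz)
    have i3: "integrable lebesgue (\<lambda>x. u x * laplacian (laplacian z) x)"
      "integrable lebesgue (\<lambda>x. u x * z x)" "integrable lebesgue (\<lambda>x. f x * z x)"
      by (intro locally_integrable_mult_test ul fl lz z)+
    have "(LINT x|lebesgue. weak_laplacian u x * laplacian z x)
        = (\<Sum>i\<in>UNIV. LINT x|lebesgue. weak_derivative [i, i] u x * laplacian z x)"
      unfolding weak_laplacian_def sum_distrib_right by (rule Bochner_Integration.integral_sum[OF i1])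
    also have "\<dots> = (\<Sum>i\<in>UNIV. LINT x|lebesgue. u x * iter_partial [i, i] (laplacian z) x)"
      using W lz unfolding has_weak_derivative_def by (intro sum.cong) auto
    also have "\<dots> = (LINT x|lebesgue. u x * laplacian (laplacian z) x)"
      unfolding laplacian_def[of "laplacian z"] sum_distrib_left
      by (rule Bochner_Integration.integral_sum[OF i2, symmetric])
    finally have 1: "(LINT x|lebesgue. weak_laplacian u x * laplacian z x)
      = (LINT x|lebesgue. u x * laplacian (laplacian z) x)" .
    have "(LINT x|lebesgue. (\<mu> * u x + f x) * z x) = (LINT x|lebesgue. \<mu> * (u x * z x) + f x * z x)"
      by (simp only: distrib_right mult.assoc)
    also have "\<dots> = \<mu> * (LINT x|lebesgue. u x * z x) + (LINT x|lebesgue. f x * z x)"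
      by (simp add: Bochner_Integration.integral_add[OF integrable_mult_right[OF i3(2)] i3(3)])
    finally have 2: "(LINT x|lebesgue. (\<mu> * u x + f x) * z x)
      = \<mu> * (LINT x|lebesgue. u x * z x) + (LINT x|lebesgue. f x * z x)" .
    have "(LINT x|lebesgue. u x * (laplacian (laplacian z) x + (- \<mu>) * z x))
        = (LINT x|lebesgue. u x * laplacian (laplacian z) x + (- \<mu>) * (u x * z x))"
      by (simp only: distrib_left mult.left_commute)
    also have "\<dots> = (LINT x|lebesgue. u x * laplacian (laplacian z) x) + (- \<mu>) * (LINT x|lebesgue. u x * z x)"
      by (subst Bochner_Integration.integral_add[OF i3(1) integrable_mult_right[OF i3(2)]])
         (simp only: integral_mult_right_zero)
    finally show ?thesis
      unfolding 1 2 by linarith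
  qed
  then show ?thesis
    unfolding weakly_solves_def by blast
qed

section \<open>Existence and uniqueness\<close>

text \<open>
  For \<open>is = []\<close> the solution operator of \<open>\<Delta>\<^sup>2 + s\<^sup>2\<close>, in general its derivative along \<open>is\<close>.
\<close>

definition resolvent :: "real \<Rightarrow> 'n::finite list \<Rightarrow> (real ^ 'n \<Rightarrow> real) \<Rightarrow> real ^ 'n \<Rightarrow> real" where
  "resolvent s is f = transport lborel parabolic (green_kernel s is) f"

context
  fixes s p :: real
  assumes s: "s > 0" and p: "2 \<le> p"
begin

lemma resolvent_Lp:
  assumes "length is \<le> 2" and "f \<in> borel_measurable borel" and "integrable lborel (\<lambda>x. \<bar>f x\<bar> powr p)"
  shows "resolvent s is f \<in> borel_measurable borel" and "resolvent s is f \<in> Lp_space p"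
proof -
  interpret transported_kernel lborel parabolic "green_kernel s is"
    by (rule green_kernel_transported[OF s assms(1)])
  show "resolvent s is f \<in> borel_measurable borel" "resolvent s is f \<in> Lp_space p"
    unfolding resolvent_def using p assms
    by (auto intro!: Lp_spaceI transport_powr_integrable transport_measurable)
qed

lemma resolvent_pairing:
  assumes len: "length is \<le> 2" and f: "f \<in> borel_measurable borel" "integrable lborel (\<lambda>x. \<bar>f x\<bar> powr p)"
    and \<phi>: "\<phi> \<in> test_functions"
  shows "(\<integral>x. resolvent s is f x * \<phi> x \<partial>lborel)
    = (\<integral>y. f y * (\<integral>\<omega>. green_kernel s is \<omega> * \<phi> (parabolic \<omega> + y) \<partial>lborel) \<partial>lborel)"
proof -
  interpret transported_kernel lborel parabolic "green_kernel s is"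
    by (rule green_kernel_transported[OF s len])
  obtain B where B: "\<And>x. \<bar>\<phi> x\<bar> \<le> B" using test_bounded[OF \<phi>] by blast
  show ?thesis
    unfolding resolvent_def
    using transport_duality[OF _ f test_integrable[OF \<phi>] B] kernel_pairing_swap[OF _ f test_integrable[OF \<phi>] B] p
    by simp
qed

lemma resolvent_weak_derivative:
  fixes "is" :: "'n::finite list"
  assumes len: "length is \<le> 2" and f: "f \<in> borel_measurable borel" "integrable lborel (\<lambda>x. \<bar>f x\<bar> powr p)"
  shows "has_weak_derivative (resolvent s [] f) is (resolvent s is f)"
  unfolding has_weak_derivative_def
proof (intro conjI ballI)
  show "locally_integrable (resolvent s [] f)" "locally_integrable (resolvent s is f)"
    using p len f by (auto intro!: Lp_locally_integrable[of p] resolvent_Lp)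
  fix \<phi> :: "real ^ 'n \<Rightarrow> real" assume \<phi>: "\<phi> \<in> test_functions"
  have shift: "(\<integral>\<omega>. green_kernel s [] \<omega> * iter_partial is \<phi> (parabolic \<omega> + y) \<partial>lborel)
      = (-1) ^ length is * (\<integral>\<omega>. green_kernel s is \<omega> * \<phi> (parabolic \<omega> + y) \<partial>lborel)" for y
    using green_kernel_iter_partial[OF s len test_translate[OF \<phi>, of y]]
      iter_partial_affine[OF test_smooth[OF \<phi>], of "is" y 1]
    by (simp add: add.commute)
  have "(LINT x|lebesgue. resolvent s [] f x * iter_partial is \<phi> x)
      = (\<integral>x. resolvent s [] f x * iter_partial is \<phi> x \<partial>lborel)"
    using resolvent_Lp(1)[of "[]", OF _ f] test_borel[OF test_iter_partial[OF \<phi>]]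
    by (intro integral_completion) simp
  also have "\<dots> = (\<integral>y. (-1) ^ length is * (f y * (\<integral>\<omega>. green_kernel s is \<omega> * \<phi> (parabolic \<omega> + y) \<partial>lborel)) \<partial>lborel)"
    by (subst resolvent_pairing[OF _ f test_iter_partial[OF \<phi>]]) (simp_all add: shift mult.left_commute)
  also have "\<dots> = (-1) ^ length is * (\<integral>x. resolvent s is f x * \<phi> x \<partial>lborel)"
    unfolding resolvent_pairing[OF len f \<phi>] by (rule integral_mult_right_zero)
  also have "(\<integral>x. resolvent s is f x * \<phi> x \<partial>lborel) = (LINT x|lebesgue. resolvent s is f x * \<phi> x)"
    using resolvent_Lp(1)[OF len f] test_borel[OF \<phi>]
    by (intro integral_completion[symmetric]) simp
  finally show "(LINT x|lebesgue. resolvent s [] f x * iter_partial is \<phi> x)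
      = (-1) ^ length is * (LINT x|lebesgue. resolvent s is f x * \<phi> x)" .
qed

lemma resolvent_sobolev:
  assumes f: "f \<in> borel_measurable borel" "integrable lborel (\<lambda>x. \<bar>f x\<bar> powr p)"
  shows "resolvent s [] f \<in> sobolev_space 2 p"
  unfolding sobolev_space_def
  using resolvent_Lp(2)[of _ f, OF _ f] resolvent_weak_derivative[OF _ f] by fastforce

lemma bilaplacian_translate:
  fixes z :: "real ^ 'n::finite \<Rightarrow> real"
  assumes "z \<in> test_functions"
  shows "laplacian (laplacian (\<lambda>x. z (y + x))) = (\<lambda>x. laplacian (laplacian z) (y + x))"
  using laplacian_affine[OF test_smooth[OF assms], of y 1]
    laplacian_affine[OF test_smooth[OF test_laplacian[OF assms]], of y 1] by simp

lemma green_kernel_reproduces: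
  fixes z :: "real ^ 'n::finite \<Rightarrow> real"
  assumes z: "z \<in> test_functions"
  shows "(\<integral>\<omega>. green_kernel s [] \<omega> * (laplacian (laplacian z) (parabolic \<omega> + y) + s\<^sup>2 * z (parabolic \<omega> + y)) \<partial>lborel) = z y"
proof -
  have zy: "(\<lambda>x. z (y + x)) \<in> test_functions" by (rule test_translate[OF z])
  have "(\<lambda>x. laplacian (laplacian (\<lambda>x. z (y + x))) x + s\<^sup>2 * z (y + x)) \<in> test_functions"
    by (intro test_combination test_laplacian zy)
  from green_kernel_fundamental[OF s zy this, unfolded bilaplacian_translate[OF z]] show ?thesis
    by (simp add: add.commute)
qed

lemma resolvent_equation:
  fixes f z :: "real ^ 'n::finite \<Rightarrow> real"
  assumes f: "f \<in> borel_measurable borel" "integrable lborel (\<lambda>x. \<bar>f x\<bar> powr p)" and z: "z \<in> test_functions"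
  shows "(\<integral>x. resolvent s [] f x * (laplacian (laplacian z) x + s\<^sup>2 * z x) \<partial>lborel) = (\<integral>x. f x * z x \<partial>lborel)"
  using resolvent_pairing[OF _ f test_combination[OF test_laplacian[OF test_laplacian[OF z]] z, of "s\<^sup>2"], of "[]"]
  by (simp add: green_kernel_reproduces[OF z])

text \<open>
  The right-hand side does not contain \<open>v\<close>, which is the uniqueness statement: \<open>\<eta>\<close> is reproduced by the
  kernel, Fubini's theorem brings the integral with \<open>v\<close> inside, and there the equation is applied to
  the translates of \<open>\<eta>\<close>.
\<close>

lemma solution_tested:
  fixes v f \<eta> :: "real ^ 'n::finite \<Rightarrow> real"
  assumes v: "v \<in> borel_measurable borel" "integrable lborel (\<lambda>x. \<bar>v x\<bar> powr p)"
    and eq: "\<And>z. z \<in> test_functions \<Longrightarrow>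
      (\<integral>x. v x * (laplacian (laplacian z) x + s\<^sup>2 * z x) \<partial>lborel) = (\<integral>x. f x * z x \<partial>lborel)"
    and \<eta>: "\<eta> \<in> test_functions"
  shows "(\<integral>x. v x * \<eta> x \<partial>lborel)
    = (\<integral>\<omega>. green_kernel s [] \<omega> * (\<integral>y. f y * \<eta> (parabolic \<omega> + y) \<partial>lborel) \<partial>lborel)"
proof -
  let ?L = "\<lambda>x. laplacian (laplacian \<eta>) x + s\<^sup>2 * \<eta> x"
  have L: "?L \<in> test_functions"
    by (intro test_combination test_laplacian \<eta>)
  obtain B where B: "\<And>x. \<bar>?L x\<bar> \<le> B" using test_bounded[OF L] by blast
  interpret transported_kernel lborel parabolic "green_kernel s ([] :: 'n list)"
    by (rule green_kernel_transported[OF s]) simp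
  have "(\<integral>x. v x * \<eta> x \<partial>lborel) = (\<integral>y. v y * (\<integral>\<omega>. green_kernel s [] \<omega> * ?L (parabolic \<omega> + y) \<partial>lborel) \<partial>lborel)"
    by (simp add: green_kernel_reproduces[OF \<eta>])
  also have "\<dots> = (\<integral>\<omega>. green_kernel s [] \<omega> * (\<integral>y. v y * ?L (parabolic \<omega> + y) \<partial>lborel) \<partial>lborel)"
    using p by (intro kernel_pairing_swap[OF _ v test_integrable[OF L] B, symmetric]) simp
  also have "\<dots> = (\<integral>\<omega>. green_kernel s [] \<omega> * (\<integral>y. f y * \<eta> (parabolic \<omega> + y) \<partial>lborel) \<partial>lborel)"
    using eq[OF test_translate[OF \<eta>], unfolded bilaplacian_translate[OF \<eta>]] by simp
  finally show ?thesis .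
qed

end

theorem lemma3p4:
  fixes p \<mu> :: real and f :: "real ^ 'n::finite \<Rightarrow> real"
  assumes "2 \<le> p" and "f \<in> Lp_space p" and "\<mu> < 0"
  shows "\<exists>u. (u \<in> sobolev_space 2 p \<and> weakly_solves \<mu> f u) \<and>
           (\<forall>v. v \<in> sobolev_space 2 p \<and> weakly_solves \<mu> f v \<longrightarrow>
                (AE x in lebesgue. v x = u x))"
proof -
  define s where "s = sqrt (- \<mu>)"
  have s: "s > 0" "s\<^sup>2 = - \<mu>" using assms(3) by (auto simp: s_def)
  have p: "1 \<le> p" using assms(1) by simp
  obtain g where g: "g \<in> borel_measurable borel" "AE x in lebesgue. f x = g x"
    "integrable lborel (\<lambda>x. \<bar>g x\<bar> powr p)"
    using Lp_spaceD[OF assms(2)] by blast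
  have fm: "f \<in> borel_measurable lebesgue" using assms(2) by (simp add: Lp_space_def)
  define u where "u = resolvent s [] g"
  have u_meas: "u \<in> borel_measurable borel" and u_Lp: "u \<in> Lp_space p"
    unfolding u_def using resolvent_Lp[OF s(1) assms(1) _ g(1,3), of "[]"] by simp_all
  have u_sob: "u \<in> sobolev_space 2 p"
    unfolding u_def by (rule resolvent_sobolev[OF s(1) assms(1) g(1,3)])
  have L: "(\<lambda>x. laplacian (laplacian z) x + s\<^sup>2 * z x) \<in> test_functions" if "z \<in> test_functions" for z :: "real ^ 'n \<Rightarrow> real"
    using that by (intro test_combination test_laplacian)
  have f_g: "(LINT x|lebesgue. f x * z x) = (\<integral>x. g x * z x \<partial>lborel)" if "z \<in> test_functions" for z
    by (rule lebesgue_integral_representative[OF fm g(1,2) test_borel[OF that]])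
  have u_eq: "(\<integral>x. u x * (laplacian (laplacian z) x + s\<^sup>2 * z x) \<partial>lborel) = (\<integral>x. g x * z x \<partial>lborel)"
    if "z \<in> test_functions" for z
    unfolding u_def by (rule resolvent_equation[OF s(1) assms(1) g(1,3) that])
  have u_solves: "weakly_solves \<mu> f u"
    unfolding weakly_solves_iff[OF p u_sob assms(2)]
  proof
    fix z :: "real ^ 'n \<Rightarrow> real" assume z: "z \<in> test_functions"
    have "(LINT x|lebesgue. u x * (laplacian (laplacian z) x + s\<^sup>2 * z x))
        = (\<integral>x. u x * (laplacian (laplacian z) x + s\<^sup>2 * z x) \<partial>lborel)"
      using u_meas test_borel[OF L[OF z]] by (intro integral_completion) simp
    then show "(LINT x|lebesgue. u x * (laplacian (laplacian z) x + (- \<mu>) * z x)) = (LINT x|lebesgue. f x * z x)"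
      using u_eq[OF z] f_g[OF z] s(2) by simp
  qed
  have u_int: "integrable lborel (\<lambda>x. \<bar>u x\<bar> powr p)"
    using u_Lp u_meas by (simp add: Lp_space_def integrable_completion)
  have "AE x in lebesgue. v x = u x" if v: "v \<in> sobolev_space 2 p" "weakly_solves \<mu> f v" for v
  proof -
    have v_Lp: "v \<in> Lp_space p" using v by (simp add: sobolev_space_def)
    then have vm: "v \<in> borel_measurable lebesgue" by (simp add: Lp_space_def)
    obtain w where w: "w \<in> borel_measurable borel" "AE x in lebesgue. v x = w x"
      "integrable lborel (\<lambda>x. \<bar>w x\<bar> powr p)"
      using Lp_spaceD[OF v_Lp] by blast
    have w_eq: "(\<integral>x. w x * (laplacian (laplacian z) x + s\<^sup>2 * z x) \<partial>lborel) = (\<integral>x. g x * z x \<partial>lborel)"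
      if z: "z \<in> test_functions" for z
      using v(2) z f_g[OF z] lebesgue_integral_representative[OF vm w(1,2) test_borel[OF L[OF z]]] s(2)
      unfolding weakly_solves_iff[OF p v(1) assms(2)] by simp
    have li: "locally_integrable w" "locally_integrable u"
      using w u_Lp by (auto intro!: Lp_locally_integrable[OF p] Lp_spaceI)
    have ti: "integrable lborel (\<lambda>x. h x * \<eta> x)"
      if "h \<in> borel_measurable borel" "locally_integrable h" "\<eta> \<in> test_functions" for h \<eta> :: "real ^ 'n \<Rightarrow> real"
      using locally_integrable_mult_test[OF that(2,3)] that(1) test_borel[OF that(3)]
      by (subst (asm) integrable_completion) auto
    have "AE x in lborel. w x - u x = 0"
    proof (rule AE_zero_if_test_integrals_zero)
      fix a b :: "real ^ 'n"
      have "h absolutely_integrable_on box a b" if "locally_integrable h" for h :: "real ^ 'n \<Rightarrow> real"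
        using that set_integrable_subset[of lebesgue "cbox a b" h "box a b"]
        by (auto simp: locally_integrable_def box_subset_cbox)
      then have "(\<lambda>x. w x - u x) absolutely_integrable_on box a b"
        using li by (intro set_integral_diff(1))
      then show "set_integrable lborel (box a b) (\<lambda>x. w x - u x)"
        unfolding set_integrable_def using w(1) u_meas by (subst (asm) integrable_completion) auto
      show "(\<lambda>x. w x - u x) \<in> borel_measurable borel" using w(1) u_meas by simp
    next
      fix \<eta> :: "real ^ 'n \<Rightarrow> real" assume \<eta>: "\<eta> \<in> test_functions"
      have "(\<integral>x. w x * \<eta> x \<partial>lborel) = (\<integral>x. u x * \<eta> x \<partial>lborel)"
        using solution_tested[OF s(1) assms(1) w(1,3) w_eq \<eta>]
          solution_tested[OF s(1) assms(1) u_meas u_int u_eq \<eta>] by simp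
      then show "(\<integral>x. (w x - u x) * \<eta> x \<partial>lborel) = 0"
        using ti[OF w(1) li(1) \<eta>] ti[OF u_meas li(2) \<eta>] by (simp add: left_diff_distrib)
    qed
    from AE_completion[OF this] w(2) show ?thesis
      by eventually_elim simp
  qed
  then show ?thesis
    using u_sob u_solves by blast
qed

end
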